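(* For all positive integers $t_1,t_2,r_2,r_3',r_3''$, all complex matrices $G_{21}\in\mathbb{C}^{r_2\times t_1}$, $G_{31}\in\mathbb{C}^{r_3'\times t_1}$, $G_{32}\in\mathbb{C}^{r_3''\times t_2}$, and every power $P$, the partial decode--forward bound $R_{\mathrm{PDF}}$, noncoherent partial decode--forward bound $R_{\mathrm{NPDF}}$, and cutset bound $R_{\mathrm{CS}}$ of the receiver frequency-division (RFD) MIMO relay channel satisfy $$R_{\mathrm{PDF}}=R_{\mathrm{NPDF}}$$ and consequently, with $\Delta_{\mathrm{PDF}}:=R_{\mathrm{CS}}-R_{\mathrm{PDF}}$ and $\Delta_{\mathrm{NPDF}}:=R_{\mathrm{CS}}-R_{\mathrm{NPDF}}$, $$\Delta_{\mathrm{PDF}}=\Delta_{\mathrm{NPDF}}\le\min(t_1,r_2).$$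
   Context: All logarithms are base 2, so rates and mutual informations are in bits. $(\cdot)^{\mathsf H}$ is the complex conjugate transpose. $P>0$ is the power constraint. RFD MIMO relay channel: the sender input is $\mathbf{X}_1\in\mathbb{C}^{t_1}$, the relay input is $\mathbf{X}_2\in\mathbb{C}^{t_2}$, the relay output is $\mathbf{Y}_2$, the receiver output is $\mathbf{Y}_3=(\mathbf{Y}_3',\mathbf{Y}_3'')$, and $$\mathbf{Y}_2=G_{21}\mathbf{X}_1+\mathbf{Z}_2,\qquad \mathbf{Y}_3'=G_{31}\mathbf{X}_1+\mathbf{Z}_3',\qquad \mathbf{Y}_3''=G_{32}\mathbf{X}_2+\mathbf{Z}_3'',$$ where $\mathbf{Z}_2\sim\mathrm{CN}(0,I_{r_2})$, $\mathbf{Z}_3'\sim\mathrm{CN}(0,I_{r_3'})$, $\mathbf{Z}_3''\sim\mathrm{CN}(0,I_{r_3''})$ are complex Gaussian, mutually independent and independent of the inputs (and of any auxiliary variable $\mathbf{U}$). Cutset bound: $$R_{\mathrm{CS}}=\sup_{F(\mathbf{x}_1,\mathbf{x}_2)}\min\{I(\mathbf{X}_1,\mathbf{X}_2;\mathbf{Y}_3),\ I(\mathbf{X}_1;\mathbf{Y}_2,\mathbf{Y}_3\mid\mathbf{X}_2)\}$$ over all joint distributions with $\mathsf{E}(\mathbf{X}_j^{\mathsf H}\mathbf{X}_j)\le P$, $j=1,2$. For this channel it equals $$\max_{K_1}\min\bigl\{\log|I_{r_3'}+G_{31}K_1G_{31}^{\mathsf H}|+\max_{K_2}\log|I_{r_3''}+G_{32}K_2G_{32}^{\mathsf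 H}|,\ \log|I_{t_1}+(G_{21}^{\mathsf H}G_{21}+G_{31}^{\mathsf H}G_{31})K_1|\bigr\}$$ over $K_1,K_2\succeq0$ with $\mathrm{tr}(K_j)\le P$, $j=1,2$. Partial decode--forward bound: $$R_{\mathrm{PDF}}=\sup\min\{I(\mathbf{X}_1,\mathbf{X}_2;\mathbf{Y}_3),\ I(\mathbf{U};\mathbf{Y}_2\mid\mathbf{X}_2)+I(\mathbf{X}_1;\mathbf{Y}_3\mid\mathbf{X}_2,\mathbf{U})\},$$ over all joint distributions $F(\mathbf{u},\mathbf{x}_1,\mathbf{x}_2)$ with $\mathsf{E}(\mathbf{X}_j^{\mathsf H}\mathbf{X}_j)\le P$, $j=1,2$, where $\mathbf{U}$ is an arbitrary auxiliary random vector. The noncoherent bound $R_{\mathrm{NPDF}}$ is the same supremum restricted to product distributions $F(\mathbf{u},\mathbf{x}_1)F(\mathbf{x}_2)$. *)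

theory Defs
  imports "HOL-Probability.Probability"
begin

(* Density of CN(0, I_n) on complex ^ 'n, normalised so that E (Z Z^H) = I_n,
   i.e. each real coordinate has variance 1/2. *)
definition std_complex_gaussian :: "(complex ^ ('n::finite)) measure" where
  "std_complex_gaussian =
     density lborel (\<lambda>z. ennreal (exp (- (norm z)\<^sup>2) / pi ^ CARD('n)))"

(* E (X^H X) \<le> P.  As an extended nonnegative integral, so that a variable X
   without a second moment does not satisfy the constraint. *)
definition power_constraint ::
    "real \<Rightarrow> 'w measure \<Rightarrow> ('w \<Rightarrow> complex ^ ('t::finite)) \<Rightarrow> bool" where
  "power_constraint P F X \<longleftrightarrow> (\<integral>\<^sup>+ w. ennreal ((norm (X w))\<^sup>2) \<partial>F) \<le> ennreal P"

(* F is the law of all transmitter-side variables w, that is (x1, x2) or ((u, x1), x2).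
   A point of the channel space is (w, z2, z3', z3''). *)
type_synonym ('w, 'r2, 'r3a, 'r3b) rfd_sample =
  "'w \<times> (complex ^ 'r2) \<times> (complex ^ 'r3a) \<times> (complex ^ 'r3b)"

definition rfd_space ::
    "'w measure \<Rightarrow> ('w, 'r2::finite, 'r3a::finite, 'r3b::finite) rfd_sample measure" where
  "rfd_space F = F \<Otimes>\<^sub>M std_complex_gaussian \<Otimes>\<^sub>M std_complex_gaussian \<Otimes>\<^sub>M std_complex_gaussian"

definition rfd_Y2 :: "complex ^ ('t1::finite) ^ ('r2::finite) \<Rightarrow> ('w \<Rightarrow> complex ^ 't1)
    \<Rightarrow> ('w, 'r2, 'r3a::finite, 'r3b::finite) rfd_sample \<Rightarrow> complex ^ 'r2" where
  "rfd_Y2 G21 X1 = (\<lambda>(w, z2, z3a, z3b). G21 *v X1 w + z2)"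

definition rfd_Y3 :: "complex ^ ('t1::finite) ^ ('r3a::finite)
    \<Rightarrow> complex ^ ('t2::finite) ^ ('r3b::finite)
    \<Rightarrow> ('w \<Rightarrow> complex ^ 't1) \<Rightarrow> ('w \<Rightarrow> complex ^ 't2)
    \<Rightarrow> ('w, 'r2::finite, 'r3a, 'r3b) rfd_sample
    \<Rightarrow> (complex ^ 'r3a) \<times> (complex ^ 'r3b)" where
  "rfd_Y3 G31 G32 X1 X2 =
     (\<lambda>(w, z2, z3a, z3b). (G31 *v X1 w + z3a, G32 *v X2 w + z3b))"

(* Mutual informations below are the library's, in bits.  The library defines
     I(A; B | C) = I(A; (B, C)) - I(A; C)
   with real values, which is meaningless if I(A; C) is infinite.  Conditional mutual
   information is symmetric in A and B, and the channel output is always put in the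
   position of A: I(X1; Y2, Y3 | X2) is written I(Y2, Y3; X1 | X2), and so on.
   (With the input in position A one would subtract e.g. I(X1; X2), which may be infinite.)
   In this order all terms are of the form I(output; function of (u, x1, x2)); because
   of the Gaussian noise and the power constraint the joint law is absolutely continuous
   with respect to the product of the marginals and the divergence is finite. *)

definition cutset_inputs ::
    "real \<Rightarrow> ((complex ^ ('t1::finite)) \<times> (complex ^ ('t2::finite))) measure set" where
  "cutset_inputs P = {F. prob_space F \<and> sets F = sets (borel \<Otimes>\<^sub>M borel) \<and>
     power_constraint P F fst \<and> power_constraint P F snd}"

definition cutset_rate :: "complex ^ ('t1::finite) ^ ('r2::finite) \<Rightarrow> complex ^ 't1 ^ ('r3a::finite)
    \<Rightarrow> complex ^ ('t2::finite) ^ ('r3b::finite)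
    \<Rightarrow> ((complex ^ 't1) \<times> (complex ^ 't2)) measure \<Rightarrow> real" where
  "cutset_rate G21 G31 G32 F =
    (let M = rfd_space F :: (_, 'r2, 'r3a, 'r3b) rfd_sample measure;
         X1 = (\<lambda>s. fst (fst s));
         X2 = (\<lambda>s. snd (fst s));
         Y2 = rfd_Y2 G21 fst;
         Y3 = rfd_Y3 G31 G32 fst snd
     in min
       (prob_space.mutual_information M 2
          (borel \<Otimes>\<^sub>M borel) (borel \<Otimes>\<^sub>M borel) (\<lambda>s. (X1 s, X2 s)) Y3)
       (prob_space.conditional_mutual_information M 2
          (borel \<Otimes>\<^sub>M (borel \<Otimes>\<^sub>M borel)) borel borel (\<lambda>s. (Y2 s, Y3 s)) X1 X2))"

definition R_CS :: "complex ^ ('t1::finite) ^ ('r2::finite) \<Rightarrow> complex ^ 't1 ^ ('r3a::finite)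
    \<Rightarrow> complex ^ ('t2::finite) ^ ('r3b::finite)
    \<Rightarrow> real \<Rightarrow> ereal" where
  "R_CS G21 G31 G32 P = (SUP F \<in> cutset_inputs P. ereal (cutset_rate G21 G31 G32 F))"

(* The auxiliary random vector U takes values in C^m with m arbitrary.  Since the suprema
   below range over m, vectors in C^m are functions on {..<m} rather than complex ^ 'm. *)
abbreviation aux_space :: "nat \<Rightarrow> (nat \<Rightarrow> complex) measure" where
  "aux_space m \<equiv> Pi\<^sub>M {..<m} (\<lambda>_. borel)"

type_synonym ('t1, 't2) pdf_input =
  "((nat \<Rightarrow> complex) \<times> (complex ^ 't1)) \<times> (complex ^ 't2)"

definition pdf_inputs :: "real \<Rightarrow> nat \<Rightarrow> ('t1::finite, 't2::finite) pdf_input measure set" where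
  "pdf_inputs P m = {F. prob_space F \<and>
     sets F = sets ((aux_space m \<Otimes>\<^sub>M borel) \<Otimes>\<^sub>M borel) \<and>
     power_constraint P F (\<lambda>w. snd (fst w)) \<and> power_constraint P F snd}"

definition npdf_inputs :: "real \<Rightarrow> nat \<Rightarrow> ('t1::finite, 't2::finite) pdf_input measure set" where
  "npdf_inputs P m = {F \<in> pdf_inputs P m.
     \<exists>F1 F2. prob_space F1 \<and> sets F1 = sets (aux_space m \<Otimes>\<^sub>M borel) \<and>
             prob_space F2 \<and> sets F2 = sets borel \<and> F = F1 \<Otimes>\<^sub>M F2}"

definition pdf_rate :: "complex ^ ('t1::finite) ^ ('r2::finite) \<Rightarrow> complex ^ 't1 ^ ('r3a::finite)
    \<Rightarrow> complex ^ ('t2::finite) ^ ('r3b::finite)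
    \<Rightarrow> nat \<Rightarrow> ('t1, 't2) pdf_input measure \<Rightarrow> real" where
  "pdf_rate G21 G31 G32 m F =
    (let M = rfd_space F :: (_, 'r2, 'r3a, 'r3b) rfd_sample measure;
         U = (\<lambda>s. fst (fst (fst s)));
         X1 = (\<lambda>s. snd (fst (fst s)));
         X2 = (\<lambda>s. snd (fst s));
         Y2 = rfd_Y2 G21 (\<lambda>w. snd (fst w));
         Y3 = rfd_Y3 G31 G32 (\<lambda>w. snd (fst w)) snd
     in min
       (prob_space.mutual_information M 2
          (borel \<Otimes>\<^sub>M borel) (borel \<Otimes>\<^sub>M borel) (\<lambda>s. (X1 s, X2 s)) Y3)
       (prob_space.conditional_mutual_information M 2
          borel (aux_space m) borel Y2 U X2 +
        prob_space.conditional_mutual_information M 2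
          (borel \<Otimes>\<^sub>M borel) borel (borel \<Otimes>\<^sub>M aux_space m) Y3 X1 (\<lambda>s. (X2 s, U s))))"

definition R_PDF :: "complex ^ ('t1::finite) ^ ('r2::finite) \<Rightarrow> complex ^ 't1 ^ ('r3a::finite)
    \<Rightarrow> complex ^ ('t2::finite) ^ ('r3b::finite)
    \<Rightarrow> real \<Rightarrow> ereal" where
  "R_PDF G21 G31 G32 P =
     (SUP m. SUP F \<in> pdf_inputs P m. ereal (pdf_rate G21 G31 G32 m F))"

definition R_NPDF :: "complex ^ ('t1::finite) ^ ('r2::finite) \<Rightarrow> complex ^ 't1 ^ ('r3a::finite)
    \<Rightarrow> complex ^ ('t2::finite) ^ ('r3b::finite)
    \<Rightarrow> real \<Rightarrow> ereal" where
  "R_NPDF G21 G31 G32 P =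
     (SUP m. SUP F \<in> npdf_inputs P m. ereal (pdf_rate G21 G31 G32 m F))"

definition \<Delta>_PDF :: "complex ^ ('t1::finite) ^ ('r2::finite) \<Rightarrow> complex ^ 't1 ^ ('r3a::finite)
    \<Rightarrow> complex ^ ('t2::finite) ^ ('r3b::finite)
    \<Rightarrow> real \<Rightarrow> ereal" where
  "\<Delta>_PDF G21 G31 G32 P = R_CS G21 G31 G32 P - R_PDF G21 G31 G32 P"

definition \<Delta>_NPDF :: "complex ^ ('t1::finite) ^ ('r2::finite) \<Rightarrow> complex ^ 't1 ^ ('r3a::finite)
    \<Rightarrow> complex ^ ('t2::finite) ^ ('r3b::finite)
    \<Rightarrow> real \<Rightarrow> ereal" where
  "\<Delta>_NPDF G21 G31 G32 P = R_CS G21 G31 G32 P - R_NPDF G21 G31 G32 P"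

end

theory Submission
  imports Defs
begin

text \<open>Write \<open>h(Y | V)\<close> for the conditional entropy of a noisy output. All mutual informations
  are differences of such entropies, and each inequality between them is an instance of Gibbs'
  inequality \<open>h(Y | V) \<le> - E ln q(Y, V)\<close> for a suitable subprobability density \<open>q\<close>.

  Noncoherent transmission loses nothing because \<open>U\<close> may be replaced by \<open>(U, X\<^sub>2)\<close> and \<open>X\<^sub>2\<close> by
  an independent copy: \<open>Y\<^sub>3''\<close> depends on \<open>X\<^sub>2\<close> alone, so neither term decreases.

  For the gap take any input of the cutset bound and let \<open>U = G\<^sub>2\<^sub>1 X\<^sub>1 + Z\<close> with a fresh copy \<open>Z\<close>
  of the relay noise. The loss is at most \<open>I(X\<^sub>1; Y\<^sub>2 | U) = h(Y\<^sub>2 | U) - h(Z\<^sub>2)\<close>. Given \<open>U\<close>, the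
  uncertainty about \<open>Y\<^sub>2\<close> is at most that of a noise of twice the variance on the range of \<open>G\<^sub>2\<^sub>1\<close>,
  which costs one bit per complex dimension of that range. No optimality of Gaussian inputs is needed.\<close>

section \<open>Gaussian noise\<close>

text \<open>The fresh noise \<open>Z\<close> has the law of the relay noise, so \<open>U\<close> can
  replace the relay output as side information on \<open>X1\<close> while staying independent of the
  channel noise, as an auxiliary must. The chain rule leaves h(Y3' | Y2) in the cutset term, the
  second term of the achieved rate contains h(Y3' | U), and the two agree; what remains of the
  difference is h(Y2 | U) - h(Z2). Every density is therefore taken with respect to Lebesgue measure
  on the output times the law of the side information. The noise makes such a density exist and
  bounded, and the power constraint makes its logarithm integrable, so that all differences of
  entropies are differences of real numbers. The gap is computed over the reals: each real dimension
  of the range of \<open>G21\<close> costs a factor sqrt 2, that is half a bit, and this range has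
  real dimension at most 2 min(t1, r2).\<close>

lemma norm_sq_eq_sum_inner:
  fixes z :: "'a::euclidean_space"
  shows "(norm z)\<^sup>2 = (\<Sum>b\<in>Basis. (z \<bullet> b)\<^sup>2)"
  unfolding power2_norm_eq_inner by (subst euclidean_inner) (simp add: power2_eq_square)

lemma nn_integral_exp_square:
  fixes a :: real
  assumes "a > 0"
  shows "(\<integral>\<^sup>+x. ennreal (exp (- (a * x\<^sup>2))) \<partial>lborel) = ennreal (sqrt (pi / a))"
proof -
  \<comment> \<open>The standard deviation for which the exponent is that of a centred normal
    density.\<close>
  define s where "s = 1 / sqrt (2 * a)"
  have s: "s > 0" "s\<^sup>2 = 1 / (2 * a)" using assms by (simp_all add: s_def power_divide)
  have eq: "exp (- (a * x\<^sup>2)) = sqrt (pi / a) * normal_density 0 s x" for x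
    using assms by (simp add: normal_density_def s)
  have "(\<integral>\<^sup>+x. ennreal (normal_density 0 s x) \<partial>lborel) = 1"
    by (subst nn_integral_eq_integral) (auto simp: s normal_density_nonneg)
  then show ?thesis
    unfolding eq using assms by (simp add: ennreal_mult nn_integral_cmult normal_density_nonneg)
qed

lemma nn_integral_exp_norm_square:
  fixes a :: real
  assumes "a > 0"
  shows "(\<integral>\<^sup>+z. ennreal (exp (- (a * (norm (z::'a::euclidean_space))\<^sup>2))) \<partial>lborel)
    = ennreal (sqrt (pi / a) ^ DIM('a))"
proof -
  have "(\<integral>\<^sup>+z. ennreal (exp (- (a * (norm (z::'a))\<^sup>2))) \<partial>lborel)
    = (\<integral>\<^sup>+z. (\<Prod>b\<in>Basis. ennreal (exp (- (a * (z \<bullet> b)\<^sup>2)))) \<partial>(lborel :: 'a measure))"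
    by (simp add: prod_ennreal exp_sum[symmetric] norm_sq_eq_sum_inner sum_distrib_left sum_negf)
  also have "\<dots> = (\<Prod>b\<in>(Basis :: 'a set). ennreal (sqrt (pi / a)))"
    by (subst nn_integral_lborel_prod) (simp_all add: nn_integral_exp_square assms)
  also have "\<dots> = ennreal (sqrt (pi / a) ^ DIM('a))"
    using assms by (simp add: ennreal_power)
  finally show ?thesis .
qed

lemma nn_integral_lborel_shift:
  fixes c :: "'a::euclidean_space"
  assumes [measurable]: "f \<in> borel_measurable borel"
  shows "(\<integral>\<^sup>+x. f (c + x) \<partial>lborel) = (\<integral>\<^sup>+x. f x \<partial>lborel)"
  by (subst (2) lborel_distr_plus[of c, symmetric]) (simp add: nn_integral_distr)

text \<open>Each real coordinate has variance 1/2, so on \<open>complex ^ 'n\<close>, of real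
  dimension 2n, the constant is pi^n as in \<open>std_complex_gaussian\<close>. Allowing every
  Euclidean space lets one notion cover single outputs, tuples of outputs and a real-valued
  dummy.\<close>

definition gauss_density :: "'a::euclidean_space \<Rightarrow> real" where
  "gauss_density z = exp (- (norm z)\<^sup>2) / sqrt pi ^ DIM('a)"

definition gaussian :: "'a::euclidean_space measure" where
  "gaussian = density lborel (\<lambda>z. ennreal (gauss_density z))"

lemma gauss_density_pos: "gauss_density z > 0"
  by (simp add: gauss_density_def)

lemma gauss_density_nonneg [simp]: "gauss_density z \<ge> 0"
  using gauss_density_pos[of z] by simp

lemma gauss_density_le: "gauss_density (z::'a::euclidean_space) \<le> 1 / sqrt pi ^ DIM('a)"
  by (simp add: gauss_density_def divide_right_mono)

lemma borel_measurable_gauss_density [measurable]: "gauss_density \<in> borel_measurable borel"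
  unfolding gauss_density_def[abs_def] by measurable

lemma ln_gauss_density:
  "ln (gauss_density (z::'a::euclidean_space)) = - (real DIM('a) * ln (sqrt pi)) - (norm z)\<^sup>2"
  by (simp add: gauss_density_def ln_div ln_realpow)

lemma sets_gaussian [measurable_cong, simp]: "sets gaussian = sets borel"
  by (simp add: gaussian_def)

lemma space_gaussian [simp]: "space gaussian = UNIV"
  by (simp add: gaussian_def)

lemma nn_integral_gauss_density: "(\<integral>\<^sup>+z. ennreal (gauss_density (z::'a::euclidean_space)) \<partial>lborel) = 1"
proof -
  have "(\<integral>\<^sup>+z. ennreal (gauss_density (z::'a)) \<partial>lborel)
    = (\<integral>\<^sup>+z. ennreal (exp (- (1 * (norm (z::'a))\<^sup>2))) * ennreal (1 / sqrt pi ^ DIM('a)) \<partial>lborel)"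
    by (simp add: gauss_density_def ennreal_mult[symmetric])
  also have "\<dots> = ennreal (sqrt (pi / 1) ^ DIM('a)) * ennreal (1 / sqrt pi ^ DIM('a))"
    by (subst nn_integral_multc, simp, subst nn_integral_exp_norm_square) simp_all
  finally show ?thesis by (simp add: ennreal_mult[symmetric])
qed

lemma nn_integral_gauss_density_shift:
  "(\<integral>\<^sup>+y. ennreal (gauss_density (y - c)) \<partial>(lborel::'a::euclidean_space measure)) = 1"
  using nn_integral_lborel_shift[of "\<lambda>z. ennreal (gauss_density z)" "- c"]
  by (simp add: nn_integral_gauss_density)

interpretation gaussian: prob_space "gaussian :: 'a::euclidean_space measure"
  by standard (simp add: gaussian_def emeasure_density nn_integral_gauss_density)

lemma nn_integral_gaussian:
  assumes [measurable]: "h \<in> borel_measurable borel"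
  shows "(\<integral>\<^sup>+z. h z \<partial>gaussian) = (\<integral>\<^sup>+z. ennreal (gauss_density z) * h z \<partial>lborel)"
  unfolding gaussian_def by (subst nn_integral_density) simp_all

lemma std_complex_gaussian_eq: "std_complex_gaussian = (gaussian :: (complex ^ 'n::finite) measure)"
  by (simp add: std_complex_gaussian_def gaussian_def gauss_density_def real_sqrt_power[symmetric] power_mult)

text \<open>Norms of pairs add in squares and dimensions add, so independent noises merge into one
  noise on the product type. This turns several outputs into one vector-valued observation.\<close>

lemma gaussian_prod:
  "(gaussian :: 'a::euclidean_space measure) \<Otimes>\<^sub>M (gaussian :: 'b::euclidean_space measure) = gaussian"
proof -
  have "gauss_density a * gauss_density b = gauss_density (a, b)" for a :: 'a and b :: 'b
    by (simp add: gauss_density_def norm_Pair power_add exp_add[symmetric] algebra_simps)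
  then show ?thesis
    unfolding gaussian_def
    by (subst pair_measure_density)
       (auto simp: lborel_prod ennreal_mult[symmetric] sigma_finite_lborel case_prod_unfold
         intro!: density_cong prob_space_imp_sigma_finite gaussian.prob_space_axioms[unfolded gaussian_def])
qed

lemma integrable_gaussian_norm_square:
  "integrable gaussian (\<lambda>z. (norm (z::'a::euclidean_space))\<^sup>2)"
proof (rule integrableI_nonneg)
  \<comment> \<open>Half of the Gaussian exponent absorbs the factor |z|^2, because t \<le> 2 exp (t
    / 2).\<close>
  have b: "gauss_density z * (norm z)\<^sup>2 \<le> 2 * exp (- ((1/2) * (norm z)\<^sup>2)) / sqrt pi ^ DIM('a)" for z :: 'a
  proof -
    have "(norm z)\<^sup>2 / 2 \<le> exp ((norm z)\<^sup>2 / 2)"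
      using exp_ge_add_one_self[of "(norm z)\<^sup>2 / 2"] by linarith
    then have "exp (- (norm z)\<^sup>2) * (norm z)\<^sup>2 \<le> exp (- (norm z)\<^sup>2) * (2 * exp ((norm z)\<^sup>2 / 2))"
      by (intro mult_left_mono) auto
    also have "\<dots> = 2 * exp (- ((1/2) * (norm z)\<^sup>2))"
      by (simp add: exp_add[symmetric] mult.left_commute)
    finally show ?thesis by (simp add: gauss_density_def divide_right_mono)
  qed
  have "(\<integral>\<^sup>+z. ennreal ((norm (z::'a))\<^sup>2) \<partial>gaussian)
    \<le> (\<integral>\<^sup>+z. ennreal (2 / sqrt pi ^ DIM('a)) * ennreal (exp (- ((1/2) * (norm (z::'a))\<^sup>2))) \<partial>lborel)"
    by (subst nn_integral_gaussian, simp, intro nn_integral_mono)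
       (use b in \<open>simp add: ennreal_mult[symmetric]\<close>)
  also have "\<dots> < \<infinity>"
    by (subst nn_integral_cmult, simp, subst nn_integral_exp_norm_square)
       (simp_all add: ennreal_mult[symmetric])
  finally show "(\<integral>\<^sup>+z. ennreal ((norm (z::'a))\<^sup>2) \<partial>gaussian) < \<infinity>" .
qed simp_all

text \<open>Reflection symmetry of the noise, from which the vanishing mean follows without
  evaluating any coordinate integral.\<close>

lemma gaussian_distr_uminus: "distr gaussian borel uminus = (gaussian :: 'a::euclidean_space measure)"
proof -
  have l: "distr lborel borel uminus = (lborel :: 'a measure)"
    by (subst (2) lborel_affine[of "-1" 0]) (auto simp: density_1 one_ennreal_def[symmetric])
  show ?thesis
  proof (rule measure_eqI)
    fix A :: "'a set" assume "A \<in> sets (distr gaussian borel uminus)"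
    then have [measurable]: "A \<in> sets borel" by simp
    have "emeasure (distr gaussian borel uminus) A = (\<integral>\<^sup>+z. indicator A (- z) \<partial>gaussian)"
      by (subst nn_integral_indicator[symmetric]) (simp, subst nn_integral_distr, simp_all)
    also have "\<dots> = (\<integral>\<^sup>+z. ennreal (gauss_density (- z)) * indicator A (- z) \<partial>lborel)"
      by (subst nn_integral_gaussian) (simp_all add: gauss_density_def)
    also have "\<dots> = (\<integral>\<^sup>+z. ennreal (gauss_density z) * indicator A z \<partial>distr lborel borel uminus)"
      by (subst nn_integral_distr) simp_all
    also have "\<dots> = emeasure gaussian A"
      unfolding l by (simp add: gaussian_def emeasure_density)
    finally show "emeasure (distr gaussian borel uminus) A = emeasure gaussian A" .
  qed simp
qed

lemma integral_gaussian_inner: "(\<integral>z. z \<bullet> (b::'a::euclidean_space) \<partial>gaussian) = 0"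
proof -
  have "(\<integral>z. z \<bullet> b \<partial>gaussian) = (\<integral>z. z \<bullet> b \<partial>distr gaussian borel uminus)"
    by (simp add: gaussian_distr_uminus)
  also have "\<dots> = - (\<integral>z. z \<bullet> b \<partial>gaussian)"
    by (subst integral_distr) simp_all
  finally show ?thesis by simp
qed

section \<open>Exponential moments of the noise\<close>

lemma nn_integral_gaussian_exp_inner:
  "(\<integral>\<^sup>+z. ennreal (exp (2 * (v \<bullet> z))) \<partial>gaussian) = ennreal (exp ((norm (v::'a::euclidean_space))\<^sup>2))"
proof -
  \<comment> \<open>Completing the square: the exponential tilt is a shift of the mean by
    \<open>v\<close>, at the price of the factor exp |v|^2.\<close>
  have e: "gauss_density z * exp (2 * (v \<bullet> z)) = exp ((norm v)\<^sup>2) * gauss_density (z - v)" for z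
    by (simp add: gauss_density_def exp_add[symmetric] power2_norm_eq_inner inner_diff inner_commute
      algebra_simps)
  have "(\<integral>\<^sup>+z. ennreal (exp (2 * (v \<bullet> z))) \<partial>gaussian)
    = (\<integral>\<^sup>+z. ennreal (exp ((norm v)\<^sup>2)) * ennreal (gauss_density (z - v)) \<partial>lborel)"
    by (subst nn_integral_gaussian) (simp_all add: ennreal_mult[symmetric] e)
  then show ?thesis
    by (subst (asm) nn_integral_cmult) (simp_all add: nn_integral_gauss_density_shift)
qed

text \<open>The tilt halves the exponent and so doubles the variance. Each real coordinate
  contributes sqrt 2, which is where the constant of the gap comes from.\<close>

lemma nn_integral_gaussian_exp_half_square:
  "(\<integral>\<^sup>+z. ennreal (exp ((norm (z::'a::euclidean_space))\<^sup>2 / 2)) \<partial>gaussian) = ennreal (sqrt 2 ^ DIM('a))"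
proof -
  have e: "gauss_density z * exp ((norm z)\<^sup>2 / 2) = (1 / sqrt pi ^ DIM('a)) * exp (- ((1/2) * (norm z)\<^sup>2))" for z :: 'a
    by (simp add: gauss_density_def exp_add[symmetric])
  have "(\<integral>\<^sup>+z. ennreal (exp ((norm (z::'a))\<^sup>2 / 2)) \<partial>gaussian)
    = (\<integral>\<^sup>+z. ennreal (1 / sqrt pi ^ DIM('a)) * ennreal (exp (- ((1/2) * (norm (z::'a))\<^sup>2))) \<partial>lborel)"
    by (subst nn_integral_gaussian, simp) (intro nn_integral_cong, simp add: ennreal_mult[symmetric] e)
  also have "\<dots> = ennreal (1 / sqrt pi ^ DIM('a)) * ennreal (sqrt (pi / (1/2)) ^ DIM('a))"
    by (subst nn_integral_cmult, simp, subst nn_integral_exp_norm_square) simp_all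
  also have "\<dots> = ennreal (sqrt 2 ^ DIM('a))"
    by (simp add: ennreal_mult[symmetric] real_sqrt_mult power_mult_distrib)
  finally show ?thesis .
qed

text \<open>The square in the exponent is linearised by \<open>exp |v|\<^sup>2 = E exp (2 v \<bullet> W)\<close>, which avoids any appeal
  to the invariance of \<open>lborel\<close> under orthogonal maps.\<close>

lemma nn_integral_gaussian_exp_projection_le:
  fixes B :: "'a::euclidean_space set"
  assumes fin: "finite B" and orth: "pairwise orthogonal B" and unit: "\<And>b. b \<in> B \<Longrightarrow> norm b = 1"
    and card: "card B \<le> DIM('b::euclidean_space)"
  shows "(\<integral>\<^sup>+z. ennreal (exp ((\<Sum>b\<in>B. (z \<bullet> b)\<^sup>2) / 2)) \<partial>gaussian) \<le> ennreal (sqrt 2 ^ DIM('b))"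
proof -
  \<comment> \<open>The elements of \<open>B\<close> are matched with distinct coordinates of an
    auxiliary Gaussian vector on \<open>'b\<close>; there are enough of them by
    \<open>card\<close>.\<close>
  obtain e where e: "e ` B \<subseteq> (Basis :: 'b set)" "inj_on e B"
    using card_le_inj[OF fin finite_Basis card] by blast
  \<comment> \<open>The factor 1 / sqrt 2 makes |v z|^2 the wanted exponent. The map
    \<open>u\<close> is the adjoint of \<open>v\<close>, so after exchanging the integrals the inner
    one is again an exponential moment, now with exponent |u w|^2 \<le> |w|^2 / 2.\<close>
  define v where "v z = (\<Sum>b\<in>B. ((z \<bullet> b) / sqrt 2) *\<^sub>R e b)" for z
  define u where "u w = (\<Sum>b\<in>B. ((w \<bullet> e b) / sqrt 2) *\<^sub>R b)" for w
  have eb: "norm (e b) = 1" if "b \<in> B" for b using e that by auto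
  have ee: "e x \<bullet> e y = 0" if "x \<in> B" "y \<in> B" "x \<noteq> y" for x y
    using e that by (subst inner_Basis) (auto simp: inj_on_def)
  have v: "(norm (v z))\<^sup>2 = (\<Sum>b\<in>B. (z \<bullet> b)\<^sup>2) / 2" for z
    unfolding v_def
    by (subst norm_sum_Pythagorean)
       (auto simp: fin pairwise_def orthogonal_def eb ee power_divide sum_divide_distrib power_mult_distrib)
  have u: "(norm (u w))\<^sup>2 \<le> (norm w)\<^sup>2 / 2" for w
  proof -
    have "(norm (u w))\<^sup>2 = (\<Sum>b\<in>B. (w \<bullet> e b)\<^sup>2) / 2"
      unfolding u_def
      by (subst norm_sum_Pythagorean)
         (use orth in \<open>auto simp: fin pairwise_def orthogonal_def unit power_divide sum_divide_distrib
          power_mult_distrib\<close>)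
    also have "(\<Sum>b\<in>B. (w \<bullet> e b)\<^sup>2) = (\<Sum>c\<in>e ` B. (w \<bullet> c)\<^sup>2)"
      using e by (simp add: sum.reindex)
    also have "\<dots> \<le> (norm w)\<^sup>2"
      unfolding norm_sq_eq_sum_inner by (rule sum_mono2) (use e in auto)
    finally show ?thesis by simp
  qed
  have adj: "v z \<bullet> w = u w \<bullet> z" for z w
    unfolding v_def u_def inner_sum_left by (rule sum.cong) (simp_all add: inner_commute mult.commute)
  have [measurable]: "v \<in> borel_measurable borel" "u \<in> borel_measurable borel"
    unfolding v_def u_def by simp_all
  interpret P: pair_sigma_finite "gaussian :: 'a measure" "gaussian :: 'b measure" ..
  have "(\<integral>\<^sup>+z. ennreal (exp ((\<Sum>b\<in>B. (z \<bullet> b)\<^sup>2) / 2)) \<partial>gaussian)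
    = (\<integral>\<^sup>+z. (\<integral>\<^sup>+w. ennreal (exp (2 * (v z \<bullet> w))) \<partial>gaussian) \<partial>gaussian)"
    by (simp add: nn_integral_gaussian_exp_inner v)
  also have "\<dots> = (\<integral>\<^sup>+w. (\<integral>\<^sup>+z. ennreal (exp (2 * (u w \<bullet> z))) \<partial>gaussian) \<partial>gaussian)"
    by (subst P.Fubini'[symmetric]) (simp_all add: adj)
  also have "\<dots> \<le> (\<integral>\<^sup>+w. ennreal (exp ((norm (w::'b))\<^sup>2 / 2)) \<partial>gaussian)"
    by (intro nn_integral_mono) (unfold nn_integral_gaussian_exp_inner, intro ennreal_leI, simp only: exp_le_cancel_iff u)
  finally show ?thesis by (simp add: nn_integral_gaussian_exp_half_square)
qed

section \<open>Integrals that depend on one factor of a product\<close>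

lemma integral_pair_fst:
  fixes f :: "_ \<Rightarrow> real"
  assumes "prob_space B" "integrable A f"
  shows "integrable (A \<Otimes>\<^sub>M B) (\<lambda>x. f (fst x))" "(\<integral>x. f (fst x) \<partial>(A \<Otimes>\<^sub>M B)) = (\<integral>x. f x \<partial>A)"
proof -
  have d: "distr (A \<Otimes>\<^sub>M B) A fst = A" by (rule prob_space.distr_pair_fst) fact
  show "integrable (A \<Otimes>\<^sub>M B) (\<lambda>x. f (fst x))"
    by (rule integrable_distr[of fst _ A]) (use assms d in auto)
  show "(\<integral>x. f (fst x) \<partial>(A \<Otimes>\<^sub>M B)) = (\<integral>x. f x \<partial>A)"
    by (subst d[symmetric], subst integral_distr) (use assms in auto)
qed

lemma distr_pair_snd:
  assumes "prob_space A" "sigma_finite_measure B"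
  shows "distr (A \<Otimes>\<^sub>M B) B snd = B"
proof (rule measure_eqI)
  interpret A: prob_space A by fact
  interpret B: sigma_finite_measure B by fact
  fix X assume X: "X \<in> sets (distr (A \<Otimes>\<^sub>M B) B snd)"
  have "emeasure (distr (A \<Otimes>\<^sub>M B) B snd) X = emeasure (A \<Otimes>\<^sub>M B) (space A \<times> X)"
    using X by (auto simp: emeasure_distr space_pair_measure dest: sets.sets_into_space intro!: arg_cong2[where f=emeasure])
  then show "emeasure (distr (A \<Otimes>\<^sub>M B) B snd) X = emeasure B X"
    using X by (simp add: B.emeasure_pair_measure_Times A.emeasure_space_1)
qed simp

lemma integral_pair_snd:
  fixes f :: "_ \<Rightarrow> real"
  assumes "prob_space A" "prob_space B" "integrable B f"
  shows "integrable (A \<Otimes>\<^sub>M B) (\<lambda>x. f (snd x))" "(\<integral>x. f (snd x) \<partial>(A \<Otimes>\<^sub>M B)) = (\<integral>x. f x \<partial>B)"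
proof -
  have d: "distr (A \<Otimes>\<^sub>M B) B snd = B"
    by (rule distr_pair_snd) (use assms in \<open>auto intro: prob_space_imp_sigma_finite\<close>)
  show "integrable (A \<Otimes>\<^sub>M B) (\<lambda>x. f (snd x))"
    by (rule integrable_distr[of snd _ B]) (use assms d in auto)
  show "(\<integral>x. f (snd x) \<partial>(A \<Otimes>\<^sub>M B)) = (\<integral>x. f x \<partial>B)"
    by (subst d[symmetric], subst integral_distr) (use assms in auto)
qed

section \<open>Conditional entropy of a noisy observation\<close>

text \<open>Apply ln t \<le> t - 1 to t = q / f. Under \<open>L\<close> the ratio has integral at
  most 1, because the density \<open>f\<close> of \<open>L\<close> cancels the denominator.\<close>

lemma gibbs_inequality:
  fixes f q :: "'x \<Rightarrow> real"
  assumes L: "prob_space L" "L = density B (\<lambda>x. ennreal (f x))"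
    and f[measurable]: "f \<in> borel_measurable B" and f0: "\<And>x. f x \<ge> 0"
    and q[measurable]: "q \<in> borel_measurable B" and q0: "\<And>x. q x \<ge> 0"
    and le: "(\<integral>\<^sup>+x. ennreal (q x) \<partial>B) \<le> 1"
    and pos: "AE x in L. q x > 0"
    and int: "integrable L (\<lambda>x. ln (f x))" "integrable L (\<lambda>x. ln (q x))"
  shows "(\<integral>x. ln (q x) \<partial>L) \<le> (\<integral>x. ln (f x) \<partial>L)"
proof -
  interpret prob_space L by fact
  have fpos: "AE x in L. f x > 0"
    unfolding L(2) by (subst AE_density) (auto simp: f0 less_le)
  have m: "borel_measurable L = borel_measurable B"
    by (rule measurable_cong_sets) (simp_all add: L(2))
  have "(\<integral>\<^sup>+x. ennreal (q x / f x) \<partial>L) = (\<integral>\<^sup>+x. ennreal (f x) * ennreal (q x / f x) \<partial>B)"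
    unfolding L(2) by (rule nn_integral_density) measurable
  \<comment> \<open>The left integrand vanishes wherever \<open>f\<close> does, whatever
    \<open>q\<close> is there, so in general only an inequality holds.\<close>
  also have "\<dots> \<le> (\<integral>\<^sup>+x. ennreal (q x) \<partial>B)"
    by (intro nn_integral_mono) (auto simp: ennreal_mult[symmetric] f0 q0)
  finally have r1: "(\<integral>\<^sup>+x. ennreal (q x / f x) \<partial>L) \<le> 1" using le by simp
  have r: "integrable L (\<lambda>x. q x / f x)"
    by (rule integrableI_nonneg) (use r1 in \<open>auto simp: f0 q0 m intro: le_less_trans\<close>)
  have "ennreal (\<integral>x. q x / f x \<partial>L) \<le> 1"
    using r1 by (subst nn_integral_eq_integral[symmetric, OF r]) (auto simp: f0 q0)
  then have r2: "(\<integral>x. q x / f x \<partial>L) \<le> 1" by (simp add: ennreal_le_1)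
  have "(\<integral>x. ln (q x) \<partial>L) - (\<integral>x. ln (f x) \<partial>L) = (\<integral>x. ln (q x) - ln (f x) \<partial>L)"
    using int by simp
  also have "\<dots> \<le> (\<integral>x. q x / f x - 1 \<partial>L)"
  proof (rule integral_mono_AE)
    show "AE x in L. ln (q x) - ln (f x) \<le> q x / f x - 1"
      using fpos pos
    proof eventually_elim
      case (elim x)
      then show ?case using ln_le_minus_one[of "q x / f x"] by (simp add: ln_div)
    qed
  qed (use int r in auto)
  also have "\<dots> \<le> 0" using r r2 by (simp add: prob_space)
  finally show ?thesis by simp
qed

definition channel :: "'w measure \<Rightarrow> 'v measure \<Rightarrow> ('w \<Rightarrow> 'a::euclidean_space) \<Rightarrow> ('w \<Rightarrow> 'v)
    \<Rightarrow> ('a \<times> 'v) measure" where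
  "channel F N g V = distr (F \<Otimes>\<^sub>M gaussian) (borel \<Otimes>\<^sub>M N) (\<lambda>(w, z). (g w + z, V w))"

text \<open>\<open>f (y, v)\<close> is the conditional density of \<open>y = g + z\<close> given \<open>V = v\<close>, with the law of \<open>V\<close>
  as reference measure on the second component.\<close>

definition is_density :: "'w measure \<Rightarrow> 'v measure \<Rightarrow> ('w \<Rightarrow> 'a::euclidean_space) \<Rightarrow> ('w \<Rightarrow> 'v)
    \<Rightarrow> ('a \<times> 'v \<Rightarrow> real) \<Rightarrow> bool" where
  "is_density F N g V f \<longleftrightarrow> f \<in> borel_measurable (borel \<Otimes>\<^sub>M N) \<and> (\<forall>x. 0 \<le> f x) \<and> (\<exists>C. \<forall>x. f x \<le> C) \<and>
     channel F N g V = density (lborel \<Otimes>\<^sub>M distr F N V) (\<lambda>x. ennreal (f x))"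

lemma is_densityI:
  assumes "f \<in> borel_measurable (borel \<Otimes>\<^sub>M N)" "\<And>x. 0 \<le> f x" "\<And>x. f x \<le> C"
    and "channel F N g V = density (lborel \<Otimes>\<^sub>M distr F N V) (\<lambda>x. ennreal (f x))"
  shows "is_density F N g V f"
  unfolding is_density_def using assms by blast

lemma is_densityD:
  assumes "is_density F N g V f"
  shows "f \<in> borel_measurable (borel \<Otimes>\<^sub>M N)" "0 \<le> f x" "\<exists>C. \<forall>x. f x \<le> C"
    and "channel F N g V = density (lborel \<Otimes>\<^sub>M distr F N V) (\<lambda>x. ennreal (f x))"
    and "f \<in> borel_measurable (lborel \<Otimes>\<^sub>M distr F N V)"
proof -
  show "f \<in> borel_measurable (borel \<Otimes>\<^sub>M N)"
    "channel F N g V = density (lborel \<Otimes>\<^sub>M distr F N V) (\<lambda>x. ennreal (f x))" "\<exists>C. \<forall>x. f x \<le> C"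
    using assms unfolding is_density_def by blast+
  then show "f \<in> borel_measurable (lborel \<Otimes>\<^sub>M distr F N V)"
    by (subst measurable_cong_sets[OF sets_pair_measure_cong refl]) auto
  show "0 \<le> f x" using assms unfolding is_density_def by blast
qed

text \<open>\<open>h(g + Z | V)\<close> in nats\<close>

definition ent :: "'w measure \<Rightarrow> 'v measure \<Rightarrow> ('w \<Rightarrow> 'a::euclidean_space) \<Rightarrow> ('w \<Rightarrow> 'v) \<Rightarrow> real" where
  "ent F N g V = - (\<integral>x. ln ((SOME f. is_density F N g V f) x) \<partial>channel F N g V)"

text \<open>The second moment makes the logarithm of the noise density integrable under the law of
  the output, and comparison with that density is what keeps the entropy finite.\<close>

locale awgn = prob_space F for F :: "'w measure" +
  fixes N :: "'v measure" and g :: "'w \<Rightarrow> 'a::euclidean_space" and V :: "'w \<Rightarrow> 'v"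
  assumes g[measurable]: "g \<in> borel_measurable F" and V[measurable]: "V \<in> measurable F N"
    and g_square: "integrable F (\<lambda>w. (norm (g w))\<^sup>2)"
begin

sublocale FG: pair_prob_space F "gaussian :: 'a measure" ..

sublocale FL: pair_sigma_finite F "lborel :: 'a measure" ..

sublocale K: prob_space "distr F N V"
  by (rule prob_space_distr) simp

sublocale LK: pair_sigma_finite "lborel :: 'a measure" "distr F N V" ..

lemma sets_channel [measurable_cong, simp]: "sets (channel F N g V) = sets (borel \<Otimes>\<^sub>M N)"
  by (simp add: channel_def)

lemma sets_base [measurable_cong, simp]: "sets (lborel \<Otimes>\<^sub>M distr F N V) = sets (borel \<Otimes>\<^sub>M N)"
  by (intro sets_pair_measure_cong) simp_all

lemma prob_space_channel: "prob_space (channel F N g V)"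
  unfolding channel_def by (rule FG.prob_space_distr) simp

text \<open>Substituting y = g w + z replaces the noise by the kernel
  \<open>gauss_density (y - g w)\<close> against Lebesgue measure, the form in which the law can be
  compared with the reference measure.\<close>

lemma nn_integral_channel:
  assumes [measurable]: "h \<in> borel_measurable (borel \<Otimes>\<^sub>M N)"
  shows "(\<integral>\<^sup>+x. h x \<partial>channel F N g V)
    = (\<integral>\<^sup>+w. (\<integral>\<^sup>+y. ennreal (gauss_density (y - g w)) * h (y, V w) \<partial>lborel) \<partial>F)"
proof -
  have "(\<integral>\<^sup>+x. h x \<partial>channel F N g V) = (\<integral>\<^sup>+w. (\<integral>\<^sup>+z. h (g w + z, V w) \<partial>gaussian) \<partial>F)"
    unfolding channel_def
    by (subst nn_integral_distr) (simp_all add: case_prod_unfold gaussian.nn_integral_fst[symmetric])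
  also have "\<dots> = (\<integral>\<^sup>+w. (\<integral>\<^sup>+y. ennreal (gauss_density (y - g w)) * h (y, V w) \<partial>lborel) \<partial>F)"
  proof (rule nn_integral_cong)
    fix w assume w: "w \<in> space F"
    have [measurable]: "(\<lambda>y. h (y, V w)) \<in> borel_measurable borel"
      using w by (intro measurable_compose[OF measurable_Pair2' assms]) (auto dest: measurable_space[OF V])
    have "(\<integral>\<^sup>+z. h (g w + z, V w) \<partial>gaussian)
      = (\<integral>\<^sup>+z. (\<lambda>y. ennreal (gauss_density (y - g w)) * h (y, V w)) (g w + z) \<partial>lborel)"
      by (subst nn_integral_gaussian) simp_all
    then show "(\<integral>\<^sup>+z. h (g w + z, V w) \<partial>gaussian)
      = (\<integral>\<^sup>+y. ennreal (gauss_density (y - g w)) * h (y, V w) \<partial>lborel)"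
      by (subst (asm) nn_integral_lborel_shift) simp_all
  qed
  finally show ?thesis .
qed

lemma nn_integral_base:
  fixes h :: "'a \<times> 'v \<Rightarrow> ennreal"
  assumes [measurable]: "h \<in> borel_measurable (borel \<Otimes>\<^sub>M N)"
  shows "(\<integral>\<^sup>+x. h x \<partial>(lborel \<Otimes>\<^sub>M distr F N V)) = (\<integral>\<^sup>+w. (\<integral>\<^sup>+y. h (y, V w) \<partial>lborel) \<partial>F)"
proof -
  have [measurable]: "(\<lambda>v. \<integral>\<^sup>+y. h (y, v) \<partial>lborel) \<in> borel_measurable N"
    by (rule lborel.borel_measurable_nn_integral) simp
  have "h \<in> borel_measurable (lborel \<Otimes>\<^sub>M distr F N V)" by simp
  from LK.nn_integral_snd[OF this] show ?thesis
    by (simp add: nn_integral_distr)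
qed

text \<open>Both parts rest on |a + b|^2 \<le> 2 |a|^2 + 2 |b|^2. The explicit bound serves to bound
  rates uniformly over all inputs of the given power.\<close>

lemma integrable_channel_norm_square: "integrable (channel F N g V) (\<lambda>x. (norm (fst x))\<^sup>2)"
  and integral_channel_norm_square_le:
    "(\<integral>x. (norm (fst x))\<^sup>2 \<partial>channel F N g V)
      \<le> 2 * (\<integral>w. (norm (g w))\<^sup>2 \<partial>F) + 2 * (\<integral>z. (norm (z::'a))\<^sup>2 \<partial>gaussian)"
proof -
  have b: "(norm (g w + z))\<^sup>2 \<le> 2 * (norm (g w))\<^sup>2 + 2 * (norm z)\<^sup>2" for w z
  proof -
    have "(norm (g w + z))\<^sup>2 \<le> (norm (g w) + norm z)\<^sup>2" by (intro power_mono norm_triangle_ineq) simp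
    then show ?thesis using sum_squares_bound[of "norm (g w)" "norm z"] by (simp add: power2_sum)
  qed
  let ?P = "F \<Otimes>\<^sub>M (gaussian :: 'a measure)"
  have fg: "integrable ?P (\<lambda>x. (norm (g (fst x)))\<^sup>2)"
    "(\<integral>x. (norm (g (fst x)))\<^sup>2 \<partial>?P) = (\<integral>w. (norm (g w))\<^sup>2 \<partial>F)"
    by (rule integral_pair_fst[OF gaussian.prob_space_axioms g_square])+
  have gg: "integrable ?P (\<lambda>x. (norm (snd x))\<^sup>2)"
    "(\<integral>x. (norm (snd x))\<^sup>2 \<partial>?P) = (\<integral>z. (norm (z::'a))\<^sup>2 \<partial>gaussian)"
    by (rule integral_pair_snd[OF prob_space_axioms gaussian.prob_space_axioms integrable_gaussian_norm_square])+
  have i: "integrable ?P (\<lambda>x. 2 * (norm (g (fst x)))\<^sup>2 + 2 * (norm (snd x))\<^sup>2)"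
    using fg(1) gg(1) by (intro Bochner_Integration.integrable_add integrable_mult_right)
  have j: "integrable ?P (\<lambda>x. (norm (g (fst x) + snd x))\<^sup>2)"
    by (rule Bochner_Integration.integrable_bound[OF i]) (use b in auto)
  show "integrable (channel F N g V) (\<lambda>x. (norm (fst x))\<^sup>2)"
    unfolding channel_def using j by (subst integrable_distr_eq) (simp_all add: case_prod_unfold)
  have "(\<integral>x. (norm (fst x))\<^sup>2 \<partial>channel F N g V) = (\<integral>x. (norm (g (fst x) + snd x))\<^sup>2 \<partial>?P)"
    unfolding channel_def by (subst integral_distr) (simp_all add: case_prod_unfold)
  also have "\<dots> \<le> (\<integral>x. 2 * (norm (g (fst x)))\<^sup>2 + 2 * (norm (snd x))\<^sup>2 \<partial>?P)"
    by (rule integral_mono[OF j i]) (rule b)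
  also have "\<dots> = 2 * (\<integral>w. (norm (g w))\<^sup>2 \<partial>F) + 2 * (\<integral>z. (norm (z::'a))\<^sup>2 \<partial>gaussian)"
    using fg gg by (subst Bochner_Integration.integral_add) (auto intro!: integrable_mult_right)
  finally show "(\<integral>x. (norm (fst x))\<^sup>2 \<partial>channel F N g V)
      \<le> 2 * (\<integral>w. (norm (g w))\<^sup>2 \<partial>F) + 2 * (\<integral>z. (norm (z::'a))\<^sup>2 \<partial>gaussian)" .
qed

text \<open>The noise density is bounded by \<open>C\<close>, so the law is dominated by \<open>C\<close> times the reference measure.\<close>

lemma density_exists: "\<exists>f. is_density F N g V f"
proof -
  let ?B = "(lborel :: 'a measure) \<Otimes>\<^sub>M distr F N V" and ?L = "channel F N g V"
  define C :: real where "C = 1 / sqrt pi ^ DIM('a)"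
  have C: "C > 0" by (simp add: C_def)
  interpret L: prob_space ?L by (rule prob_space_channel)
  have le: "emeasure ?L A \<le> ennreal C * emeasure ?B A" if "A \<in> sets (borel \<Otimes>\<^sub>M N)" for A
  proof -
    note that[measurable]
    have "emeasure ?L A = (\<integral>\<^sup>+x. indicator A x \<partial>?L)" by simp
    also have "\<dots> = (\<integral>\<^sup>+w. (\<integral>\<^sup>+y. ennreal (gauss_density (y - g w)) * indicator A (y, V w) \<partial>lborel) \<partial>F)"
      by (subst nn_integral_channel) simp_all
    also have "\<dots> \<le> (\<integral>\<^sup>+w. (\<integral>\<^sup>+y. ennreal C * indicator A (y, V w) \<partial>lborel) \<partial>F)"
      by (intro nn_integral_mono mult_right_mono ennreal_leI) (simp_all add: C_def gauss_density_le)
    also have "\<dots> = (\<integral>\<^sup>+x. ennreal C * indicator A x \<partial>?B)"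
      by (subst nn_integral_base) simp_all
    also have "\<dots> = ennreal C * emeasure ?B A"
      by (subst nn_integral_cmult) simp_all
    finally show ?thesis .
  qed
  have "absolutely_continuous ?B ?L"
    unfolding absolutely_continuous_def
  proof (safe intro!: null_setsI)
    fix A assume "A \<in> null_sets ?B"
    then have A: "A \<in> sets (borel \<Otimes>\<^sub>M N)" "emeasure ?B A = 0" by auto
    then show "A \<in> sets ?L" by simp
    show "emeasure ?L A = 0" using le[OF A(1)] A(2) by simp
  qed
  then obtain f where fm[measurable]: "f \<in> borel_measurable ?B" and f: "density ?B f = ?L"
    using LK.Radon_Nikodym[of ?L] by auto
  \<comment> \<open>On \<open>E\<close> the Radon-Nikodym derivative exceeds \<open>C\<close>, yet
    domination bounds its integral there by that of the constant \<open>C\<close>. Hence the excess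
    vanishes almost everywhere.\<close>
  define E where "E = {x \<in> space ?B. ennreal C < f x}"
  have E[measurable]: "E \<in> sets ?B" unfolding E_def by (rule borel_measurable_less) (simp_all add: fm)
  then have [simp]: "E \<in> sets (borel \<Otimes>\<^sub>M N)" by simp
  have LE: "emeasure ?L E = (\<integral>\<^sup>+x. f x * indicator E x \<partial>?B)"
    by (subst f[symmetric], subst emeasure_density) simp_all
  have CE: "(\<integral>\<^sup>+x. ennreal C * indicator E x \<partial>?B) = ennreal C * emeasure ?B E"
    by (subst nn_integral_cmult) simp_all
  have up: "(\<integral>\<^sup>+x. ennreal C * indicator E x \<partial>?B) \<le> emeasure ?L E"
    unfolding LE by (intro nn_integral_mono) (auto simp: E_def indicator_def)
  have "(\<integral>\<^sup>+x. f x * indicator E x - ennreal C * indicator E x \<partial>?B)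
    = emeasure ?L E - ennreal C * emeasure ?B E"
    unfolding LE CE[symmetric]
  proof (rule nn_integral_diff)
    show "(\<integral>\<^sup>+x. ennreal C * indicator E x \<partial>?B) \<noteq> \<infinity>"
      using up L.emeasure_finite[of E] by (metis infinity_ennreal_def neq_top_trans)
  qed (auto simp: E_def indicator_def)
  also have "\<dots> = 0" using le[of E] L.emeasure_finite[of E] by (simp add: diff_eq_0_iff_ennreal less_top[symmetric])
  finally have "AE x in ?B. f x * indicator E x - ennreal C * indicator E x = 0"
    by (subst (asm) nn_integral_0_iff_AE) simp_all
  then have fC: "AE x in ?B. f x \<le> ennreal C"
    using AE_space
  proof eventually_elim
    case (elim x)
    show ?case
    proof (rule ccontr)
      assume *: "\<not> f x \<le> ennreal C"
      then have "x \<in> E" using elim(2) by (simp add: E_def)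
      then show False using elim(1) * by (simp add: diff_eq_0_iff_ennreal)
    qed
  qed
  \<comment> \<open>Truncation changes the derivative only on a null set and makes it real-valued
    and bounded at every point, as \<open>is_density\<close> demands.\<close>
  define h where "h x = enn2real (min (f x) (ennreal C))" for x
  have hm: "h \<in> borel_measurable ?B" unfolding h_def by measurable
  have e: "ennreal (h x) = min (f x) (ennreal C)" for x
    unfolding h_def by (rule ennreal_enn2real) (simp add: min_less_iff_disj)
  have "density ?B (\<lambda>x. ennreal (h x)) = density ?B f"
    unfolding e using fC by (intro density_cong) (auto elim!: eventually_mono simp: min_absorb1)
  moreover have "h x \<le> C" for x
  proof -
    have "h x \<le> enn2real (ennreal C)" unfolding h_def by (rule enn2real_mono) auto
    then show ?thesis using C by simp
  qed
  ultimately have "is_density F N g V h"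
    using hm f by (intro is_densityI[of _ _ C]) (simp_all add: h_def)
  then show ?thesis by blast
qed

lemma density_pos:
  assumes "is_density F N g V f"
  shows "AE x in channel F N g V. f x > 0"
proof -
  have [measurable]: "f \<in> borel_measurable (lborel \<Otimes>\<^sub>M distr F N V)"
    using is_densityD[OF assms] by simp
  show ?thesis
    unfolding is_densityD(4)[OF assms] using is_densityD(2)[OF assms] by (auto simp: AE_density less_le)
qed

lemma nn_integral_density_base:
  assumes "is_density F N g V f"
  shows "(\<integral>\<^sup>+x. ennreal (f x) \<partial>(lborel \<Otimes>\<^sub>M distr F N V)) = 1"
proof -
  interpret L: prob_space "channel F N g V" by (rule prob_space_channel)
  have [measurable]: "f \<in> borel_measurable (lborel \<Otimes>\<^sub>M distr F N V)"
    using is_densityD[OF assms] by simp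
  have L: "channel F N g V = density (lborel \<Otimes>\<^sub>M distr F N V) (\<lambda>x. ennreal (f x))"
    using is_densityD[OF assms] by simp
  have "emeasure (channel F N g V) (space (lborel \<Otimes>\<^sub>M distr F N V)) = 1"
    using L.emeasure_space_1 by (simp add: L)
  moreover have "space (lborel \<Otimes>\<^sub>M distr F N V) \<in> sets (lborel \<Otimes>\<^sub>M distr F N V)" by (rule sets.top)
  ultimately show ?thesis
    unfolding L by (subst (asm) emeasure_density) (simp_all del: sets_base cong: nn_integral_cong)
qed

text \<open>Boundedness of \<open>f\<close> controls the logarithm from above. From below, ln t
  \<le> t - 1 with t = q / f compares it with the noise density \<open>q\<close>, whose logarithm is
  integrable by the second moment.\<close>

lemma integrable_ln_density:
  assumes f: "is_density F N g V f"
  shows "integrable (channel F N g V) (\<lambda>x. ln (f x))"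
proof -
  let ?B = "(lborel :: 'a measure) \<Otimes>\<^sub>M distr F N V" and ?L = "channel F N g V"
  interpret L: prob_space ?L by (rule prob_space_channel)
  note [measurable] = is_densityD(1)[OF f] and f0 = is_densityD(2)[OF f]
  have L: "?L = density ?B (\<lambda>x. ennreal (f x))"
    by (rule is_densityD(4)[OF f])
  obtain C where C: "f x \<le> C" for x using is_densityD(3)[OF f] by blast
  \<comment> \<open>The bound is raised to at least 1 so that \<open>ln D\<close> is nonnegative and
    can enter a dominating function.\<close>
  define D where "D = max C 1"
  have D: "f x \<le> D" "D \<ge> 1" for x using C[of x] by (auto simp: D_def)
  define q where "q x = gauss_density (fst x)" for x :: "'a \<times> 'v"
  have q: "q x > 0" for x by (simp add: q_def gauss_density_pos)
  have [measurable]: "q \<in> borel_measurable (borel \<Otimes>\<^sub>M N)" unfolding q_def by measurable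
  have lnq: "integrable ?L (\<lambda>x. ln (q x))"
    unfolding q_def ln_gauss_density using integrable_channel_norm_square by simp
  have "(\<integral>\<^sup>+x. ennreal (q x / f x) \<partial>?L) = (\<integral>\<^sup>+x. ennreal (f x) * ennreal (q x / f x) \<partial>?B)"
    unfolding L by (subst nn_integral_density) simp_all
  also have "\<dots> \<le> (\<integral>\<^sup>+x. ennreal (q x) \<partial>?B)"
    by (intro nn_integral_mono) (auto simp: ennreal_mult[symmetric] f0 q less_imp_le)
  also have "\<dots> = 1"
    by (subst nn_integral_base) (simp_all add: q_def nn_integral_gauss_density emeasure_space_1)
  finally have "(\<integral>\<^sup>+x. ennreal (q x / f x) \<partial>?L) < \<infinity>" by (auto intro: le_less_trans)
  then have r: "integrable ?L (\<lambda>x. q x / f x)"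
    by (intro integrableI_nonneg) (auto simp: f0 q less_imp_le)
  show ?thesis
  proof (rule Bochner_Integration.integrable_bound)
    show "integrable ?L (\<lambda>x. ln D + q x / f x + \<bar>ln (q x)\<bar>)"
      using r lnq by simp
    show "AE x in ?L. norm (ln (f x)) \<le> norm (ln D + q x / f x + \<bar>ln (q x)\<bar>)"
      using density_pos[OF f]
    proof eventually_elim
      case (elim x)
      have "ln (f x) \<le> ln D" using elim D(1)[of x] by simp
      moreover have "ln (q x) - ln (f x) \<le> q x / f x - 1"
        using ln_le_minus_one[of "q x / f x"] elim q[of x] by (simp add: ln_div)
      moreover have "q x / f x \<ge> 0" "ln D \<ge> 0" using elim q[of x] D(2) by simp_all
      ultimately show ?case by simp
    qed
  qed simp
qed

lemma integral_ln_le_density: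
  assumes f: "is_density F N g V f"
    and q[measurable]: "q \<in> borel_measurable (borel \<Otimes>\<^sub>M N)" and q0: "\<And>x. q x \<ge> 0"
    and le: "(\<integral>\<^sup>+x. ennreal (q x) \<partial>(lborel \<Otimes>\<^sub>M distr F N V)) \<le> 1"
    and pos: "AE x in channel F N g V. q x > 0"
    and int: "integrable (channel F N g V) (\<lambda>x. ln (q x))"
  shows "(\<integral>x. ln (q x) \<partial>channel F N g V) \<le> (\<integral>x. ln (f x) \<partial>channel F N g V)"
proof (rule gibbs_inequality[OF prob_space_channel _ _ _ _ q0 le pos _ int])
  show "integrable (channel F N g V) (\<lambda>x. ln (f x))" by (rule integrable_ln_density[OF f])
  show "q \<in> borel_measurable (lborel \<Otimes>\<^sub>M distr F N V)" by measurable
qed (rule is_densityD[OF f])+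

text \<open>Two densities of the same law are test densities for each other, so Gibbs' inequality in
  both directions shows that the choice made in \<open>ent\<close> is immaterial.\<close>

lemma ent_eq:
  assumes f: "is_density F N g V f"
  shows "ent F N g V = - (\<integral>x. ln (f x) \<partial>channel F N g V)"
proof -
  define h where "h = (SOME f. is_density F N g V f)"
  have h: "is_density F N g V h" unfolding h_def by (rule someI[of _ f]) (rule f)
  have *: "(\<integral>x. ln (a x) \<partial>channel F N g V) \<le> (\<integral>x. ln (b x) \<partial>channel F N g V)"
    if "is_density F N g V a" "is_density F N g V b" for a b
    by (rule integral_ln_le_density[OF that(2)])
       (use is_densityD[OF that(1)] nn_integral_density_base[OF that(1)] density_pos[OF that(1)]
         integrable_ln_density[OF that(1)] in simp_all)
  show ?thesis
    unfolding ent_def h_def[symmetric] using *[OF f h] *[OF h f] by simp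
qed

lemma ent_le:
  assumes "q \<in> borel_measurable (borel \<Otimes>\<^sub>M N)" "\<And>x. q x \<ge> 0"
    and "(\<integral>\<^sup>+x. ennreal (q x) \<partial>(lborel \<Otimes>\<^sub>M distr F N V)) \<le> 1"
    and "AE x in channel F N g V. q x > 0"
    and "integrable (channel F N g V) (\<lambda>x. ln (q x))"
  shows "ent F N g V \<le> - (\<integral>x. ln (q x) \<partial>channel F N g V)"
proof -
  obtain f where f: "is_density F N g V f" using density_exists ..
  show ?thesis using integral_ln_le_density[OF f assms] by (simp add: ent_eq[OF f])
qed

end

section \<open>Entropy inequalities\<close>

text \<open>By Tonelli the two middle factors may be exchanged. For a pair of independent channels
  this regroups sources with noises in the joint law and outputs with side informations in the
  reference measure.\<close>

lemma distr_pair_rearrange: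
  assumes "sigma_finite_measure A" "sigma_finite_measure B" "sigma_finite_measure C" "sigma_finite_measure D"
  shows "distr ((A \<Otimes>\<^sub>M B) \<Otimes>\<^sub>M (C \<Otimes>\<^sub>M D)) ((A \<Otimes>\<^sub>M C) \<Otimes>\<^sub>M (B \<Otimes>\<^sub>M D)) (\<lambda>((a, b), (c, d)). ((a, c), (b, d)))
    = (A \<Otimes>\<^sub>M C) \<Otimes>\<^sub>M (B \<Otimes>\<^sub>M D)" (is "?L = ?R")
proof (rule measure_eqI)
  interpret A: sigma_finite_measure A by fact
  interpret B: sigma_finite_measure B by fact
  interpret C: sigma_finite_measure C by fact
  interpret D: sigma_finite_measure D by fact
  interpret BD: pair_sigma_finite B D ..
  interpret CD: pair_sigma_finite C D ..
  interpret BC: pair_sigma_finite B C ..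
  fix X assume "X \<in> sets ?L"
  then have [measurable]: "X \<in> sets ((A \<Otimes>\<^sub>M C) \<Otimes>\<^sub>M (B \<Otimes>\<^sub>M D))" by simp
  let ?h = "indicator X :: _ \<Rightarrow> ennreal"
  have "emeasure ?L X = (\<integral>\<^sup>+x. ?h x \<partial>?L)" by simp
  also have "\<dots> = (\<integral>\<^sup>+x. ?h ((fst (fst x), fst (snd x)), (snd (fst x), snd (snd x))) \<partial>((A \<Otimes>\<^sub>M B) \<Otimes>\<^sub>M (C \<Otimes>\<^sub>M D)))"
    by (subst nn_integral_distr) (simp_all add: case_prod_unfold)
  also have "\<dots> = (\<integral>\<^sup>+x. \<integral>\<^sup>+y. ?h ((fst x, fst y), (snd x, snd y)) \<partial>(C \<Otimes>\<^sub>M D) \<partial>(A \<Otimes>\<^sub>M B))"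
    by (subst CD.nn_integral_fst[symmetric]) simp_all
  also have "\<dots> = (\<integral>\<^sup>+x. \<integral>\<^sup>+c. \<integral>\<^sup>+d. ?h ((fst x, c), (snd x, d)) \<partial>D \<partial>C \<partial>(A \<Otimes>\<^sub>M B))"
    by (intro nn_integral_cong) (subst D.nn_integral_fst[symmetric], auto simp: space_pair_measure)
  also have "\<dots> = (\<integral>\<^sup>+a. \<integral>\<^sup>+b. \<integral>\<^sup>+c. \<integral>\<^sup>+d. ?h ((a, c), (b, d)) \<partial>D \<partial>C \<partial>B \<partial>A)"
    by (subst B.nn_integral_fst[symmetric]) simp_all
  also have "\<dots> = (\<integral>\<^sup>+a. \<integral>\<^sup>+c. \<integral>\<^sup>+b. \<integral>\<^sup>+d. ?h ((a, c), (b, d)) \<partial>D \<partial>B \<partial>C \<partial>A)"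
    by (intro nn_integral_cong BC.Fubini'[symmetric]) simp
  also have "\<dots> = (\<integral>\<^sup>+x. \<integral>\<^sup>+b. \<integral>\<^sup>+d. ?h (x, (b, d)) \<partial>D \<partial>B \<partial>(A \<Otimes>\<^sub>M C))"
    by (subst C.nn_integral_fst[symmetric]) simp_all
  also have "\<dots> = (\<integral>\<^sup>+x. \<integral>\<^sup>+y. ?h (x, y) \<partial>(B \<Otimes>\<^sub>M D) \<partial>(A \<Otimes>\<^sub>M C))"
    by (intro nn_integral_cong) (subst D.nn_integral_fst[symmetric], auto simp: space_pair_measure)
  also have "\<dots> = (\<integral>\<^sup>+x. ?h x \<partial>?R)"
    by (subst BD.nn_integral_fst[symmetric]) simp_all
  also have "\<dots> = emeasure ?R X" by simp
  finally show "emeasure ?L X = emeasure ?R X" .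
qed simp

text \<open>In the chain rule this moves the noise of the first output from the channel into the
  source.\<close>

lemma distr_pair_assoc:
  assumes "sigma_finite_measure B" "sigma_finite_measure C"
  shows "distr (A \<Otimes>\<^sub>M (B \<Otimes>\<^sub>M C)) ((A \<Otimes>\<^sub>M B) \<Otimes>\<^sub>M C) (\<lambda>(a, b, c). ((a, b), c)) = (A \<Otimes>\<^sub>M B) \<Otimes>\<^sub>M C" (is "?L = ?R")
proof (rule measure_eqI)
  interpret B: sigma_finite_measure B by fact
  interpret C: sigma_finite_measure C by fact
  interpret BC: pair_sigma_finite B C ..
  fix X assume "X \<in> sets ?L"
  then have [measurable]: "X \<in> sets ((A \<Otimes>\<^sub>M B) \<Otimes>\<^sub>M C)" by simp
  let ?h = "indicator X :: _ \<Rightarrow> ennreal"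
  have "emeasure ?L X = (\<integral>\<^sup>+x. ?h x \<partial>?L)" by simp
  also have "\<dots> = (\<integral>\<^sup>+x. ?h ((fst x, fst (snd x)), snd (snd x)) \<partial>(A \<Otimes>\<^sub>M (B \<Otimes>\<^sub>M C)))"
    by (subst nn_integral_distr) (simp_all add: case_prod_unfold)
  also have "\<dots> = (\<integral>\<^sup>+a. \<integral>\<^sup>+y. ?h ((a, fst y), snd y) \<partial>(B \<Otimes>\<^sub>M C) \<partial>A)"
    by (subst BC.nn_integral_fst[symmetric]) simp_all
  also have "\<dots> = (\<integral>\<^sup>+a. \<integral>\<^sup>+b. \<integral>\<^sup>+c. ?h ((a, b), c) \<partial>C \<partial>B \<partial>A)"
    by (intro nn_integral_cong) (subst C.nn_integral_fst[symmetric], auto simp: space_pair_measure)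
  also have "\<dots> = (\<integral>\<^sup>+x. ?h x \<partial>?R)"
    by (subst C.nn_integral_fst[symmetric], simp) (subst B.nn_integral_fst[symmetric], simp_all)
  also have "\<dots> = emeasure ?R X" by simp
  finally show "emeasure ?L X = emeasure ?R X" .
qed simp

section \<open>Images of a channel under maps of its output, side information and source\<close>

lemma borel_measurable_fst_snd [measurable]:
  "fst \<in> borel_measurable (borel :: ('a::second_countable_topology \<times> 'b::second_countable_topology) measure)"
  "snd \<in> borel_measurable (borel :: ('a::second_countable_topology \<times> 'b::second_countable_topology) measure)"
  by (simp_all add: borel_prod[symmetric])

lemma norm_fst_snd_le: "norm (fst x) \<le> norm x" "norm (snd x) \<le> norm x"
  using norm_fst_le[of "fst x" "snd x"] norm_snd_le[of "snd x" "fst x"] by simp_all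

lemma distr_gaussian_fst: "distr (gaussian :: ('a::euclidean_space \<times> 'b::euclidean_space) measure) borel fst = gaussian"
proof -
  have "distr ((gaussian :: 'a measure) \<Otimes>\<^sub>M (gaussian :: 'b measure)) gaussian fst = gaussian"
    by (rule gaussian.distr_pair_fst)
  then show ?thesis unfolding gaussian_prod by (simp cong: distr_cong)
qed

lemma distr_gaussian_snd: "distr (gaussian :: ('a::euclidean_space \<times> 'b::euclidean_space) measure) borel snd = gaussian"
proof -
  have "distr ((gaussian :: 'a measure) \<Otimes>\<^sub>M (gaussian :: 'b measure)) gaussian snd = gaussian"
    by (rule distr_pair_snd) (rule gaussian.prob_space_axioms gaussian.sigma_finite_measure_axioms)+
  then show ?thesis unfolding gaussian_prod by (simp cong: distr_cong)
qed

lemma distr_gaussian_id: "distr (gaussian :: 'a::euclidean_space measure) borel (\<lambda>x. x) = gaussian"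
  using distr_id2[of borel "gaussian :: 'a measure"] by simp

text \<open>An additive \<open>p\<close> that preserves the noise law sends signal plus noise to
  signal plus noise. The instances are the identity and the two projections of a pair of
  outputs.\<close>

lemma (in awgn) channel_image:
  fixes p :: "'a \<Rightarrow> 'b::euclidean_space"
  assumes [measurable]: "p \<in> borel_measurable borel" and p: "\<And>x y. p (x + y) = p x + p y"
    and pg: "distr gaussian borel p = gaussian"
    and [measurable]: "T \<in> measurable N N'"
  shows "channel F N' (\<lambda>w. p (g w)) (\<lambda>w. T (V w))
    = distr (channel F N g V) (borel \<Otimes>\<^sub>M N') (\<lambda>x. (p (fst x), T (snd x)))"
proof -
  have "F \<Otimes>\<^sub>M (gaussian :: 'b measure) = distr F F (\<lambda>x. x) \<Otimes>\<^sub>M distr gaussian borel p"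
    by (simp add: pg)
  also have "\<dots> = distr (F \<Otimes>\<^sub>M gaussian) (F \<Otimes>\<^sub>M borel) (\<lambda>(w, z). (w, p z))"
    by (subst pair_measure_distr) (simp_all add: pg gaussian.sigma_finite_measure_axioms)
  finally show ?thesis
    unfolding channel_def by (simp add: distr_distr comp_def case_prod_unfold p)
qed

lemma channel_distr:
  fixes g :: "'w \<Rightarrow> 'a::euclidean_space"
  assumes [measurable]: "T \<in> measurable F F'" "g \<in> borel_measurable F'" "V \<in> measurable F' N"
  shows "channel (distr F F' T) N g V = channel F N (\<lambda>w. g (T w)) (\<lambda>w. V (T w))"
proof -
  have "distr F F' T \<Otimes>\<^sub>M (gaussian :: 'a measure) = distr F F' T \<Otimes>\<^sub>M distr gaussian borel (\<lambda>x. x)"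
    by (simp add: distr_gaussian_id)
  also have "\<dots> = distr (F \<Otimes>\<^sub>M gaussian) (F' \<Otimes>\<^sub>M borel) (\<lambda>(w, z). (T w, z))"
    by (subst pair_measure_distr) (simp_all add: distr_gaussian_id gaussian.sigma_finite_measure_axioms)
  finally show ?thesis
    unfolding channel_def by (simp add: distr_distr comp_def case_prod_unfold)
qed

lemma ent_distr:
  assumes [measurable]: "T \<in> measurable F F'" "g \<in> borel_measurable F'" "V \<in> measurable F' N"
  shows "ent (distr F F' T) N g V = ent F N (\<lambda>w. g (T w)) (\<lambda>w. V (T w))"
  unfolding ent_def is_density_def by (simp add: channel_distr distr_distr comp_def)

lemma (in awgn) awgn_comp:
  fixes p :: "'a \<Rightarrow> 'b::euclidean_space"
  assumes [measurable]: "p \<in> borel_measurable borel" "T \<in> measurable N N'" and p: "\<And>x. norm (p x) \<le> norm x"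
  shows "awgn F N' (\<lambda>w. p (g w)) (\<lambda>w. T (V w))"
proof
  show "integrable F (\<lambda>w. (norm (p (g w)))\<^sup>2)"
    by (rule Bochner_Integration.integrable_bound[OF g_square]) (simp_all add: p power_mono)
qed simp_all

text \<open>Transports positivity, integrability and entropy of a density to a larger law, so that
  densities of different marginal channels can be multiplied on one joint law.\<close>

lemma (in awgn) density_pullback:
  assumes f: "is_density F N g V f" and [measurable]: "S \<in> measurable M (borel \<Otimes>\<^sub>M N)"
    and M: "channel F N g V = distr M (borel \<Otimes>\<^sub>M N) S"
  shows "AE x in M. f (S x) > 0" "integrable M (\<lambda>x. ln (f (S x)))"
    "(\<integral>x. ln (f (S x)) \<partial>M) = - ent F N g V"
proof -
  note [measurable] = is_densityD(1)[OF f]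
  show "AE x in M. f (S x) > 0"
    using density_pos[OF f] unfolding M by (rule AE_distrD[rotated]) simp
  show "integrable M (\<lambda>x. ln (f (S x)))"
    using integrable_ln_density[OF f] unfolding M by (rule integrable_distr[rotated]) simp
  show "(\<integral>x. ln (f (S x)) \<partial>M) = - ent F N g V"
    unfolding ent_eq[OF f] M by (subst integral_distr) simp_all
qed

text \<open>Conditioning reduces entropy: the density for the coarser observation, read through
  \<open>T\<close>, is an admissible test density for the finer one.\<close>

lemma (in awgn) ent_le_comp:
  assumes T[measurable]: "T \<in> measurable N N'"
  shows "ent F N g V \<le> ent F N' g (\<lambda>w. T (V w))"
proof -
  interpret A: awgn F N' g "\<lambda>w. T (V w)"
    using awgn_comp[of "\<lambda>x. x" T N'] by simp
  obtain f where f: "is_density F N' g (\<lambda>w. T (V w)) f" using A.density_exists ..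
  note [measurable] = is_densityD(1)[OF f]
  have ch: "channel F N' g (\<lambda>w. T (V w)) = distr (channel F N g V) (borel \<Otimes>\<^sub>M N') (\<lambda>x. (fst x, T (snd x)))"
    using channel_image[of "\<lambda>x. x" T N'] by (simp add: distr_gaussian_id)
  have S[measurable]: "(\<lambda>x. (fst x, T (snd x))) \<in> measurable (channel F N g V) (borel \<Otimes>\<^sub>M N')" by simp
  note pb = A.density_pullback[OF f S ch]
  have "ent F N g V \<le> - (\<integral>x. ln (f (fst x, T (snd x))) \<partial>channel F N g V)"
  proof (rule ent_le)
    show "(\<integral>\<^sup>+x. ennreal (f (fst x, T (snd x))) \<partial>(lborel \<Otimes>\<^sub>M distr F N V)) \<le> 1"
      using A.nn_integral_density_base[OF f] by (simp add: nn_integral_base A.nn_integral_base)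
  qed (use pb is_densityD(2)[OF f] in simp_all)
  then show ?thesis using pb by simp
qed

text \<open>The fibre masses form a density of the law of \<open>V\<close> with respect to itself,
  hence equal 1 almost everywhere. Products of conditional densities must be normalised fibrewise;
  total mass 1 of each factor says nothing about their product.\<close>

lemma (in awgn) nn_integral_density_eq_1:
  assumes f: "is_density F N g V f"
  shows "AE w in F. (\<integral>\<^sup>+y. ennreal (f (y, V w)) \<partial>lborel) = 1"
proof -
  note [measurable] = is_densityD(1)[OF f]
  let ?K = "distr F N V"
  define k where "k v = (\<integral>\<^sup>+y. ennreal (f (y, v)) \<partial>lborel)" for v
  have [measurable]: "k \<in> borel_measurable N"
    unfolding k_def by (rule lborel.borel_measurable_nn_integral) simp
  have "density ?K k = density ?K (\<lambda>_. 1)"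
  proof (rule measure_eqI)
    fix A assume "A \<in> sets (density ?K k)"
    then have [measurable]: "A \<in> sets N" by simp
    have "emeasure (density ?K k) A = (\<integral>\<^sup>+w. k (V w) * indicator A (V w) \<partial>F)"
      by (subst emeasure_density) (simp_all add: nn_integral_distr)
    also have "\<dots> = (\<integral>\<^sup>+w. (\<integral>\<^sup>+y. ennreal (f (y, V w)) * indicator A (V w) \<partial>lborel) \<partial>F)"
    proof (intro nn_integral_cong)
      fix w assume w: "w \<in> space F"
      have [measurable]: "(\<lambda>y. f (y, V w)) \<in> borel_measurable borel"
        using w by (intro measurable_compose[OF measurable_Pair2' is_densityD(1)[OF f]]) (auto dest: measurable_space[OF V])
      show "k (V w) * indicator A (V w) = (\<integral>\<^sup>+y. ennreal (f (y, V w)) * indicator A (V w) \<partial>lborel)"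
        unfolding k_def by (subst nn_integral_multc) simp_all
    qed
    also have "\<dots> = (\<integral>\<^sup>+x. ennreal (f x) * indicator A (snd x) \<partial>(lborel \<Otimes>\<^sub>M ?K))"
      by (subst nn_integral_base) simp_all
    also have "\<dots> = (\<integral>\<^sup>+x. indicator A (snd x) \<partial>channel F N g V)"
      unfolding is_densityD(4)[OF f] using is_densityD(5)[OF f] by (subst nn_integral_density) simp_all
    also have "\<dots> = (\<integral>\<^sup>+w. indicator A (V w) \<partial>F)"
      by (subst nn_integral_channel, simp)
         (simp add: nn_integral_multc nn_integral_gauss_density_shift)
    also have "\<dots> = emeasure (density ?K (\<lambda>_. 1)) A"
      by (subst emeasure_density) (simp_all add: nn_integral_distr del: nn_integral_indicator)
    finally show "emeasure (density ?K k) A = emeasure (density ?K (\<lambda>_. 1)) A" .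
  qed simp
  then have "AE v in ?K. k v = 1"
  proof (subst (asm) finite_density_unique)
    have "integral\<^sup>N ?K k = emeasure (density ?K k) (space N)"
      by (subst emeasure_density) (auto intro!: nn_integral_cong)
    also have "\<dots> = 1"
      using \<open>density ?K k = density ?K (\<lambda>_. 1)\<close> K.emeasure_space_1 by (simp add: density_1)
    finally show "integral\<^sup>N ?K k \<noteq> \<infinity>" by simp
  qed auto
  then show ?thesis unfolding k_def by (rule AE_distrD[OF V])
qed

text \<open>Subadditivity: the product of the two conditional densities is the test density, and by
  Tonelli its fibre masses are products of fibre masses equal to 1.\<close>

lemma ent_pair_le:
  fixes g :: "'w \<Rightarrow> 'a::euclidean_space \<times> 'b::euclidean_space"
  assumes "awgn F N g V"
  shows "ent F N g V \<le> ent F N (\<lambda>w. fst (g w)) V + ent F N (\<lambda>w. snd (g w)) V"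
proof -
  interpret awgn F N g V by fact
  interpret A: awgn F N "\<lambda>w. fst (g w)" V
    using awgn_comp[of fst "\<lambda>x. x" N] by (simp add: norm_fst_snd_le)
  interpret B: awgn F N "\<lambda>w. snd (g w)" V
    using awgn_comp[of snd "\<lambda>x. x" N] by (simp add: norm_fst_snd_le)
  obtain f where f: "is_density F N (\<lambda>w. fst (g w)) V f" using A.density_exists ..
  obtain h where h: "is_density F N (\<lambda>w. snd (g w)) V h" using B.density_exists ..
  note [measurable] = is_densityD(1)[OF f] is_densityD(1)[OF h]
  have cf: "channel F N (\<lambda>w. fst (g w)) V = distr (channel F N g V) (borel \<Otimes>\<^sub>M N) (\<lambda>x. (fst (fst x), snd x))"
    using channel_image[of fst "\<lambda>x. x" N] by (simp add: distr_gaussian_fst)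
  have ch: "channel F N (\<lambda>w. snd (g w)) V = distr (channel F N g V) (borel \<Otimes>\<^sub>M N) (\<lambda>x. (snd (fst x), snd x))"
    using channel_image[of snd "\<lambda>x. x" N] by (simp add: distr_gaussian_snd)
  have S1: "(\<lambda>x. (fst (fst x), snd x)) \<in> measurable (channel F N g V) (borel \<Otimes>\<^sub>M N)"
    and S2: "(\<lambda>x. (snd (fst x), snd x)) \<in> measurable (channel F N g V) (borel \<Otimes>\<^sub>M N)"
    by (simp_all add: borel_prod[symmetric])
  note pf = A.density_pullback[OF f S1 cf] and ph = B.density_pullback[OF h S2 ch]
  let ?q = "\<lambda>x. f (fst (fst x), snd x) * h (snd (fst x), snd x)"
  have pos: "AE x in channel F N g V. ?q x > 0" using pf(1) ph(1) by eventually_elim simp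
  have ln: "AE x in channel F N g V. ln (f (fst (fst x), snd x)) + ln (h (snd (fst x), snd x)) = ln (?q x)"
    using pf(1) ph(1) by eventually_elim (simp add: ln_mult)
  have [measurable]: "?q \<in> borel_measurable (borel \<Otimes>\<^sub>M N)" by (simp add: borel_prod[symmetric])
  have int: "integrable (channel F N g V) (\<lambda>x. ln (?q x))"
    by (rule integrable_cong_AE_imp[OF Bochner_Integration.integrable_add[OF pf(2) ph(2)]]) (use ln in simp_all)
  have "ent F N g V \<le> - (\<integral>x. ln (?q x) \<partial>channel F N g V)"
  proof (rule ent_le[OF _ _ _ pos int])
    have "(\<integral>\<^sup>+x. ennreal (?q x) \<partial>(lborel \<Otimes>\<^sub>M distr F N V))
      = (\<integral>\<^sup>+w. (\<integral>\<^sup>+y. ennreal (f (fst y, V w) * h (snd y, V w)) \<partial>lborel) \<partial>F)"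
      by (subst nn_integral_base) simp_all
    also have "\<dots> = (\<integral>\<^sup>+w. (\<integral>\<^sup>+y. ennreal (f (y, V w)) \<partial>lborel) * (\<integral>\<^sup>+y. ennreal (h (y, V w)) \<partial>lborel) \<partial>F)"
    proof (intro nn_integral_cong)
      fix w assume w: "w \<in> space F"
      have [measurable]: "(\<lambda>y. f (y, V w)) \<in> borel_measurable borel" "(\<lambda>y. h (y, V w)) \<in> borel_measurable borel"
        using w by (intro measurable_compose[OF measurable_Pair2' is_densityD(1)[OF f]] measurable_compose[OF measurable_Pair2' is_densityD(1)[OF h]]; auto dest: measurable_space[OF V])+
      show "(\<integral>\<^sup>+y. ennreal (f (fst y, V w) * h (snd y, V w)) \<partial>lborel)
        = (\<integral>\<^sup>+y. ennreal (f (y, V w)) \<partial>lborel) * (\<integral>\<^sup>+y. ennreal (h (y, V w)) \<partial>lborel)"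
        unfolding lborel_prod[symmetric]
        by (subst lborel.nn_integral_fst[symmetric])
           (simp_all add: ennreal_mult is_densityD(2)[OF f] is_densityD(2)[OF h] nn_integral_cmult nn_integral_multc)
    qed
    also have "\<dots> = (\<integral>\<^sup>+w. 1 \<partial>F)"
    proof (rule nn_integral_cong_AE)
      show "AE w in F. (\<integral>\<^sup>+y. ennreal (f (y, V w)) \<partial>lborel) * (\<integral>\<^sup>+y. ennreal (h (y, V w)) \<partial>lborel) = 1"
        using A.nn_integral_density_eq_1[OF f] B.nn_integral_density_eq_1[OF h] by eventually_elim simp
    qed
    finally show "(\<integral>\<^sup>+x. ennreal (?q x) \<partial>(lborel \<Otimes>\<^sub>M distr F N V)) \<le> 1"
      by (simp add: emeasure_space_1)
  qed (simp_all add: is_densityD(2)[OF f] is_densityD(2)[OF h])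
  also have "(\<integral>x. ln (?q x) \<partial>channel F N g V)
    = (\<integral>x. ln (f (fst (fst x), snd x)) + ln (h (snd (fst x), snd x)) \<partial>channel F N g V)"
    using ln pf(2) ph(2) int by (intro integral_cong_AE) (auto dest: borel_measurable_integrable elim!: eventually_mono)
  finally show ?thesis using pf ph by simp
qed

section \<open>Noise entropy and independent channels\<close>

definition noise_ent :: "'a::euclidean_space itself \<Rightarrow> real" where
  "noise_ent _ = - (\<integral>z. ln (gauss_density (z :: 'a)) \<partial>gaussian)"

lemma measure_gaussian_UNIV [simp]: "measure gaussian UNIV = 1"
  using gaussian.prob_space by simp

lemma integrable_ln_gauss_density: "integrable gaussian (\<lambda>z. ln (gauss_density (z :: 'a::euclidean_space)))"
  unfolding ln_gauss_density using integrable_gaussian_norm_square[where 'a='a] by simp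

lemma noise_ent_eq:
  "noise_ent TYPE('a::euclidean_space) = real DIM('a) * ln (sqrt pi) + (\<integral>z. (norm (z::'a))\<^sup>2 \<partial>gaussian)"
  unfolding noise_ent_def ln_gauss_density
  using integrable_gaussian_norm_square[where 'a='a] by simp

text \<open>The Gaussian entropy is never evaluated: once it is additive over products, the noise
  terms of the different rates cancel symbolically.\<close>

lemma noise_ent_prod:
  "noise_ent TYPE('a::euclidean_space \<times> 'b::euclidean_space) = noise_ent TYPE('a) + noise_ent TYPE('b)"
proof -
  let ?G = "gaussian :: ('a \<times> 'b) measure"
  have f: "integrable ?G (\<lambda>z. (norm (fst z))\<^sup>2)" "(\<integral>z. (norm (fst z))\<^sup>2 \<partial>?G) = (\<integral>z. (norm (z::'a))\<^sup>2 \<partial>gaussian)"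
    unfolding gaussian_prod[symmetric]
    by (rule integral_pair_fst[OF gaussian.prob_space_axioms integrable_gaussian_norm_square])+
  have s: "integrable ?G (\<lambda>z. (norm (snd z))\<^sup>2)" "(\<integral>z. (norm (snd z))\<^sup>2 \<partial>?G) = (\<integral>z. (norm (z::'b))\<^sup>2 \<partial>gaussian)"
    unfolding gaussian_prod[symmetric]
    by (rule integral_pair_snd[OF gaussian.prob_space_axioms gaussian.prob_space_axioms integrable_gaussian_norm_square])+
  have "(\<integral>z. (norm z)\<^sup>2 \<partial>?G) = (\<integral>z. (norm (fst z))\<^sup>2 + (norm (snd z))\<^sup>2 \<partial>?G)"
    by (simp add: norm_prod_def)
  then show ?thesis
    unfolding noise_ent_eq using f s by (simp add: algebra_simps)
qed

text \<open>Given \<open>V\<close> the signal is known, so the conditional density is explicit: the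
  noise density shifted by \<open>k v\<close>.\<close>

lemma ent_deterministic:
  fixes k :: "'v \<Rightarrow> 'a::euclidean_space"
  assumes "awgn F N (\<lambda>w. k (V w)) V" and [measurable]: "k \<in> borel_measurable N"
  shows "ent F N (\<lambda>w. k (V w)) V = noise_ent TYPE('a)"
proof -
  interpret awgn F N "\<lambda>w. k (V w)" V by fact
  let ?g = "\<lambda>w. k (V w)" and ?f = "\<lambda>x. gauss_density (fst x - k (snd x))"
  have [measurable]: "?f \<in> borel_measurable (borel \<Otimes>\<^sub>M N)" by simp
  have fB: "?f \<in> borel_measurable (lborel \<Otimes>\<^sub>M distr F N V)" by simp
  have f: "is_density F N ?g V ?f"
  proof (rule is_densityI[OF _ _ gauss_density_le])
    show "channel F N ?g V = density (lborel \<Otimes>\<^sub>M distr F N V) (\<lambda>x. ennreal (?f x))"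
    proof (rule measure_eqI)
      fix A assume "A \<in> sets (channel F N ?g V)"
      then have [measurable]: "A \<in> sets (borel \<Otimes>\<^sub>M N)" by simp
      have "emeasure (channel F N ?g V) A = (\<integral>\<^sup>+x. indicator A x \<partial>channel F N ?g V)" by simp
      also have "\<dots> = (\<integral>\<^sup>+x. ennreal (?f x) * indicator A x \<partial>(lborel \<Otimes>\<^sub>M distr F N V))"
        by (subst nn_integral_channel, simp, subst nn_integral_base) simp_all
      also have "\<dots> = emeasure (density (lborel \<Otimes>\<^sub>M distr F N V) (\<lambda>x. ennreal (?f x))) A"
        by (subst emeasure_density) (use fB in simp_all)
      finally show "emeasure (channel F N ?g V) A
        = emeasure (density (lborel \<Otimes>\<^sub>M distr F N V) (\<lambda>x. ennreal (?f x))) A" .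
    qed simp
  qed simp_all
  have "(\<integral>x. ln (?f x) \<partial>channel F N ?g V) = (\<integral>x. ln (gauss_density (snd x)) \<partial>(F \<Otimes>\<^sub>M (gaussian :: 'a measure)))"
    unfolding channel_def by (subst integral_distr) (simp_all add: case_prod_unfold)
  also have "\<dots> = - noise_ent TYPE('a)"
    unfolding noise_ent_def
    by (simp add: integral_pair_snd[OF prob_space_axioms gaussian.prob_space_axioms integrable_ln_gauss_density])
  finally show ?thesis by (simp add: ent_eq[OF f])
qed

text \<open>Independence makes the product of the two densities a true density of the joint channel
  and not merely a test density, hence an equality. The work lies in regrouping sources, noises and
  reference measures consistently.\<close>

lemma
  fixes g1 :: "'w1 \<Rightarrow> 'a::euclidean_space" and g2 :: "'w2 \<Rightarrow> 'b::euclidean_space"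
  assumes "awgn F1 N1 g1 V1" "awgn F2 N2 g2 V2"
  shows ent_product: "ent (F1 \<Otimes>\<^sub>M F2) (N1 \<Otimes>\<^sub>M N2) (\<lambda>w. (g1 (fst w), g2 (snd w))) (\<lambda>w. (V1 (fst w), V2 (snd w)))
    = ent F1 N1 g1 V1 + ent F2 N2 g2 V2"
    and awgn_product: "awgn (F1 \<Otimes>\<^sub>M F2) (N1 \<Otimes>\<^sub>M N2) (\<lambda>w. (g1 (fst w), g2 (snd w))) (\<lambda>w. (V1 (fst w), V2 (snd w)))"
proof -
  interpret A: awgn F1 N1 g1 V1 by fact
  interpret B: awgn F2 N2 g2 V2 by fact
  interpret P: pair_prob_space F1 F2 ..
  let ?F = "F1 \<Otimes>\<^sub>M F2" and ?N = "N1 \<Otimes>\<^sub>M N2"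
    and ?g = "\<lambda>w. (g1 (fst w), g2 (snd w))" and ?V = "\<lambda>w. (V1 (fst w), V2 (snd w))"
  show PP: "awgn ?F ?N ?g ?V"
  proof
    have "integrable ?F (\<lambda>w. (norm (g1 (fst w)))\<^sup>2 + (norm (g2 (snd w)))\<^sup>2)"
      by (intro Bochner_Integration.integrable_add integral_pair_fst(1)[OF B.prob_space_axioms A.g_square]
        integral_pair_snd(1)[OF A.prob_space_axioms B.prob_space_axioms B.g_square])
    then show "integrable ?F (\<lambda>w. (norm (?g w))\<^sup>2)"
      by (simp add: norm_Pair)
  qed (simp_all add: borel_prod[symmetric])
  interpret PA: awgn ?F ?N ?g ?V by (rule PP)
  obtain f1 where f1: "is_density F1 N1 g1 V1 f1" using A.density_exists by blast
  obtain f2 where f2: "is_density F2 N2 g2 V2 f2" using B.density_exists by blast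
  note [measurable] = is_densityD(1)[OF f1] is_densityD(1)[OF f2]
  obtain C1 where C1: "\<And>x. f1 x \<le> C1" using is_densityD(3)[OF f1] by blast
  obtain C2 where C2: "\<And>x. f2 x \<le> C2" using is_densityD(3)[OF f2] by blast
  let ?r = "\<lambda>((a, b), (c, d)). ((a, c), (b, d))"
  let ?f = "\<lambda>x. f1 (fst (fst x), fst (snd x)) * f2 (snd (fst x), snd (snd x))"
  let ?B1 = "(lborel :: 'a measure) \<Otimes>\<^sub>M distr F1 N1 V1" and ?B2 = "(lborel :: 'b measure) \<Otimes>\<^sub>M distr F2 N2 V2"
  have fm: "?f \<in> borel_measurable (borel \<Otimes>\<^sub>M ?N)" by (simp add: borel_prod[symmetric])
  \<comment> \<open>Lebesgue measure and the law of the side information both split; regrouping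
    pairs each output with its own side information.\<close>
  have base: "(lborel :: ('a \<times> 'b) measure) \<Otimes>\<^sub>M distr ?F ?N ?V = distr (?B1 \<Otimes>\<^sub>M ?B2) (borel \<Otimes>\<^sub>M ?N) ?r"
  proof -
    have "distr ?F ?N ?V = distr F1 N1 V1 \<Otimes>\<^sub>M distr F2 N2 V2"
      by (subst pair_measure_distr) (simp_all add: B.K.sigma_finite_measure_axioms case_prod_unfold)
    then have "(lborel :: ('a \<times> 'b) measure) \<Otimes>\<^sub>M distr ?F ?N ?V
      = (lborel \<Otimes>\<^sub>M lborel) \<Otimes>\<^sub>M (distr F1 N1 V1 \<Otimes>\<^sub>M distr F2 N2 V2)"
      by (simp add: lborel_prod)
    also have "\<dots> = distr (?B1 \<Otimes>\<^sub>M ?B2) ((lborel \<Otimes>\<^sub>M lborel) \<Otimes>\<^sub>M (distr F1 N1 V1 \<Otimes>\<^sub>M distr F2 N2 V2)) ?r"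
      by (rule distr_pair_rearrange[symmetric])
         (rule sigma_finite_lborel A.K.sigma_finite_measure_axioms B.K.sigma_finite_measure_axioms)+
    also have "\<dots> = distr (?B1 \<Otimes>\<^sub>M ?B2) (borel \<Otimes>\<^sub>M ?N) ?r"
      by (intro distr_cong refl sets_pair_measure_cong) (simp_all add: borel_prod[symmetric] cong: sets_pair_measure_cong)
    finally show ?thesis .
  qed
  have "channel ?F ?N ?g ?V = distr ((F1 \<Otimes>\<^sub>M F2) \<Otimes>\<^sub>M (gaussian \<Otimes>\<^sub>M gaussian)) (borel \<Otimes>\<^sub>M ?N)
      (\<lambda>x. ((g1 (fst (fst x)) + fst (snd x), g2 (snd (fst x)) + snd (snd x)), ?V (fst x)))"
    unfolding channel_def gaussian_prod by (simp add: case_prod_unfold plus_prod_def)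
  also have "(F1 \<Otimes>\<^sub>M F2) \<Otimes>\<^sub>M ((gaussian :: 'a measure) \<Otimes>\<^sub>M (gaussian :: 'b measure))
    = distr ((F1 \<Otimes>\<^sub>M gaussian) \<Otimes>\<^sub>M (F2 \<Otimes>\<^sub>M gaussian)) ((F1 \<Otimes>\<^sub>M F2) \<Otimes>\<^sub>M (gaussian \<Otimes>\<^sub>M gaussian)) ?r"
    by (rule distr_pair_rearrange[symmetric])
       (rule gaussian.sigma_finite_measure_axioms A.sigma_finite_measure_axioms B.sigma_finite_measure_axioms)+
  finally have "channel ?F ?N ?g ?V = distr ((F1 \<Otimes>\<^sub>M gaussian) \<Otimes>\<^sub>M (F2 \<Otimes>\<^sub>M gaussian)) (borel \<Otimes>\<^sub>M ?N)
      (\<lambda>x. ((g1 (fst (fst x)) + snd (fst x), g2 (fst (snd x)) + snd (snd x)), (V1 (fst (fst x)), V2 (fst (snd x)))))"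
    by (simp add: distr_distr comp_def case_prod_unfold borel_prod[symmetric])
  also have "\<dots> = distr (channel F1 N1 g1 V1 \<Otimes>\<^sub>M channel F2 N2 g2 V2) (borel \<Otimes>\<^sub>M ?N) ?r"
    using B.prob_space_channel unfolding channel_def
    by (subst pair_measure_distr)
       (auto simp: distr_distr comp_def case_prod_unfold borel_prod[symmetric] intro: prob_space_imp_sigma_finite)
  also have "channel F1 N1 g1 V1 \<Otimes>\<^sub>M channel F2 N2 g2 V2 = density (?B1 \<Otimes>\<^sub>M ?B2) (\<lambda>x. ennreal (?f (?r x)))"
  proof -
    have s: "sigma_finite_measure (density ?B2 (\<lambda>x. ennreal (f2 x)))"
      using prob_space_imp_sigma_finite[OF B.prob_space_channel] by (simp add: is_densityD(4)[OF f2])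
    show ?thesis
      unfolding is_densityD(4)[OF f1] is_densityD(4)[OF f2]
      by (subst pair_measure_density)
         (use is_densityD(5)[OF f1] is_densityD(5)[OF f2] s B.LK.sigma_finite_measure_axioms in
           \<open>auto simp: case_prod_unfold ennreal_mult is_densityD(2)[OF f1] is_densityD(2)[OF f2]\<close>)
  qed
  also have "distr (density (?B1 \<Otimes>\<^sub>M ?B2) (\<lambda>x. ennreal (?f (?r x)))) (borel \<Otimes>\<^sub>M ?N) ?r
    = density (distr (?B1 \<Otimes>\<^sub>M ?B2) (borel \<Otimes>\<^sub>M ?N) ?r) (\<lambda>x. ennreal (?f x))"
    by (rule density_distr[symmetric]) (use fm in \<open>simp_all add: borel_prod[symmetric] case_prod_unfold\<close>)
  finally have "is_density ?F ?N ?g ?V ?f"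
    unfolding base[symmetric]
    by (intro is_densityI[of _ _ "C1 * C2"])
       (use fm C1 C2 is_densityD(2)[OF f1] is_densityD(2)[OF f2] in
         \<open>auto intro!: mult_mono order_trans[OF is_densityD(2)[OF f1] C1]\<close>)
  note f = this
  have c1: "channel F1 N1 g1 V1 = distr (channel ?F ?N ?g ?V) (borel \<Otimes>\<^sub>M N1) (\<lambda>x. (fst (fst x), fst (snd x)))"
  proof -
    have "channel F1 N1 g1 V1 = channel (distr ?F F1 fst) N1 g1 V1"
      by (simp add: B.distr_pair_fst)
    also have "\<dots> = channel ?F N1 (\<lambda>w. g1 (fst w)) (\<lambda>w. V1 (fst w))"
      by (rule channel_distr) simp_all
    also have "\<dots> = distr (channel ?F ?N ?g ?V) (borel \<Otimes>\<^sub>M N1) (\<lambda>x. (fst (fst x), fst (snd x)))"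
      using PA.channel_image[of fst fst N1] by (simp add: distr_gaussian_fst)
    finally show ?thesis .
  qed
  have c2: "channel F2 N2 g2 V2 = distr (channel ?F ?N ?g ?V) (borel \<Otimes>\<^sub>M N2) (\<lambda>x. (snd (fst x), snd (snd x)))"
  proof -
    have "channel F2 N2 g2 V2 = channel (distr ?F F2 snd) N2 g2 V2"
      by (subst distr_pair_snd[OF A.prob_space_axioms B.sigma_finite_measure_axioms]) (rule refl)
    also have "\<dots> = channel ?F N2 (\<lambda>w. g2 (snd w)) (\<lambda>w. V2 (snd w))"
      by (rule channel_distr) simp_all
    also have "\<dots> = distr (channel ?F ?N ?g ?V) (borel \<Otimes>\<^sub>M N2) (\<lambda>x. (snd (fst x), snd (snd x)))"
      using PA.channel_image[of snd snd N2] by (simp add: distr_gaussian_snd)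
    finally show ?thesis .
  qed
  have S1: "(\<lambda>x. (fst (fst x), fst (snd x))) \<in> measurable (channel ?F ?N ?g ?V) (borel \<Otimes>\<^sub>M N1)"
    and S2: "(\<lambda>x. (snd (fst x), snd (snd x))) \<in> measurable (channel ?F ?N ?g ?V) (borel \<Otimes>\<^sub>M N2)"
    by simp_all
  note p1 = A.density_pullback[OF f1 S1 c1] and p2 = B.density_pullback[OF f2 S2 c2]
  have "(\<integral>x. ln (?f x) \<partial>channel ?F ?N ?g ?V)
    = (\<integral>x. ln (f1 (fst (fst x), fst (snd x))) + ln (f2 (snd (fst x), snd (snd x))) \<partial>channel ?F ?N ?g ?V)"
  proof (rule integral_cong_AE)
    show "AE x in channel ?F ?N ?g ?V. ln (?f x) = ln (f1 (fst (fst x), fst (snd x))) + ln (f2 (snd (fst x), snd (snd x)))"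
      using p1(1) p2(1) by eventually_elim (simp add: ln_mult)
  qed (use fm in \<open>simp_all add: borel_prod[symmetric]\<close>)
  then show "ent ?F ?N ?g ?V = ent F1 N1 g1 V1 + ent F2 N2 g2 V2"
    using p1 p2 by (simp add: PA.ent_eq[OF f])
qed

text \<open>Unconditional entropy is treated as conditioning on a constant, so every conditional
  inequality applies to it.\<close>

abbreviation ent0 :: "'w measure \<Rightarrow> ('w \<Rightarrow> 'a::euclidean_space) \<Rightarrow> real" where
  "ent0 F g \<equiv> ent F (count_space (UNIV :: unit set)) g (\<lambda>_. ())"

abbreviation awgn0 :: "'w measure \<Rightarrow> ('w \<Rightarrow> 'a::euclidean_space) \<Rightarrow> bool" where
  "awgn0 F g \<equiv> awgn F (count_space (UNIV :: unit set)) g (\<lambda>_. ())"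

lemma (in awgn) awgn_trivial: "awgn0 F g"
  by standard (simp_all add: g_square)

lemma (in awgn) awgn_observation:
  assumes "W \<in> measurable F N'"
  shows "awgn F N' g W"
  by standard (simp_all add: g_square assms)

text \<open>Adjoins independent randomness to the source. The side information may use it although
  the signal does not; this is how \<open>U\<close> receives its own noise.\<close>

lemma (in awgn) awgn_fst:
  assumes "prob_space G" "W \<in> measurable (F \<Otimes>\<^sub>M G) N'"
  shows "awgn (F \<Otimes>\<^sub>M G) N' (\<lambda>x. g (fst x)) W"
proof -
  interpret G: prob_space G by fact
  interpret P: pair_prob_space F G ..
  show ?thesis
    by standard (simp_all add: assms integral_pair_fst(1)[OF assms(1) g_square])
qed

lemma (in awgn) ent_le_ent0: "ent F N g V \<le> ent0 F g"
  by (rule ent_le_comp) simp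

section \<open>Mutual information as a difference of entropies\<close>

lemma (in awgn) channel_trivial:
  "channel F (count_space UNIV) g (\<lambda>_. ()) = distr (channel F N g V) (borel \<Otimes>\<^sub>M count_space UNIV) (\<lambda>x. (fst x, ()))"
  using channel_image[of "\<lambda>x. x" "\<lambda>_. ()" "count_space UNIV"] by (simp add: distr_gaussian_id)

lemma distr_channel_fst_trivial:
  assumes "awgn0 F g" and p: "is_density F (count_space UNIV) g (\<lambda>_. ()) p"
  shows "distr (channel F (count_space UNIV) g (\<lambda>_. ())) borel fst = density lborel (\<lambda>y. ennreal (p (y, ())))"
proof (rule measure_eqI)
  interpret awgn F "count_space UNIV" g "\<lambda>_. ()" by fact
  note [measurable] = is_densityD(1)[OF p]
  let ?C = "channel F (count_space UNIV) g (\<lambda>_. ())"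
  fix A assume "A \<in> sets (distr ?C borel fst)"
  then have [measurable]: "A \<in> sets borel" by simp
  have "emeasure (distr ?C borel fst) A = (\<integral>\<^sup>+x. indicator A x \<partial>distr ?C borel fst)" by simp
  also have "\<dots> = (\<integral>\<^sup>+x. indicator A (fst x) \<partial>?C)"
    by (subst nn_integral_distr) simp_all
  also have "\<dots> = (\<integral>\<^sup>+x. ennreal (p x) * indicator A (fst x) \<partial>(lborel \<Otimes>\<^sub>M distr F (count_space UNIV) (\<lambda>_. ())))"
    unfolding is_densityD(4)[OF p] using is_densityD(5)[OF p] by (subst nn_integral_density) simp_all
  also have "\<dots> = (\<integral>\<^sup>+y. ennreal (p (y, ())) * indicator A y \<partial>lborel)"
    by (subst nn_integral_base) (simp_all add: emeasure_space_1)
  finally show "emeasure (distr ?C borel fst) A = emeasure (density lborel (\<lambda>y. ennreal (p (y, ())))) A"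
    by (simp add: emeasure_density)
qed simp

lemma (in awgn) distr_channel_fst:
  assumes p: "is_density F (count_space UNIV) g (\<lambda>_. ()) p"
  shows "distr (channel F N g V) borel fst = density lborel (\<lambda>y. ennreal (p (y, ())))"
  unfolding distr_channel_fst_trivial[OF awgn_trivial p, symmetric] channel_trivial
  by (simp add: distr_distr comp_def)

lemma (in awgn) distr_channel_snd: "distr (channel F N g V) N snd = distr F N V"
proof -
  have "distr (channel F N g V) N snd = distr (F \<Otimes>\<^sub>M (gaussian :: 'a measure)) N (\<lambda>x. V (fst x))"
    unfolding channel_def by (simp add: distr_distr comp_def case_prod_unfold)
  also have "\<dots> = distr (distr (F \<Otimes>\<^sub>M (gaussian :: 'a measure)) F fst) N V"
    by (subst distr_distr) (simp_all add: comp_def)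
  finally show ?thesis by (simp add: gaussian.distr_pair_fst)
qed

text \<open>The integrand is the logarithm of conditional over unconditional output density. Both
  orders of the arguments occur in the rates: the unconditional term has the inputs first, the
  conditional terms have the output first.\<close>

lemma
  fixes g :: "'w \<Rightarrow> 'a::euclidean_space"
  assumes M: "prob_space M" and A: "awgn F N g V"
    and X[measurable]: "X \<in> measurable M N" and Y[measurable]: "Y \<in> borel_measurable M"
    and law: "distr M (borel \<Otimes>\<^sub>M N) (\<lambda>s. (Y s, X s)) = channel F N g V"
  shows mutual_information_output_first:
    "prob_space.mutual_information M 2 borel N Y X = (ent0 F g - ent F N g V) / ln 2"
  and mutual_information_output_second:
    "prob_space.mutual_information M 2 N borel X Y = (ent0 F g - ent F N g V) / ln 2"
proof -
  interpret prob_space M by fact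
  interpret information_space M 2 by standard simp
  interpret A: awgn F N g V by fact
  interpret A0: awgn F "count_space UNIV" g "\<lambda>_. ()" by (rule A.awgn_trivial)
  let ?K = "distr F N V" and ?L = "channel F N g V"
  obtain f where f: "is_density F N g V f" using A.density_exists by blast
  obtain p where p: "is_density F (count_space UNIV) g (\<lambda>_. ()) p" using A0.density_exists by blast
  note [measurable] = is_densityD(1)[OF f] is_densityD(1)[OF p]
  have K: "distr M N X = ?K"
  proof -
    have "distr M N X = distr (distr M (borel \<Otimes>\<^sub>M N) (\<lambda>s. (Y s, X s))) N snd"
      by (simp add: distr_distr comp_def)
    then show ?thesis by (simp add: law A.distr_channel_snd)
  qed
  have pY: "distr M borel Y = density lborel (\<lambda>y. ennreal (p (y, ())))"
  proof -
    have "distr M borel Y = distr (distr M (borel \<Otimes>\<^sub>M N) (\<lambda>s. (Y s, X s))) borel fst"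
      by (simp add: distr_distr comp_def)
    then show ?thesis by (simp add: law A.distr_channel_fst[OF p])
  qed
  have dY: "distributed M lborel Y (\<lambda>y. ennreal (p (y, ())))"
    unfolding distributed_def using pY by (simp cong: distr_cong)
  \<comment> \<open>The input has density 1 with respect to its own law, so the density formula
    applies to inputs without a Lebesgue density.\<close>
  have dX: "distributed M ?K X (\<lambda>_. ennreal 1)"
    unfolding distributed_def using K by (simp add: density_1 cong: distr_cong)
  have dYX: "distributed M (lborel \<Otimes>\<^sub>M ?K) (\<lambda>s. (Y s, X s)) (\<lambda>x. ennreal (f x))"
    unfolding distributed_def using law is_densityD(4,5)[OF f] by (simp cong: distr_cong)
  have dXY: "distributed M (?K \<Otimes>\<^sub>M lborel) (\<lambda>s. (X s, Y s)) (\<lambda>x. ennreal (f (snd x, fst x)))"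
    using distributed_swap[OF sigma_finite_lborel A.K.sigma_finite_measure_axioms dYX]
    by (simp add: case_prod_unfold)
  let ?i = "\<lambda>x. f x * log 2 (f x / p (fst x, ()))"
  have S: "(\<lambda>x. (fst x, ())) \<in> measurable ?L (borel \<Otimes>\<^sub>M count_space UNIV)" by simp
  note pp = A0.density_pullback[OF p S A.channel_trivial]
  have im: "?i \<in> borel_measurable (lborel \<Otimes>\<^sub>M ?K)" by simp
  have "(\<integral>x. ?i x \<partial>(lborel \<Otimes>\<^sub>M ?K)) = (\<integral>x. log 2 (f x / p (fst x, ())) \<partial>?L)"
    unfolding is_densityD(4)[OF f] using is_densityD(2,5)[OF f]
    by (subst integral_density) simp_all
  also have "\<dots> = (\<integral>x. (ln (f x) - ln (p (fst x, ()))) / ln 2 \<partial>?L)"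
  proof (rule integral_cong_AE)
    show "AE x in ?L. log 2 (f x / p (fst x, ())) = (ln (f x) - ln (p (fst x, ()))) / ln 2"
      using A.density_pos[OF f] pp(1) by eventually_elim (simp add: log_def ln_div)
  qed simp_all
  also have "\<dots> = (ent0 F g - ent F N g V) / ln 2"
    using A.integrable_ln_density[OF f] pp by (simp add: A.ent_eq[OF f])
  finally have I: "(\<integral>x. ?i x \<partial>(lborel \<Otimes>\<^sub>M ?K)) = (ent0 F g - ent F N g V) / ln 2" .
  \<comment> \<open>\<open>mutual_information\<close> depends on its space arguments only through
    their measurable structure, so the reference measures may be inserted.\<close>
  have "mutual_information 2 borel N Y X = mutual_information 2 lborel ?K Y X"
    unfolding mutual_information_def
    by (intro arg_cong2[where f="KL_divergence 2"] arg_cong2[where f=pair_measure] distr_cong) simp_all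
  also have "\<dots> = (\<integral>x. ?i x \<partial>(lborel \<Otimes>\<^sub>M ?K))"
    by (subst mutual_information_distr[OF sigma_finite_lborel A.K.sigma_finite_measure_axioms dY _ dX _ dYX])
       (simp_all add: is_densityD(2)[OF f] is_densityD(2)[OF p])
  finally show "mutual_information 2 borel N Y X = (ent0 F g - ent F N g V) / ln 2" using I by simp
  have "mutual_information 2 N borel X Y = mutual_information 2 ?K lborel X Y"
    unfolding mutual_information_def
    by (intro arg_cong2[where f="KL_divergence 2"] arg_cong2[where f=pair_measure] distr_cong) simp_all
  also have "\<dots> = (\<integral>x. ?i (snd x, fst x) \<partial>(?K \<Otimes>\<^sub>M lborel))"
    by (subst mutual_information_distr[OF A.K.sigma_finite_measure_axioms sigma_finite_lborel dX _ dY _ dXY])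
       (simp_all add: is_densityD(2)[OF f] is_densityD(2)[OF p])
  also have "\<dots> = (\<integral>x. ?i x \<partial>(lborel \<Otimes>\<^sub>M ?K))"
    using A.LK.integral_product_swap[OF im] by (simp add: case_prod_unfold)
  finally show "mutual_information 2 N borel X Y = (ent0 F g - ent F N g V) / ln 2" using I by simp
qed

text \<open>The centred noise density is the test density. The bound is crude, but it depends on the
  input only through its second moment.\<close>

lemma ent0_le:
  fixes g :: "'w \<Rightarrow> 'a::euclidean_space"
  assumes "awgn0 F g"
  shows "ent0 F g \<le> real DIM('a) * ln (sqrt pi)
    + 2 * (\<integral>w. (norm (g w))\<^sup>2 \<partial>F) + 2 * (\<integral>z. (norm (z::'a))\<^sup>2 \<partial>gaussian)"
proof -
  interpret awgn F "count_space UNIV" g "\<lambda>_. ()" by fact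
  let ?L = "channel F (count_space UNIV) g (\<lambda>_. ())"
  interpret L: prob_space ?L by (rule prob_space_channel)
  have "ent0 F g \<le> - (\<integral>x. ln (gauss_density (fst x)) \<partial>?L)"
  proof (rule ent_le)
    show "(\<integral>\<^sup>+x. ennreal (gauss_density (fst x)) \<partial>((lborel :: 'a measure) \<Otimes>\<^sub>M distr F (count_space UNIV) (\<lambda>_. ()))) \<le> 1"
      by (subst nn_integral_base) (simp_all add: nn_integral_gauss_density emeasure_space_1)
    show "integrable ?L (\<lambda>x. ln (gauss_density (fst x)))"
      unfolding ln_gauss_density using integrable_channel_norm_square by simp
  qed (simp_all add: gauss_density_pos)
  also have "- (\<integral>x. ln (gauss_density (fst x)) \<partial>?L) = real DIM('a) * ln (sqrt pi) + (\<integral>x. (norm (fst x))\<^sup>2 \<partial>?L)"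
    unfolding ln_gauss_density using integrable_channel_norm_square L.prob_space by simp
  finally show ?thesis using integral_channel_norm_square_le by simp
qed

text \<open>The first output becomes side information for the second, with its noise now counted as
  part of the source. As a random variable it is then signal plus fresh noise, exactly the form of
  the auxiliary \<open>U\<close>.\<close>

lemma ent_chain_le:
  fixes g :: "'w \<Rightarrow> 'a::euclidean_space \<times> 'b::euclidean_space"
  assumes "awgn F N g V"
  shows "ent F N g V \<le> ent F N (\<lambda>w. fst (g w)) V +
    ent (F \<Otimes>\<^sub>M (gaussian :: 'a measure)) (borel \<Otimes>\<^sub>M N) (\<lambda>x. snd (g (fst x)))
      (\<lambda>x. (fst (g (fst x)) + snd x, V (fst x)))"
proof -
  interpret awgn F N g V by fact
  let ?G = "F \<Otimes>\<^sub>M (gaussian :: 'a measure)" and ?U = "\<lambda>x. (fst (g (fst x)) + snd x, V (fst x))"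
    and ?g2 = "\<lambda>x. snd (g (fst x))" and ?L = "channel F N g V"
  let ?N = "(borel :: 'a measure) \<Otimes>\<^sub>M N"
  interpret A: awgn F N "\<lambda>w. fst (g w)" V
    using awgn_comp[of fst "\<lambda>x. x" N] by (simp add: norm_fst_snd_le)
  interpret B0: awgn F N "\<lambda>w. snd (g w)" V
    using awgn_comp[of snd "\<lambda>x. x" N] by (simp add: norm_fst_snd_le)
  interpret B: awgn ?G ?N ?g2 ?U
    by (rule B0.awgn_fst[OF gaussian.prob_space_axioms]) simp
  obtain p where p: "is_density F N (\<lambda>w. fst (g w)) V p" using A.density_exists by blast
  obtain f where f: "is_density ?G ?N ?g2 ?U f" using B.density_exists by blast
  note [measurable] = is_densityD(1)[OF f] is_densityD(1)[OF p]
  have cp: "channel F N (\<lambda>w. fst (g w)) V = distr ?L (borel \<Otimes>\<^sub>M N) (\<lambda>x. (fst (fst x), snd x))"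
    using channel_image[of fst "\<lambda>x. x" N] by (simp add: distr_gaussian_fst)
  \<comment> \<open>The noise pair is split: its first component joins the source and only the
    second remains channel noise.\<close>
  have cf: "channel ?G ?N ?g2 ?U = distr ?L (borel \<Otimes>\<^sub>M ?N) (\<lambda>x. (snd (fst x), (fst (fst x), snd x)))"
  proof -
    have "distr ?L (borel \<Otimes>\<^sub>M ?N) (\<lambda>x. (snd (fst x), (fst (fst x), snd x)))
      = distr (F \<Otimes>\<^sub>M gaussian) (borel \<Otimes>\<^sub>M ?N)
          (\<lambda>x. (snd (g (fst x)) + snd (snd x), (fst (g (fst x)) + fst (snd x), V (fst x))))"
      unfolding channel_def by (simp add: distr_distr comp_def case_prod_unfold)
    also have "\<dots> = distr (F \<Otimes>\<^sub>M ((gaussian :: 'a measure) \<Otimes>\<^sub>M (gaussian :: 'b measure))) (borel \<Otimes>\<^sub>M ?N)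
          (\<lambda>x. (snd (g (fst x)) + snd (snd x), (fst (g (fst x)) + fst (snd x), V (fst x))))"
      unfolding gaussian_prod ..
    also have "\<dots> = distr ((F \<Otimes>\<^sub>M (gaussian :: 'a measure)) \<Otimes>\<^sub>M (gaussian :: 'b measure)) (borel \<Otimes>\<^sub>M ?N)
          (\<lambda>x. (snd (g (fst (fst x))) + snd x, (fst (g (fst (fst x))) + snd (fst x), V (fst (fst x)))))"
      by (subst distr_pair_assoc[OF gaussian.sigma_finite_measure_axioms gaussian.sigma_finite_measure_axioms, symmetric])
         (simp add: distr_distr comp_def case_prod_unfold)
    finally show ?thesis by (simp add: channel_def case_prod_unfold)
  qed
  have S1: "(\<lambda>x. (fst (fst x), snd x)) \<in> measurable ?L (borel \<Otimes>\<^sub>M N)"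
    and S2: "(\<lambda>x. (snd (fst x), (fst (fst x), snd x))) \<in> measurable ?L (borel \<Otimes>\<^sub>M ?N)"
    by simp_all
  note pp = A.density_pullback[OF p S1 cp] and pf = B.density_pullback[OF f S2 cf]
  let ?q = "\<lambda>x. p (fst (fst x), snd x) * f (snd (fst x), (fst (fst x), snd x))"
  have pos: "AE x in ?L. ?q x > 0" using pp(1) pf(1) by eventually_elim simp
  have ln: "AE x in ?L. ln (p (fst (fst x), snd x)) + ln (f (snd (fst x), (fst (fst x), snd x))) = ln (?q x)"
    using pp(1) pf(1) by eventually_elim (simp add: ln_mult)
  have [measurable]: "?q \<in> borel_measurable (borel \<Otimes>\<^sub>M N)" by simp
  have int: "integrable ?L (\<lambda>x. ln (?q x))"
    by (rule integrable_cong_AE_imp[OF Bochner_Integration.integrable_add[OF pp(2) pf(2)]]) (use ln in simp_all)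
  \<comment> \<open>The first factor \<open>p\<close> of the test density is the density of the side
    information against which the second factor is normalised, so the product has mass 1.\<close>
  have dU: "distr ?G ?N ?U = density (lborel \<Otimes>\<^sub>M distr F N V) (\<lambda>x. ennreal (p x))"
    unfolding is_densityD(4)[OF p, symmetric] channel_def by (simp add: case_prod_unfold)
  have "ent F N g V \<le> - (\<integral>x. ln (?q x) \<partial>?L)"
  proof (rule ent_le[OF _ _ _ pos int])
    have fm[measurable]: "(\<lambda>y. \<integral>\<^sup>+z. ennreal (f (z, y)) \<partial>lborel) \<in> borel_measurable ?N"
      by (rule lborel.borel_measurable_nn_integral) simp
    have "(\<integral>\<^sup>+x. ennreal (?q x) \<partial>((lborel :: ('a \<times> 'b) measure) \<Otimes>\<^sub>M distr F N V))
      = (\<integral>\<^sup>+w. (\<integral>\<^sup>+y. ennreal (p (fst y, V w) * f (snd y, (fst y, V w))) \<partial>lborel) \<partial>F)"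
      by (subst nn_integral_base) simp_all
    also have "\<dots> = (\<integral>\<^sup>+w. (\<integral>\<^sup>+y. ennreal (p (y, V w)) * (\<integral>\<^sup>+z. ennreal (f (z, (y, V w))) \<partial>lborel) \<partial>lborel) \<partial>F)"
    proof (intro nn_integral_cong)
      fix w assume "w \<in> space F"
      then have [measurable]: "V w \<in> space N" by (rule measurable_space[OF V])
      show "(\<integral>\<^sup>+y. ennreal (p (fst y, V w) * f (snd y, (fst y, V w))) \<partial>lborel)
        = (\<integral>\<^sup>+y. ennreal (p (y, V w)) * (\<integral>\<^sup>+z. ennreal (f (z, (y, V w))) \<partial>lborel) \<partial>lborel)"
        unfolding lborel_prod[symmetric]
        by (subst lborel.nn_integral_fst[symmetric])
           (simp_all add: ennreal_mult is_densityD(2)[OF f] is_densityD(2)[OF p] nn_integral_cmult)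
    qed
    also have "\<dots> = (\<integral>\<^sup>+x. ennreal (p x) * (\<integral>\<^sup>+z. ennreal (f (z, x)) \<partial>lborel) \<partial>(lborel \<Otimes>\<^sub>M distr F N V))"
      by (subst A.nn_integral_base) simp_all
    also have "\<dots> = (\<integral>\<^sup>+y. (\<integral>\<^sup>+z. ennreal (f (z, y)) \<partial>lborel) \<partial>distr ?G ?N ?U)"
      unfolding dU by (subst nn_integral_density) simp_all
    also have "\<dots> = (\<integral>\<^sup>+x. ennreal (f x) \<partial>(lborel \<Otimes>\<^sub>M distr ?G ?N ?U))"
      by (subst B.nn_integral_base) (simp_all add: nn_integral_distr)
    finally show "(\<integral>\<^sup>+x. ennreal (?q x) \<partial>((lborel :: ('a \<times> 'b) measure) \<Otimes>\<^sub>M distr F N V)) \<le> 1"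
      by (simp add: B.nn_integral_density_base[OF f])
  qed (simp_all add: is_densityD(2)[OF f] is_densityD(2)[OF p])
  also have "(\<integral>x. ln (?q x) \<partial>?L) = (\<integral>x. ln (p (fst (fst x), snd x)) + ln (f (snd (fst x), (fst (fst x), snd x))) \<partial>?L)"
    using ln pp(2) pf(2) int by (intro integral_cong_AE) (auto dest: borel_measurable_integrable elim!: eventually_mono)
  finally show ?thesis using pp pf by simp
qed

text \<open>The test density \<open>q (\<cdot>, u)\<close> is that of a Gaussian with mean \<open>A u\<close> and covariance \<open>I + A\<close>, up to
  the common scale of the noise, where \<open>A\<close> is the orthogonal projection onto \<open>span B\<close>; note that
  \<open>(I + A)\<^sup>-\<^sup>1 = I - A / 2\<close>.\<close>

lemma ent_gap_le:
  fixes g :: "'w \<Rightarrow> 'a::euclidean_space" and B :: "'a set"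
  assumes "awgn0 F g"
    and fin: "finite B" and orth: "pairwise orthogonal B" and unit: "\<And>b. b \<in> B \<Longrightarrow> norm b = 1"
    and card: "card B \<le> DIM('b::euclidean_space)"
    and span: "\<And>w. (\<Sum>b\<in>B. (g w \<bullet> b) *\<^sub>R b) = g w"
  shows "ent (F \<Otimes>\<^sub>M (gaussian :: 'a measure)) borel (\<lambda>x. g (fst x)) (\<lambda>x. g (fst x) + snd x)
    \<le> noise_ent TYPE('a) + real DIM('b) * ln (sqrt 2)"
proof -
  interpret A0: awgn F "count_space UNIV" g "\<lambda>_. ()" by fact
  let ?G = "F \<Otimes>\<^sub>M (gaussian :: 'a measure)" and ?g = "\<lambda>x. g (fst x)" and ?U = "\<lambda>x. g (fst x) + snd x"
  interpret awgn ?G borel ?g ?U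
    by (rule A0.awgn_fst[OF gaussian.prob_space_axioms]) simp
  let ?L = "channel ?G borel ?g ?U" and ?P = "?G \<Otimes>\<^sub>M (gaussian :: 'a measure)"
  \<comment> \<open>\<open>A\<close> is the orthogonal projection, \<open>s\<close> its squared norm
    and \<open>t\<close> its bilinear form; \<open>D\<close> bounds the mass of the
    variance-doubling tilt.\<close>
  define A where "A y = (\<Sum>b\<in>B. (y \<bullet> b) *\<^sub>R b)" for y
  define s where "s y = (\<Sum>b\<in>B. (y \<bullet> b)\<^sup>2)" for y
  define t where "t y z = (\<Sum>b\<in>B. (y \<bullet> b) * (z \<bullet> b))" for y z
  define D where "D = sqrt 2 ^ DIM('b)"
  have D: "D > 0" by (simp add: D_def)
  have [measurable]: "A \<in> borel_measurable borel" "s \<in> borel_measurable borel"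
    unfolding A_def s_def by simp_all
  have onb: "c \<bullet> b = (if c = b then 1 else 0)" if "c \<in> B" "b \<in> B" for b c
    using orth unit that by (auto simp: pairwise_def orthogonal_def norm_eq_1)
  have Ab: "A y \<bullet> b = y \<bullet> b" if "b \<in> B" for y b
    using that fin by (simp add: A_def inner_sum_left onb if_distrib[of "\<lambda>x. _ * x"] cong: sum.cong if_cong)
  have Ag: "A (g w) = g w" for w by (simp add: A_def span)
  have Aadd: "A (y + z) = A y + A z" for y z
    by (simp add: A_def inner_add_left scaleR_add_left sum.distrib)
  have inner_A: "z \<bullet> A y = t y z" for y z
    by (simp add: A_def t_def inner_sum_right)
  have norm_A: "(norm (A y))\<^sup>2 = s y" for y
    unfolding power2_norm_eq_inner inner_A by (simp add: t_def s_def Ab power2_eq_square)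
  have s0: "s y \<ge> 0" for y by (simp add: s_def sum_nonneg)
  \<comment> \<open>For y = g + z and u = g + z' both arguments lose the signal: y - A u = z - A z',
    since \<open>A\<close> fixes \<open>g\<close>, and y - u = z - z'. So the expectation of
    \<open>ln q\<close> does not depend on the law of the input.\<close>
  define q where "q x = gauss_density (fst x - A (snd x)) * exp (s (fst x - snd x) / 2) / D" for x
  have q: "q x > 0" for x using D by (simp add: q_def gauss_density_pos)
  have [measurable]: "q \<in> borel_measurable (borel \<Otimes>\<^sub>M borel)" unfolding q_def by measurable
  \<comment> \<open>The square in the noise density contributes twice the cross term, the tilt takes
    one of these back, and the quadratic terms of the two noises remain with opposite signs.\<close>
  have lnq: "ln (q (g (fst x) + z, g (fst x) + snd x))
    = ln (gauss_density z) + t (snd x) z + s z / 2 - s (snd x) / 2 - ln D" for x z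
  proof -
    have n: "(norm (z - A (snd x)))\<^sup>2 = (norm z)\<^sup>2 - 2 * t (snd x) z + s (snd x)"
      unfolding norm_A[symmetric] inner_A[symmetric] power2_norm_eq_inner
      by (simp add: inner_diff inner_commute)
    have ss: "s (z - snd x) = s z - 2 * t (snd x) z + s (snd x)"
      by (simp add: s_def t_def inner_diff_left power2_diff sum.distrib sum_subtractf sum_distrib_left algebra_simps)
    show ?thesis
      using D gauss_density_pos[of "z - A (snd x)"] by (simp add: q_def Aadd Ag ln_mult ln_div ln_gauss_density n ss field_simps)
  qed
  have inner_sq: "integrable gaussian (\<lambda>z. (z \<bullet> b)\<^sup>2)" for b :: 'a
  proof (rule Bochner_Integration.integrable_bound)
    show "integrable gaussian (\<lambda>z::'a. (norm z)\<^sup>2 * (norm b)\<^sup>2)"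
      using integrable_gaussian_norm_square[where 'a='a] by simp
    have "(z \<bullet> b)\<^sup>2 \<le> (norm z)\<^sup>2 * (norm b)\<^sup>2" for z
      using Cauchy_Schwarz_ineq[of z b] by (simp add: power2_norm_eq_inner)
    then show "AE z in gaussian. norm ((z \<bullet> b)\<^sup>2) \<le> norm ((norm z)\<^sup>2 * (norm b)\<^sup>2)" by simp
  qed simp
  have is': "integrable gaussian s" unfolding s_def using inner_sq by simp
  have snd_int: "integrable ?P (\<lambda>x. h (snd x))" "(\<integral>x. h (snd x) \<partial>?P) = (\<integral>z. h z \<partial>gaussian)"
    if "integrable gaussian h" for h :: "'a \<Rightarrow> real"
    by (rule integral_pair_snd[OF A0.FG.prob_space_axioms gaussian.prob_space_axioms that])+
  have fst_int: "integrable ?P (\<lambda>x. h (snd (fst x)))" "(\<integral>x. h (snd (fst x)) \<partial>?P) = (\<integral>z. h z \<partial>gaussian)"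
    if h: "integrable gaussian h" for h :: "'a \<Rightarrow> real"
  proof -
    note i = integral_pair_snd[OF A0.prob_space_axioms gaussian.prob_space_axioms h]
    show "integrable ?P (\<lambda>x. h (snd (fst x)))" "(\<integral>x. h (snd (fst x)) \<partial>?P) = (\<integral>z. h z \<partial>gaussian)"
      using integral_pair_fst[OF gaussian.prob_space_axioms i(1)] i(2) by simp_all
  qed
  have tb: "integrable ?P (\<lambda>x. (snd (fst x) \<bullet> b) * (snd x \<bullet> b))"
    "(\<integral>x. (snd (fst x) \<bullet> b) * (snd x \<bullet> b) \<partial>?P) = 0" for b
  proof -
    show i: "integrable ?P (\<lambda>x. (snd (fst x) \<bullet> b) * (snd x \<bullet> b))"
    proof (rule Bochner_Integration.integrable_bound)
      show "integrable ?P (\<lambda>x. (snd (fst x) \<bullet> b)\<^sup>2 + (snd x \<bullet> b)\<^sup>2)"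
        by (intro Bochner_Integration.integrable_add snd_int(1) fst_int(1) inner_sq)
      have "\<bar>x * y\<bar> \<le> x\<^sup>2 + y\<^sup>2" for x y :: real
      proof -
        have "2 * (\<bar>x\<bar> * \<bar>y\<bar>) \<le> x\<^sup>2 + y\<^sup>2" using sum_squares_bound[of "\<bar>x\<bar>" "\<bar>y\<bar>"] by simp
        moreover have "0 \<le> \<bar>x\<bar> * \<bar>y\<bar>" by simp
        ultimately show ?thesis unfolding abs_mult by linarith
      qed
      then show "AE x in ?P. norm ((snd (fst x) \<bullet> b) * (snd x \<bullet> b)) \<le> norm ((snd (fst x) \<bullet> b)\<^sup>2 + (snd x \<bullet> b)\<^sup>2)"
        by simp
    qed simp
    show "(\<integral>x. (snd (fst x) \<bullet> b) * (snd x \<bullet> b) \<partial>?P) = 0"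
      by (subst FG.integral_fst'[OF i, symmetric]) (simp add: integral_gaussian_inner)
  qed
  have t_int: "integrable ?P (\<lambda>x. t (snd (fst x)) (snd x))" "(\<integral>x. t (snd (fst x)) (snd x) \<partial>?P) = 0"
    unfolding t_def using tb by simp_all
  note ints = t_int snd_int[OF is'] fst_int[OF is'] snd_int[OF integrable_ln_gauss_density]
  \<comment> \<open>The two noises have the same law, so their quadratic terms cancel in
    expectation; the cross term has mean 0 by independence.\<close>
  have pull: "integrable ?P (\<lambda>x. ln (q (g (fst (fst x)) + snd x, g (fst (fst x)) + snd (fst x))))"
    "(\<integral>x. ln (q (g (fst (fst x)) + snd x, g (fst (fst x)) + snd (fst x))) \<partial>?P)
      = - noise_ent TYPE('a) - ln D"
    unfolding lnq noise_ent_def using ints FG.prob_space by simp_all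
  have "ent ?G borel ?g ?U \<le> - (\<integral>x. ln (q x) \<partial>?L)"
  proof (rule ent_le)
    have "(\<integral>\<^sup>+y. ennreal (q (y, u)) \<partial>lborel) \<le> 1" for u
    proof -
      have "(\<integral>\<^sup>+y. ennreal (q (y, u)) \<partial>lborel) = (\<integral>\<^sup>+y. ennreal (q (A u + y, u)) \<partial>lborel)"
        by (rule nn_integral_lborel_shift[symmetric]) simp
      also have "\<dots> = (\<integral>\<^sup>+y. ennreal (gauss_density y) * (ennreal (exp (s y / 2)) * ennreal (1 / D)) \<partial>lborel)"
      proof (rule nn_integral_cong)
        fix y
        \<comment> \<open>\<open>A u - u\<close> is orthogonal to \<open>B\<close>, so the shift
          that centres the noise density leaves the tilt centred as well.\<close>
        have "s (A u + y - u) = s y"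
          unfolding s_def by (rule sum.cong) (simp_all add: inner_diff_left inner_add_left Ab)
        then show "ennreal (q (A u + y, u)) = ennreal (gauss_density y) * (ennreal (exp (s y / 2)) * ennreal (1 / D))"
          using D by (simp add: q_def ennreal_mult[symmetric])
      qed
      also have "\<dots> = (\<integral>\<^sup>+y. ennreal (exp (s y / 2)) \<partial>gaussian) * ennreal (1 / D)"
        by (subst nn_integral_gaussian[symmetric]) (simp_all add: nn_integral_multc)
      also have "\<dots> \<le> ennreal D * ennreal (1 / D)"
        using nn_integral_gaussian_exp_projection_le[OF fin orth unit card]
        by (intro mult_right_mono) (simp_all add: s_def D_def)
      finally show ?thesis using D by (simp add: ennreal_mult[symmetric])
    qed
    then have "(\<integral>\<^sup>+x. (\<integral>\<^sup>+y. ennreal (q (y, ?U x)) \<partial>lborel) \<partial>?G) \<le> (\<integral>\<^sup>+x. 1 \<partial>?G)"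
      by (intro nn_integral_mono)
    then show "(\<integral>\<^sup>+x. ennreal (q x) \<partial>(lborel \<Otimes>\<^sub>M distr ?G borel ?U)) \<le> 1"
      by (subst nn_integral_base) (simp_all add: A0.FG.emeasure_space_1)
    show "integrable ?L (\<lambda>x. ln (q x))"
      unfolding channel_def using pull(1) by (subst integrable_distr_eq) (simp_all add: case_prod_unfold)
  qed (simp_all add: q less_imp_le)
  also have "(\<integral>x. ln (q x) \<partial>?L) = - noise_ent TYPE('a) - ln D"
    unfolding channel_def pull(2)[symmetric] by (subst integral_distr) (simp_all add: case_prod_unfold)
  finally show ?thesis by (simp add: D_def ln_realpow)
qed

section \<open>Rates of the RFD channel\<close>

lemma borel_measurable_matrix_vector [measurable (raw)]:
  fixes A :: "complex ^ 't::finite ^ 'r::finite"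
  assumes "f \<in> borel_measurable M"
  shows "(\<lambda>x. A *v f x) \<in> borel_measurable M"
  by (rule borel_measurable_continuous_on[OF linear_continuous_on[OF matrix_vector_mul_bounded_linear] assms])

lemma integrable_matrix_vector_square:
  fixes A :: "complex ^ 't::finite ^ 'r::finite"
  assumes [measurable]: "f \<in> borel_measurable M" and f: "integrable M (\<lambda>x. (norm (f x))\<^sup>2)"
  shows "integrable M (\<lambda>x. (norm (A *v f x))\<^sup>2)"
proof (rule Bochner_Integration.integrable_bound)
  show "integrable M (\<lambda>x. (onorm ((*v) A))\<^sup>2 * (norm (f x))\<^sup>2)" using f by simp
  have "(norm (A *v f x))\<^sup>2 \<le> (onorm ((*v) A) * norm (f x))\<^sup>2" for x
    by (intro power_mono onorm matrix_vector_mul_bounded_linear) simp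
  then show "AE x in M. norm ((norm (A *v f x))\<^sup>2) \<le> norm ((onorm ((*v) A))\<^sup>2 * (norm (f x))\<^sup>2)"
    by (simp add: power_mult_distrib)
qed simp

lemma power_constraint_integrable:
  assumes "power_constraint P F X" and [measurable]: "X \<in> borel_measurable F"
  shows "integrable F (\<lambda>w. (norm (X w))\<^sup>2)"
  using assms(1) unfolding power_constraint_def
  by (intro integrableI_nonneg) (auto intro: le_less_trans)

lemma power_constraint_distr:
  assumes [measurable]: "T \<in> measurable F F'" "X \<in> borel_measurable F'"
  shows "power_constraint P (distr F F' T) X \<longleftrightarrow> power_constraint P F (\<lambda>w. X (T w))"
  unfolding power_constraint_def by (subst nn_integral_distr) simp_all

lemma (in awgn) distr_output:
  fixes p :: "'a \<Rightarrow> 'b::euclidean_space"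
  assumes [measurable]: "p \<in> borel_measurable borel" and "\<And>x y. p (x + y) = p x + p y"
    and "distr gaussian borel p = gaussian"
  shows "distr (F \<Otimes>\<^sub>M gaussian) (borel \<Otimes>\<^sub>M N) (\<lambda>s. (p (g (fst s) + snd s), V (fst s)))
    = channel F N (\<lambda>w. p (g w)) V"
  using channel_image[of p "\<lambda>x. x" N] assms
  by (simp add: channel_def distr_distr comp_def case_prod_unfold)

text \<open>The three noises form a single Gaussian vector, so the whole relay channel is one noisy
  observation with a vector-valued signal.\<close>

lemma rfd_space_eq:
  "(rfd_space F :: ('w, 'r2::finite, 'r3a::finite, 'r3b::finite) rfd_sample measure) = F \<Otimes>\<^sub>M gaussian"
  unfolding rfd_space_def std_complex_gaussian_eq gaussian_prod ..

text \<open>The parameters occurring only on the right are free: they name the common noisy vector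
  of which \<open>Y2\<close> is a coordinate.\<close>

lemma rfd_Y2_eq: "rfd_Y2 G21 X1 s = fst ((G21 *v X1 (fst s), G31 *v X1 (fst s), G32 *v X2 (fst s)) + snd s)"
  by (simp add: rfd_Y2_def case_prod_unfold plus_prod_def)

lemma rfd_Y3_eq: "rfd_Y3 G31 G32 X1 X2 s = snd ((G21 *v X1 (fst s), G31 *v X1 (fst s), G32 *v X2 (fst s)) + snd s)"
  by (simp add: rfd_Y3_def case_prod_unfold plus_prod_def)

text \<open>The source is an arbitrary space with two input maps, so the same formulas serve pairs
  of inputs, inputs with an auxiliary, and sources enlarged by fresh noise.\<close>

locale rfd = prob_space F for F :: "'w measure" +
  fixes G21 :: "complex ^ 't1::finite ^ 'r2::finite"
    and G31 :: "complex ^ 't1 ^ 'r3a::finite"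
    and G32 :: "complex ^ 't2::finite ^ 'r3b::finite"
    and X1 :: "'w \<Rightarrow> complex ^ 't1" and X2 :: "'w \<Rightarrow> complex ^ 't2"
  assumes X1[measurable]: "X1 \<in> borel_measurable F" and X2[measurable]: "X2 \<in> borel_measurable F"
    and X1_square: "integrable F (\<lambda>w. (norm (X1 w))\<^sup>2)"
    and X2_square: "integrable F (\<lambda>w. (norm (X2 w))\<^sup>2)"
begin

abbreviation "g2 \<equiv> \<lambda>w. G21 *v X1 w"
abbreviation "g3a \<equiv> \<lambda>w. G31 *v X1 w"
abbreviation "g3b \<equiv> \<lambda>w. G32 *v X2 w"
abbreviation "g3 \<equiv> \<lambda>w. (G31 *v X1 w, G32 *v X2 w)"
abbreviation "g \<equiv> \<lambda>w. (G21 *v X1 w, G31 *v X1 w, G32 *v X2 w)"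
abbreviation "M \<equiv> (rfd_space F :: ('w, 'r2, 'r3a, 'r3b) rfd_sample measure)"
abbreviation "Y2 \<equiv> (rfd_Y2 G21 X1 :: ('w, 'r2, 'r3a, 'r3b) rfd_sample \<Rightarrow> _)"
abbreviation "Y3 \<equiv> (rfd_Y3 G31 G32 X1 X2 :: ('w, 'r2, 'r3a, 'r3b) rfd_sample \<Rightarrow> _)"

lemma awgn_g2: "V \<in> measurable F N \<Longrightarrow> awgn F N g2 V"
  and awgn_g3a: "V \<in> measurable F N \<Longrightarrow> awgn F N g3a V"
  and awgn_g3b: "V \<in> measurable F N \<Longrightarrow> awgn F N g3b V"
  by (standard; simp add: integrable_matrix_vector_square X1_square X2_square)+

lemma awgn_g: "V \<in> measurable F N \<Longrightarrow> awgn F N g V"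
  by standard (simp_all add: borel_prod[symmetric] norm_Pair integrable_matrix_vector_square X1_square X2_square)

lemma awgn_g3: "V \<in> measurable F N \<Longrightarrow> awgn F N g3 V"
  by standard (simp_all add: borel_prod[symmetric] norm_Pair integrable_matrix_vector_square X1_square X2_square)

lemma prob_space_M: "prob_space M"
proof -
  interpret P: pair_prob_space F "gaussian :: ((complex ^ 'r2) \<times> (complex ^ 'r3a) \<times> (complex ^ 'r3b)) measure" ..
  show ?thesis unfolding rfd_space_eq by (rule P.prob_space_axioms)
qed

lemma law_Y2:
  assumes [measurable]: "V \<in> measurable F N"
  shows "distr M (borel \<Otimes>\<^sub>M N) (\<lambda>s. (Y2 s, V (fst s))) = channel F N g2 V"
  using awgn.distr_output[OF awgn_g[OF assms], of fst]
  unfolding rfd_space_eq rfd_Y2_eq[of G21 X1 _ G31 G32 X2] by (simp add: distr_gaussian_fst)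

lemma law_Y3:
  assumes [measurable]: "V \<in> measurable F N"
  shows "distr M (borel \<Otimes>\<^sub>M N) (\<lambda>s. (Y3 s, V (fst s))) = channel F N g3 V"
  using awgn.distr_output[OF awgn_g[OF assms], of snd]
  unfolding rfd_space_eq rfd_Y3_eq[of G31 G32 X1 X2 _ G21] by (simp add: distr_gaussian_snd)

lemma law_Y23:
  assumes [measurable]: "V \<in> measurable F N"
  shows "distr M (borel \<Otimes>\<^sub>M N) (\<lambda>s. ((Y2 s, Y3 s), V (fst s))) = channel F N g V"
  using awgn.distr_output[OF awgn_g[OF assms], of "\<lambda>x. x"]
  unfolding rfd_space_eq rfd_Y2_eq[of G21 X1 _ G31 G32 X2] rfd_Y3_eq[of G31 G32 X1 X2 _ G21]
  by (simp add: distr_gaussian_id del: fst_add snd_add)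

lemma measurable_fst_M: "V \<in> measurable F N \<Longrightarrow> (\<lambda>s. V (fst s)) \<in> measurable M N"
  unfolding rfd_space_eq by simp

lemma borel_measurable_g [measurable]: "g \<in> borel_measurable F"
  using awgn_g[of "\<lambda>_. ()" "count_space UNIV"] by (simp add: awgn_def awgn_axioms_def)

lemma measurable_Y2: "Y2 \<in> borel_measurable M"
  unfolding rfd_space_eq rfd_Y2_eq[of G21 X1 _ G31 G32 X2, abs_def] by measurable

lemma measurable_Y3: "Y3 \<in> borel_measurable M"
  unfolding rfd_space_eq rfd_Y3_eq[of G31 G32 X1 X2 _ G21, abs_def] by measurable

lemma measurable_Y23: "(\<lambda>s. (Y2 s, Y3 s)) \<in> borel_measurable M"
  using measurable_Pair[OF measurable_Y2 measurable_Y3] by (simp add: borel_prod)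

lemma ent_g3_deterministic:
  assumes "k1 \<in> borel_measurable N" "k2 \<in> borel_measurable N" "V \<in> measurable F N"
    and "\<And>w. X1 w = k1 (V w)" "\<And>w. X2 w = k2 (V w)"
  shows "ent F N g3 V = noise_ent TYPE((complex ^ 'r3a) \<times> (complex ^ 'r3b))"
proof -
  note [measurable] = assms(1-3)
  have "(\<lambda>v. (G31 *v k1 v, G32 *v k2 v)) \<in> borel_measurable N"
    by (simp add: borel_prod[symmetric])
  from ent_deterministic[OF _ this, of F V] show ?thesis
    using awgn_g3[OF assms(3)] by (simp add: assms(4,5))
qed

text \<open>The pair of inputs is a parameter \<open>V\<close> with a pointwise equation because in
  the cutset rate it is simply the identity on the source. Given both inputs, only noise remains in
  \<open>Y3\<close>.\<close>

lemma information_X1_X2_Y3: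
  assumes "\<And>w. V w = (X1 w, X2 w)"
  shows "prob_space.mutual_information M 2 (borel \<Otimes>\<^sub>M borel) (borel \<Otimes>\<^sub>M borel) (\<lambda>s. V (fst s)) Y3
    = (ent0 F g3 - noise_ent TYPE((complex ^ 'r3a) \<times> (complex ^ 'r3b))) / ln 2"
proof -
  have V: "V = (\<lambda>w. (X1 w, X2 w))" using assms by auto
  have Vm: "V \<in> measurable F (borel \<Otimes>\<^sub>M borel)" unfolding V by simp
  have "prob_space.mutual_information M 2 (borel \<Otimes>\<^sub>M borel) borel (\<lambda>s. V (fst s)) Y3
    = (ent0 F g3 - ent F (borel \<Otimes>\<^sub>M borel) g3 V) / ln 2"
    by (rule mutual_information_output_second[OF prob_space_M awgn_g3[OF Vm] measurable_fst_M[OF Vm] measurable_Y3 law_Y3[OF Vm]])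
  moreover have "ent F (borel \<Otimes>\<^sub>M borel) g3 V = noise_ent TYPE((complex ^ 'r3a) \<times> (complex ^ 'r3b))"
    by (rule ent_g3_deterministic[of fst _ snd]) (simp_all add: Vm, simp_all add: V)
  ultimately show ?thesis by (simp add: borel_prod)
qed

text \<open>The unconditional entropy of \<open>Y2\<close> occurs in both mutual informations and
  cancels.\<close>

lemma cmi_Y2:
  assumes [measurable]: "U \<in> measurable F N"
  shows "prob_space.conditional_mutual_information M 2 borel N borel Y2 (\<lambda>s. U (fst s)) (\<lambda>s. X2 (fst s))
    = (ent F borel g2 X2 - ent F (N \<Otimes>\<^sub>M borel) g2 (\<lambda>w. (U w, X2 w))) / ln 2"
proof -
  have V: "(\<lambda>w. (U w, X2 w)) \<in> measurable F (N \<Otimes>\<^sub>M borel)" by simp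
  show ?thesis
    unfolding prob_space.conditional_mutual_information_def[OF prob_space_M]
      mutual_information_output_first[OF prob_space_M awgn_g2[OF V] measurable_fst_M[OF V] measurable_Y2 law_Y2[OF V]]
      mutual_information_output_first[OF prob_space_M awgn_g2[OF X2] measurable_fst_M[OF X2] measurable_Y2 law_Y2[OF X2]]
    by (simp add: diff_divide_distrib)
qed

lemma cmi_Y3:
  assumes [measurable]: "U \<in> measurable F N"
  shows "prob_space.conditional_mutual_information M 2 (borel \<Otimes>\<^sub>M borel) borel (borel \<Otimes>\<^sub>M N) Y3
      (\<lambda>s. X1 (fst s)) (\<lambda>s. (X2 (fst s), U (fst s)))
    = (ent F (borel \<Otimes>\<^sub>M N) g3 (\<lambda>w. (X2 w, U w)) - noise_ent TYPE((complex ^ 'r3a) \<times> (complex ^ 'r3b))) / ln 2"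
proof -
  have V: "(\<lambda>w. (X2 w, U w)) \<in> measurable F (borel \<Otimes>\<^sub>M N)"
    and W: "(\<lambda>w. (X1 w, (X2 w, U w))) \<in> measurable F (borel \<Otimes>\<^sub>M (borel \<Otimes>\<^sub>M N))" by simp_all
  have n: "ent F (borel \<Otimes>\<^sub>M (borel \<Otimes>\<^sub>M N)) g3 (\<lambda>w. (X1 w, (X2 w, U w)))
    = noise_ent TYPE((complex ^ 'r3a) \<times> (complex ^ 'r3b))"
    by (rule ent_g3_deterministic[of fst _ "\<lambda>v. fst (snd v)"]) simp_all
  show ?thesis
    unfolding prob_space.conditional_mutual_information_def[OF prob_space_M] borel_prod
      mutual_information_output_first[OF prob_space_M awgn_g3[OF V] measurable_fst_M[OF V] measurable_Y3 law_Y3[OF V]]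
      mutual_information_output_first[OF prob_space_M awgn_g3[OF W] measurable_fst_M[OF W] measurable_Y3 law_Y3[OF W]]
    by (simp add: n diff_divide_distrib)
qed

lemma cmi_Y23:
  "prob_space.conditional_mutual_information M 2 (borel \<Otimes>\<^sub>M (borel \<Otimes>\<^sub>M borel)) borel borel
      (\<lambda>s. (Y2 s, Y3 s)) (\<lambda>s. X1 (fst s)) (\<lambda>s. X2 (fst s))
    = (ent F borel g X2 - noise_ent TYPE((complex ^ 'r2) \<times> (complex ^ 'r3a) \<times> (complex ^ 'r3b))) / ln 2"
proof -
  let ?V = "\<lambda>w. (X1 w, X2 w)"
  have V: "?V \<in> measurable F (borel \<Otimes>\<^sub>M borel)" by simp
  have k: "(\<lambda>v. (G21 *v fst v, G31 *v fst v, G32 *v snd v)) \<in> borel_measurable (borel \<Otimes>\<^sub>M borel)"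
    by (simp add: borel_prod[symmetric])
  have n: "ent F (borel \<Otimes>\<^sub>M borel) g ?V = noise_ent TYPE((complex ^ 'r2) \<times> (complex ^ 'r3a) \<times> (complex ^ 'r3b))"
    using ent_deterministic[OF _ k, of F ?V] awgn_g[OF V] by simp
  have b: "borel \<Otimes>\<^sub>M (borel \<Otimes>\<^sub>M borel) = (borel :: ((complex ^ 'r2) \<times> (complex ^ 'r3a) \<times> (complex ^ 'r3b)) measure)"
    by (simp add: borel_prod)
  show ?thesis
    unfolding prob_space.conditional_mutual_information_def[OF prob_space_M] b
      mutual_information_output_first[OF prob_space_M awgn_g[OF V] measurable_fst_M[OF V] measurable_Y23 law_Y23[OF V]]
      mutual_information_output_first[OF prob_space_M awgn_g[OF X2] measurable_fst_M[OF X2] measurable_Y23 law_Y23[OF X2]]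
    by (simp add: n diff_divide_distrib)
qed

end

lemma rfd_cutset_inputs:
  assumes "F \<in> cutset_inputs P"
  shows "rfd F fst snd"
proof -
  have F: "prob_space F" "sets F = sets (borel \<Otimes>\<^sub>M borel)" "power_constraint P F fst" "power_constraint P F snd"
    using assms by (auto simp: cutset_inputs_def)
  note [measurable_cong] = F(2)
  interpret prob_space F by fact
  show ?thesis
    by standard (simp_all add: power_constraint_integrable[OF F(3)] power_constraint_integrable[OF F(4)])
qed

lemma cutset_rate_eq:
  fixes G21 :: "complex ^ 't1::finite ^ 'r2::finite"
    and G31 :: "complex ^ 't1 ^ 'r3a::finite"
    and G32 :: "complex ^ 't2::finite ^ 'r3b::finite"
  assumes "F \<in> cutset_inputs P"
  shows "cutset_rate G21 G31 G32 F = min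
    ((ent0 F (\<lambda>w. (G31 *v fst w, G32 *v snd w)) - noise_ent TYPE((complex ^ 'r3a) \<times> (complex ^ 'r3b))) / ln 2)
    ((ent F borel (\<lambda>w. (G21 *v fst w, G31 *v fst w, G32 *v snd w)) snd
      - noise_ent TYPE((complex ^ 'r2) \<times> (complex ^ 'r3a) \<times> (complex ^ 'r3b))) / ln 2)"
proof -
  interpret rfd F G21 G31 G32 fst snd by (rule rfd_cutset_inputs[OF assms])
  show ?thesis
    unfolding cutset_rate_def Let_def cmi_Y23
    using information_X1_X2_Y3[of "\<lambda>w. w"] by simp
qed

lemma rfd_pdf_inputs:
  assumes "F \<in> pdf_inputs P m"
  shows "rfd F (\<lambda>w. snd (fst w)) snd" "(\<lambda>w. fst (fst w)) \<in> measurable F (aux_space m)"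
proof -
  have F: "prob_space F" "sets F = sets ((aux_space m \<Otimes>\<^sub>M borel) \<Otimes>\<^sub>M borel)"
    "power_constraint P F (\<lambda>w. snd (fst w))" "power_constraint P F snd"
    using assms by (auto simp: pdf_inputs_def)
  note [measurable_cong] = F(2)
  interpret prob_space F by fact
  show "rfd F (\<lambda>w. snd (fst w)) snd"
    by standard (simp_all add: power_constraint_integrable[OF F(3)] power_constraint_integrable[OF F(4)])
  show "(\<lambda>w. fst (fst w)) \<in> measurable F (aux_space m)" by simp
qed

lemma pdf_rate_eq:
  fixes G21 :: "complex ^ 't1::finite ^ 'r2::finite"
    and G31 :: "complex ^ 't1 ^ 'r3a::finite"
    and G32 :: "complex ^ 't2::finite ^ 'r3b::finite"
    and F :: "('t1, 't2) pdf_input measure"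
  defines "n3 \<equiv> noise_ent TYPE((complex ^ 'r3a) \<times> (complex ^ 'r3b))"
    and "g2 \<equiv> \<lambda>w. G21 *v snd (fst w)"
    and "g3 \<equiv> \<lambda>w. (G31 *v snd (fst w), G32 *v snd w)"
  assumes "F \<in> pdf_inputs P m"
  shows "pdf_rate G21 G31 G32 m F = min
    ((ent0 F g3 - n3) / ln 2)
    ((ent F borel g2 snd - ent F (aux_space m \<Otimes>\<^sub>M borel) g2 (\<lambda>w. (fst (fst w), snd w))
      + ent F (borel \<Otimes>\<^sub>M aux_space m) g3 (\<lambda>w. (snd w, fst (fst w))) - n3) / ln 2)"
proof -
  interpret rfd F G21 G31 G32 "\<lambda>w. snd (fst w)" snd by (rule rfd_pdf_inputs[OF assms(4)])
  note U = rfd_pdf_inputs(2)[OF assms(4)]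
  show ?thesis
    unfolding pdf_rate_def Let_def cmi_Y2[OF U] cmi_Y3[OF U] n3_def g2_def g3_def
    using information_X1_X2_Y3[of "\<lambda>w. (snd (fst w), snd w)"]
    by (simp add: add_divide_distrib diff_divide_distrib)
qed

text \<open>Auxiliaries must be functions on an initial segment of the naturals, so an auxiliary
  enlarged by a vector is stored in the next \<open>CARD('n)\<close> coordinates. A measurable left
  inverse is enough: it makes each observation a function of the other.\<close>

lemma aux_space_encoding:
  "\<exists>(e :: (nat \<Rightarrow> complex) \<times> (complex ^ 'n::finite) \<Rightarrow> nat \<Rightarrow> complex) d.
    e \<in> measurable (aux_space m \<Otimes>\<^sub>M borel) (aux_space (m + CARD('n))) \<and>
    d \<in> measurable (aux_space (m + CARD('n))) (aux_space m \<Otimes>\<^sub>M borel) \<and>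
    (\<forall>x\<in>space (aux_space m \<Otimes>\<^sub>M borel). d (e x) = x)"
proof -
  obtain h :: "nat \<Rightarrow> 'n" where "bij_betw h {0..<CARD('n)} UNIV"
    using ex_bij_betw_nat_finite[of "UNIV :: 'n set"] by auto
  then have surj: "j \<in> h ` {0..<CARD('n)}" for j by (auto simp: bij_betw_def)
  define k where "k = inv_into {0..<CARD('n)} h"
  have k: "h (k j) = j" "k j < CARD('n)" for j
    using f_inv_into_f[OF surj] inv_into_into[OF surj] by (auto simp: k_def)
  define e :: "(nat \<Rightarrow> complex) \<times> (complex ^ 'n) \<Rightarrow> nat \<Rightarrow> complex" where
    "e x = (\<lambda>i\<in>{..<m + CARD('n)}. if i < m then fst x i else snd x $ h (i - m))" for x
  \<comment> \<open>The vector is rebuilt as a sum of coordinate vectors, which reduces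
    measurability to that of each \<open>axis j\<close>.\<close>
  define d :: "(nat \<Rightarrow> complex) \<Rightarrow> (nat \<Rightarrow> complex) \<times> (complex ^ 'n)" where
    "d f = ((\<lambda>i\<in>{..<m}. f i), (\<Sum>j\<in>UNIV. axis j (f (m + k j))))" for f
  have nth: "(\<lambda>x :: complex ^ 'n. x $ j) \<in> borel_measurable borel" for j
    by (intro borel_measurable_continuous_onI continuous_intros)
  have ax: "(axis j :: complex \<Rightarrow> complex ^ 'n) \<in> borel_measurable borel" for j
  proof (intro borel_measurable_continuous_onI linear_continuous_on)
    have "linear (axis j :: complex \<Rightarrow> complex ^ 'n)"
      by (intro linearI) (simp_all add: axis_def vec_eq_iff)
    then show "bounded_linear (axis j :: complex \<Rightarrow> complex ^ 'n)" by (rule linear_conv_bounded_linear[THEN iffD1])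
  qed
  show ?thesis
  proof (intro exI conjI ballI)
    show "e \<in> measurable (aux_space m \<Otimes>\<^sub>M borel) (aux_space (m + CARD('n)))"
      unfolding e_def
    proof (rule measurable_restrict)
      fix i
      show "(\<lambda>x. if i < m then fst x i else snd x $ h (i - m)) \<in> borel_measurable (aux_space m \<Otimes>\<^sub>M borel)"
      proof (cases "i < m")
        case True
        then have "(\<lambda>f. f i) \<in> borel_measurable (aux_space m)"
          by (intro measurable_component_singleton) simp
        from measurable_compose[OF measurable_fst this] True show ?thesis by simp
      next
        case False
        with measurable_compose[OF measurable_snd nth] show ?thesis by simp
      qed
    qed
    show "d \<in> measurable (aux_space (m + CARD('n))) (aux_space m \<Otimes>\<^sub>M borel)"
      unfolding d_def
    proof (intro measurable_Pair measurable_restrict borel_measurable_sum measurable_compose[OF _ ax])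
      show "(\<lambda>f. f i) \<in> borel_measurable (aux_space (m + CARD('n)))" if "i \<in> {..<m}" for i
        using that by (intro measurable_component_singleton) simp
      show "(\<lambda>f. f (m + k j)) \<in> borel_measurable (aux_space (m + CARD('n)))" for j
        using k(2)[of j] by (intro measurable_component_singleton) simp
    qed
    fix x :: "(nat \<Rightarrow> complex) \<times> (complex ^ 'n)"
    assume "x \<in> space (aux_space m \<Otimes>\<^sub>M borel)"
    \<comment> \<open>Points of \<open>aux_space m\<close> take the default value outside
      \<open>{..<m}\<close>, so restricting the code recovers the whole function.\<close>
    then have "fst x \<in> extensional {..<m}"
      by (auto simp: space_pair_measure space_PiM PiE_def)
    then have "(\<lambda>i\<in>{..<m}. e x i) = fst x"
      by (auto simp: e_def extensional_def fun_eq_iff)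
    moreover have "(\<Sum>j\<in>UNIV. axis j (e x (m + k j))) = snd x"
      using k by (simp add: e_def vec_eq_iff axis_def)
    ultimately show "d (e x) = x" by (simp add: d_def)
  qed
qed

lemma ent_cong_observation:
  fixes g :: "'w \<Rightarrow> 'a::euclidean_space"
  assumes "\<And>w. w \<in> space F \<Longrightarrow> V w = W w"
  shows "ent F N g V = ent F N g W"
proof -
  have "distr F N V = distr F N W" by (rule distr_cong) (simp_all add: assms)
  moreover have "channel F N g V = channel F N g W"
    unfolding channel_def by (rule distr_cong) (auto simp: assms space_pair_measure)
  ultimately show ?thesis by (simp add: ent_def is_density_def)
qed

text \<open>Each of the two observations is a function of the other, so conditioning on one or the
  other gives both inequalities.\<close>

lemma (in awgn) ent_injection:
  assumes e: "e \<in> measurable N N'" and d: "d \<in> measurable N' N"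
    and de: "\<And>x. x \<in> space N \<Longrightarrow> d (e x) = x"
  shows "ent F N' g (\<lambda>w. e (V w)) = ent F N g V"
proof (rule antisym)
  have "(\<lambda>w. e (V w)) \<in> measurable F N'" using e by simp
  from awgn.ent_le_comp[OF awgn_observation[OF this] d]
  have "ent F N' g (\<lambda>w. e (V w)) \<le> ent F N g (\<lambda>w. d (e (V w)))" .
  also have "\<dots> = ent F N g V"
    by (rule ent_cong_observation) (auto intro!: de dest: measurable_space[OF V])
  finally show "ent F N' g (\<lambda>w. e (V w)) \<le> ent F N g V" .
  show "ent F N g V \<le> ent F N' g (\<lambda>w. e (V w))" by (rule ent_le_comp[OF e])
qed

text \<open>A dummy second output that is pure noise reduces this to \<open>ent_product\<close>.\<close>

lemma ent_product_independent_ge: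
  fixes g1 :: "'w1 \<Rightarrow> 'a::euclidean_space"
  assumes A: "awgn0 F1 g1" and F2: "prob_space F2" and V2: "V2 \<in> measurable F2 N"
  shows "ent0 F1 g1 \<le> ent (F1 \<Otimes>\<^sub>M F2) N (\<lambda>w. g1 (fst w)) (\<lambda>w. V2 (snd w))"
proof -
  let ?U = "count_space (UNIV :: unit set)" and ?F = "F1 \<Otimes>\<^sub>M F2"
  let ?V = "\<lambda>w. ((), V2 (snd w))" and ?g = "\<lambda>w. (g1 (fst w), 0 :: real)"
  note [measurable] = V2
  interpret F2: prob_space F2 by fact
  interpret A: awgn F1 ?U g1 "\<lambda>_. ()" by fact
  have B: "awgn F2 N (\<lambda>_. 0 :: real) V2" by standard simp_all
  have P: "awgn ?F (?U \<Otimes>\<^sub>M N) ?g ?V" by (rule awgn_product[OF A B])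
  interpret P1: awgn ?F "?U \<Otimes>\<^sub>M N" "\<lambda>w. g1 (fst w)" ?V
    by (rule A.awgn_fst[OF F2]) simp
  have n: "ent F2 N (\<lambda>_. 0 :: real) V2 = noise_ent TYPE(real)"
    using ent_deterministic[of F2 N "\<lambda>_. 0 :: real" V2] B by simp
  have V: "?V \<in> measurable ?F (?U \<Otimes>\<^sub>M N)" by simp
  have "awgn ?F (?U \<Otimes>\<^sub>M N) (\<lambda>_. 0 :: real) ?V"
    using awgn.awgn_comp[OF P _ _ norm_fst_snd_le(2), of "\<lambda>x. x" "?U \<Otimes>\<^sub>M N"] by simp
  then have n': "ent ?F (?U \<Otimes>\<^sub>M N) (\<lambda>_. 0 :: real) ?V = noise_ent TYPE(real)"
    using ent_deterministic[of ?F "?U \<Otimes>\<^sub>M N" "\<lambda>_. 0 :: real" ?V] by simp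
  \<comment> \<open>The entropy of the dummy is added by independence, removed by subadditivity, and
    cancels.\<close>
  have "ent0 F1 g1 + noise_ent TYPE(real) = ent ?F (?U \<Otimes>\<^sub>M N) ?g ?V"
    using ent_product[OF A B] by (simp add: n)
  also have "\<dots> \<le> ent ?F (?U \<Otimes>\<^sub>M N) (\<lambda>w. g1 (fst w)) ?V + noise_ent TYPE(real)"
    using ent_pair_le[OF P] by (simp add: n')
  also have "ent ?F (?U \<Otimes>\<^sub>M N) (\<lambda>w. g1 (fst w)) ?V \<le> ent ?F N (\<lambda>w. g1 (fst w)) (\<lambda>w. V2 (snd w))"
    using P1.ent_le_comp[of snd N] by simp
  finally show ?thesis by simp
qed

section \<open>Rates achieved by independent inputs\<close>

lemma npdf_inputs_pair:
  assumes F1: "prob_space F1" "sets F1 = sets (aux_space m \<Otimes>\<^sub>M borel)" "power_constraint P F1 snd"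
    and F2: "prob_space F2" "sets F2 = sets borel" "power_constraint P F2 (\<lambda>x. x)"
  shows "F1 \<Otimes>\<^sub>M F2 \<in> npdf_inputs P m"
proof -
  interpret A: prob_space F1 by fact
  interpret B: prob_space F2 by fact
  interpret AB: pair_prob_space F1 F2 ..
  note [measurable_cong] = F1(2) F2(2)
  have "power_constraint P (distr (F1 \<Otimes>\<^sub>M F2) F1 fst) snd"
    using F1(3) by (simp add: B.distr_pair_fst)
  then have 1: "power_constraint P (F1 \<Otimes>\<^sub>M F2) (\<lambda>w. snd (fst w))"
    by (subst (asm) power_constraint_distr) simp_all
  have "power_constraint P (distr (F1 \<Otimes>\<^sub>M F2) F2 snd) (\<lambda>x. x)"
    using F2(3) by (simp add: distr_pair_snd[OF A.prob_space_axioms B.sigma_finite_measure_axioms])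
  then have 2: "power_constraint P (F1 \<Otimes>\<^sub>M F2) snd"
    by (subst (asm) power_constraint_distr) simp_all
  have "sets (F1 \<Otimes>\<^sub>M F2) = sets ((aux_space m \<Otimes>\<^sub>M borel) \<Otimes>\<^sub>M borel)"
    using F1(2) F2(2) by (rule sets_pair_measure_cong)
  then show ?thesis
    unfolding npdf_inputs_def pdf_inputs_def using 1 2 assms AB.prob_space_axioms by blast
qed

text \<open>For independent \<open>X2\<close> everything reduces to the two marginals:
  \<open>X2\<close> as side information does not lower the entropy of \<open>Y2\<close>, and
  \<open>Y3''\<close> adds its full entropy to the first term but only noise entropy to the second,
  where \<open>X2\<close> is given. Lower bounds suffice for achievability.\<close>

lemma pdf_rate_pair_ge:
  fixes G21 :: "complex ^ 't1::finite ^ 'r2::finite"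
    and G31 :: "complex ^ 't1 ^ 'r3a::finite"
    and G32 :: "complex ^ 't2::finite ^ 'r3b::finite"
    and F1 :: "((nat \<Rightarrow> complex) \<times> (complex ^ 't1)) measure" and F2 :: "(complex ^ 't2) measure"
  assumes F1: "prob_space F1" "sets F1 = sets (aux_space m \<Otimes>\<^sub>M borel)" "power_constraint P F1 snd"
    and F2: "prob_space F2" "sets F2 = sets borel" "power_constraint P F2 (\<lambda>x. x)"
  shows "min
    ((ent0 F1 (\<lambda>w. G31 *v snd w) + ent0 F2 (\<lambda>x. G32 *v x)
      - noise_ent TYPE((complex ^ 'r3a) \<times> (complex ^ 'r3b))) / ln 2)
    ((ent0 F1 (\<lambda>w. G21 *v snd w) - ent F1 (aux_space m) (\<lambda>w. G21 *v snd w) fst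
      + ent F1 (aux_space m) (\<lambda>w. G31 *v snd w) fst - noise_ent TYPE(complex ^ 'r3a)) / ln 2)
    \<le> pdf_rate G21 G31 G32 m (F1 \<Otimes>\<^sub>M F2)"
proof -
  let ?F = "F1 \<Otimes>\<^sub>M F2" and ?U = "count_space (UNIV :: unit set)"
  let ?g2 = "\<lambda>w. G21 *v snd (fst w)" and ?g3 = "\<lambda>w. (G31 *v snd (fst w), G32 *v snd w)"
  have F: "?F \<in> pdf_inputs P m"
    using npdf_inputs_pair[OF assms] by (simp add: npdf_inputs_def)
  interpret A: prob_space F1 by fact
  interpret B: prob_space F2 by fact
  note [measurable_cong] = F1(2) F2(2)
  have i1: "integrable F1 (\<lambda>w. (norm (snd w))\<^sup>2)" by (rule power_constraint_integrable[OF F1(3)]) simp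
  have i2: "integrable F2 (\<lambda>w. (norm w)\<^sup>2)" by (rule power_constraint_integrable[OF F2(3)]) simp
  have a2: "awgn F1 N (\<lambda>w. G21 *v snd w) V" if "V \<in> measurable F1 N" for N :: "'v measure" and V
    by standard (simp_all add: that integrable_matrix_vector_square i1)
  have a3: "awgn F1 N (\<lambda>w. G31 *v snd w) V" if "V \<in> measurable F1 N" for N :: "'v measure" and V
    by standard (simp_all add: that integrable_matrix_vector_square i1)
  have b: "awgn F2 N (\<lambda>x. G32 *v x) V" if "V \<in> measurable F2 N" for N :: "'v measure" and V
    by standard (simp_all add: that integrable_matrix_vector_square i2)
  interpret R: rfd ?F G21 G31 G32 "\<lambda>w. snd (fst w)" snd by (rule rfd_pdf_inputs(1)[OF F])
  have t1: "ent0 F1 (\<lambda>w. G31 *v snd w) + ent0 F2 (\<lambda>x. G32 *v x) \<le> ent0 ?F ?g3"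
  proof -
    have "ent0 F1 (\<lambda>w. G31 *v snd w) + ent0 F2 (\<lambda>x. G32 *v x) = ent ?F (?U \<Otimes>\<^sub>M ?U) ?g3 (\<lambda>_. ((), ()))"
      by (rule ent_product[OF a3 b, symmetric]) simp_all
    also have "\<dots> \<le> ent0 ?F ?g3" by (rule awgn.ent_le_ent0[OF R.awgn_g3]) simp
    finally show ?thesis .
  qed
  have t2: "ent0 F1 (\<lambda>w. G21 *v snd w) \<le> ent ?F borel ?g2 snd"
    using ent_product_independent_ge[OF a2 F2(1), of "\<lambda>x. x" borel] by simp
  have t3: "ent ?F (aux_space m \<Otimes>\<^sub>M borel) ?g2 (\<lambda>w. (fst (fst w), snd w)) \<le> ent F1 (aux_space m) (\<lambda>w. G21 *v snd w) fst"
  proof -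
    have "ent ?F (aux_space m \<Otimes>\<^sub>M borel) ?g2 (\<lambda>w. (fst (fst w), snd w)) \<le> ent ?F (aux_space m) ?g2 (\<lambda>w. fst (fst w))"
      using awgn.ent_le_comp[OF R.awgn_g2, of "\<lambda>w. (fst (fst w), snd w)" "aux_space m \<Otimes>\<^sub>M borel" fst "aux_space m"] by simp
    also have "\<dots> = ent (distr ?F F1 fst) (aux_space m) (\<lambda>w. G21 *v snd w) fst"
      by (rule ent_distr[symmetric]) simp_all
    finally show ?thesis by (simp add: B.distr_pair_fst)
  qed
  have t4: "ent F1 (aux_space m) (\<lambda>w. G31 *v snd w) fst + noise_ent TYPE(complex ^ 'r3b)
    \<le> ent ?F (borel \<Otimes>\<^sub>M aux_space m) ?g3 (\<lambda>w. (snd w, fst (fst w)))"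
  proof -
    have aI: "awgn F1 (aux_space m) (\<lambda>w. G31 *v snd w) fst" by (rule a3) simp
    have bI: "awgn F2 borel (\<lambda>x. G32 *v x) (\<lambda>x. x)" by (rule b) simp
    have "ent F2 borel (\<lambda>x. G32 *v x) (\<lambda>x. x) = noise_ent TYPE(complex ^ 'r3b)"
      using ent_deterministic[of F2 borel "\<lambda>x. G32 *v x" "\<lambda>x. x"] bI by simp
    then have "ent F1 (aux_space m) (\<lambda>w. G31 *v snd w) fst + noise_ent TYPE(complex ^ 'r3b)
      = ent ?F (aux_space m \<Otimes>\<^sub>M borel) ?g3 (\<lambda>w. (fst (fst w), snd w))"
      using ent_product[OF aI bI] by simp
    also have "\<dots> \<le> ent ?F (borel \<Otimes>\<^sub>M aux_space m) ?g3 (\<lambda>w. (snd w, fst (fst w)))"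
      using awgn.ent_le_comp[OF R.awgn_g3, of "\<lambda>w. (fst (fst w), snd w)" "aux_space m \<Otimes>\<^sub>M borel"
        "\<lambda>x. (snd x, fst x)" "borel \<Otimes>\<^sub>M aux_space m"] by simp
    finally show ?thesis .
  qed
  show ?thesis
    unfolding pdf_rate_eq[OF F] using t1 t2 t3 t4
    by (intro min.mono divide_right_mono) (simp_all add: noise_ent_prod)
qed

text \<open>The bound on the left involves only the joint law of \<open>W\<close> and
  \<open>X1\<close> and, separately, the law of \<open>X2\<close>. A coherent construction on any
  probability space can therefore be replaced by the product of these laws, with \<open>W\<close>
  encoded as an auxiliary.\<close>

lemma npdf_achieves:
  fixes G21 :: "complex ^ 't1::finite ^ 'r2::finite"
    and G31 :: "complex ^ 't1 ^ 'r3a::finite"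
    and G32 :: "complex ^ 't2::finite ^ 'r3b::finite"
  assumes H: "prob_space H" and X1[measurable]: "X1 \<in> borel_measurable H" and X2[measurable]: "X2 \<in> borel_measurable H"
    and P1: "power_constraint P H X1" and P2: "power_constraint P H X2"
    and W[measurable]: "W \<in> measurable H N" and e[measurable]: "e \<in> measurable N (aux_space m)"
    and d: "d \<in> measurable (aux_space m) N" and de: "\<And>x. x \<in> space N \<Longrightarrow> d (e x) = x"
  obtains F where "F \<in> npdf_inputs P m"
    and "min
    ((ent0 H (\<lambda>w. G31 *v X1 w) + ent0 H (\<lambda>w. G32 *v X2 w)
      - noise_ent TYPE((complex ^ 'r3a) \<times> (complex ^ 'r3b))) / ln 2)
    ((ent0 H (\<lambda>w. G21 *v X1 w) - ent H N (\<lambda>w. G21 *v X1 w) W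
      + ent H N (\<lambda>w. G31 *v X1 w) W - noise_ent TYPE(complex ^ 'r3a)) / ln 2)
    \<le> pdf_rate G21 G31 G32 m F"
proof -
  interpret prob_space H by fact
  interpret R: rfd H G21 G31 G32 X1 X2
    by standard (simp_all add: power_constraint_integrable[OF P1] power_constraint_integrable[OF P2])
  \<comment> \<open>Here the dependence between \<open>X2\<close> and the pair of \<open>W\<close>
    and \<open>X1\<close> is discarded, while the law of each of the two parts is kept.\<close>
  define F1 where "F1 = distr H (aux_space m \<Otimes>\<^sub>M borel) (\<lambda>h. (e (W h), X1 h))"
  define F2 where "F2 = distr H borel X2"
  have F1: "prob_space F1" "sets F1 = sets (aux_space m \<Otimes>\<^sub>M borel)" "power_constraint P F1 snd"
    unfolding F1_def by (auto intro: prob_space_distr simp: power_constraint_distr P1)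
  have F2: "prob_space F2" "sets F2 = sets borel" "power_constraint P F2 (\<lambda>x. x)"
    unfolding F2_def by (auto intro: prob_space_distr simp: power_constraint_distr P2)
  have [simp]: "ent0 F1 (\<lambda>w. G31 *v snd w) = ent0 H (\<lambda>w. G31 *v X1 w)"
    "ent0 F1 (\<lambda>w. G21 *v snd w) = ent0 H (\<lambda>w. G21 *v X1 w)"
    "ent0 F2 (\<lambda>x. G32 *v x) = ent0 H (\<lambda>w. G32 *v X2 w)"
    "ent F1 (aux_space m) (\<lambda>w. G21 *v snd w) fst = ent H N (\<lambda>w. G21 *v X1 w) W"
    "ent F1 (aux_space m) (\<lambda>w. G31 *v snd w) fst = ent H N (\<lambda>w. G31 *v X1 w) W"
    unfolding F1_def F2_def
    by (simp_all add: ent_distr awgn.ent_injection[OF R.awgn_g2[OF W] e d] awgn.ent_injection[OF R.awgn_g3a[OF W] e d] de)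
  show thesis
    using pdf_rate_pair_ge[OF F1 F2, of G31 G32 G21] by (intro that[OF npdf_inputs_pair[OF F1 F2]]) simp
qed

section \<open>Comparison of the bounds\<close>

text \<open>Once \<open>V\<close> determines \<open>X2\<close>, the component \<open>Y3''\<close>
  carries only noise; subadditivity splits it off.\<close>

lemma (in rfd) ent_g3_given_le:
  assumes V: "V \<in> measurable F N" and k: "k \<in> borel_measurable N" "\<And>w. X2 w = k (V w)"
  shows "ent F N g3 V \<le> ent F N g3a V + noise_ent TYPE(complex ^ 'r3b)"
proof -
  have "(\<lambda>v. G32 *v k v) \<in> borel_measurable N" using k(1) by simp
  from ent_deterministic[OF _ this, of F V]
  have "ent F N g3b V = noise_ent TYPE(complex ^ 'r3b)"
    using awgn_g3b[OF V] by (simp add: k(2))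
  then show ?thesis using ent_pair_le[OF awgn_g3[OF V]] by simp
qed

lemma (in rfd) ent0_g3_le: "ent0 F g3 \<le> ent0 F g3a + ent0 F g3b"
  using ent_pair_le[OF awgn_g3, of "\<lambda>_. ()" "count_space UNIV"] by simp

lemma npdf_rate_le_R_NPDF:
  assumes "F \<in> npdf_inputs P m"
  shows "ereal (pdf_rate G21 G31 G32 m F) \<le> R_NPDF G21 G31 G32 P"
proof -
  have "ereal (pdf_rate G21 G31 G32 m F) \<le> (SUP F \<in> npdf_inputs P m. ereal (pdf_rate G21 G31 G32 m F))"
    by (rule SUP_upper[OF assms])
  also have "\<dots> \<le> R_NPDF G21 G31 G32 P"
    unfolding R_NPDF_def by (rule SUP_upper) simp
  finally show ?thesis .
qed

text \<open>With (U, X2) as the new auxiliary, h(Y2 | U, X2) stays as it is and h(Y3' | U, X2) still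
  accounts for the informative part of \<open>Y3\<close>. Decoupling \<open>X2\<close> raises h(Y2 |
  X2) to h(Y2) and h(Y3) to h(Y3') + h(Y3''). The supremum over \<open>m\<close> absorbs the longer
  auxiliary.\<close>

lemma pdf_rate_le_R_NPDF:
  fixes G21 :: "complex ^ 't1::finite ^ 'r2::finite"
    and G31 :: "complex ^ 't1 ^ 'r3a::finite"
    and G32 :: "complex ^ 't2::finite ^ 'r3b::finite"
    and F :: "('t1, 't2) pdf_input measure"
  assumes F: "F \<in> pdf_inputs P m"
  shows "ereal (pdf_rate G21 G31 G32 m F) \<le> R_NPDF G21 G31 G32 P"
proof -
  interpret rfd F G21 G31 G32 "\<lambda>w. snd (fst w)" snd by (rule rfd_pdf_inputs(1)[OF F])
  note U[measurable] = rfd_pdf_inputs(2)[OF F]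
  let ?N = "aux_space m \<Otimes>\<^sub>M (borel :: (complex ^ 't2) measure)"
    and ?W = "\<lambda>w. (fst (fst w), snd w)" and ?W' = "\<lambda>w. (snd w, fst (fst w))"
  have W: "?W \<in> measurable F ?N" and W': "?W' \<in> measurable F (borel \<Otimes>\<^sub>M aux_space m)" by simp_all
  obtain e :: "(nat \<Rightarrow> complex) \<times> (complex ^ 't2) \<Rightarrow> nat \<Rightarrow> complex" and d
    where e: "e \<in> measurable ?N (aux_space (m + CARD('t2)))" "d \<in> measurable (aux_space (m + CARD('t2))) ?N"
      "\<And>x. x \<in> space ?N \<Longrightarrow> d (e x) = x"
    using aux_space_encoding[where 'n='t2 and m=m] by blast
  have P: "power_constraint P F (\<lambda>w. snd (fst w))" "power_constraint P F snd"
    using F by (simp_all add: pdf_inputs_def)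
  obtain F' where F': "F' \<in> npdf_inputs P (m + CARD('t2))" and rate: "min
    ((ent0 F g3a + ent0 F g3b - noise_ent TYPE((complex ^ 'r3a) \<times> (complex ^ 'r3b))) / ln 2)
    ((ent0 F g2 - ent F ?N g2 ?W + ent F ?N g3a ?W - noise_ent TYPE(complex ^ 'r3a)) / ln 2)
    \<le> pdf_rate G21 G31 G32 (m + CARD('t2)) F'"
    by (rule npdf_achieves[OF prob_space_axioms X1 X2 P W e(1,2), of G31 G32 G21]) (use e(3) in auto)
  have 1: "ent F borel g2 snd \<le> ent0 F g2" by (rule awgn.ent_le_ent0[OF awgn_g2[OF X2]])
  \<comment> \<open>The two conditional terms of the rate list \<open>U\<close> and
    \<open>X2\<close> in opposite orders; a swap of coordinates aligns them.\<close>
  have "ent F (borel \<Otimes>\<^sub>M aux_space m) g3a ?W' \<le> ent F ?N g3a ?W"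
    using awgn.ent_le_comp[OF awgn_g3a[OF W'], of "\<lambda>x. (snd x, fst x)" ?N] by simp
  then have 2: "ent F (borel \<Otimes>\<^sub>M aux_space m) g3 ?W' \<le> ent F ?N g3a ?W + noise_ent TYPE(complex ^ 'r3b)"
    using ent_g3_given_le[OF W', of fst] by simp
  have "pdf_rate G21 G31 G32 m F \<le> pdf_rate G21 G31 G32 (m + CARD('t2)) F'"
    unfolding pdf_rate_eq[OF F] using 1 2 ent0_g3_le
    by (intro order_trans[OF _ rate] min.mono divide_right_mono) (simp_all add: noise_ent_prod)
  also have "ereal \<dots> \<le> R_NPDF G21 G31 G32 P"
    by (rule npdf_rate_le_R_NPDF[OF F'])
  finally show ?thesis by simp
qed

text \<open>The range is treated as a real subspace, so \<open>DIM\<close> counts twice the complex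
  dimension. Its dimension is bounded by that of the domain and that of the codomain; these two
  bounds are the source of the minimum of t1 and r2.\<close>

lemma orthonormal_range_basis:
  fixes A :: "complex ^ 't::finite ^ 'r::finite"
  shows "\<exists>B. finite B \<and> pairwise orthogonal B \<and> (\<forall>b\<in>B. norm b = 1) \<and>
    card B \<le> DIM(complex ^ 't) \<and> card B \<le> DIM(complex ^ 'r) \<and>
    (\<forall>x. (\<Sum>b\<in>B. ((A *v x) \<bullet> b) *\<^sub>R b) = A *v x)"
proof -
  have lin: "linear ((*v) A)"
    using matrix_vector_mul_bounded_linear[of A] by (rule bounded_linear.linear)
  have sub: "subspace (range ((*v) A))" using lin by (simp add: linear_subspace_image)
  show ?thesis
  proof (rule orthonormal_basis_subspace[OF sub])
    fix B assume B: "pairwise orthogonal B" "\<And>b. b \<in> B \<Longrightarrow> norm b = 1"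
      "independent B" "card B = dim (range ((*v) A))" "span B = range ((*v) A)"
    have fin: "finite B" using B(3) by (rule independent_imp_finite)
    have "card B \<le> DIM(complex ^ 't)"
      unfolding B(4) using dim_image_le[OF lin, of UNIV] by (simp only: dim_UNIV)
    moreover have "card B \<le> DIM(complex ^ 'r)" unfolding B(4) by (rule dim_subset_UNIV)
    moreover have "(\<Sum>b\<in>B. ((A *v x) \<bullet> b) *\<^sub>R b) = A *v x" for x
      by (rule orthonormal_basis_expand[OF B(1,2) _ fin]) (simp_all add: B(5))
    ultimately show ?thesis using B(1,2) fin by blast
  qed
qed

text \<open>Up to noise entropies, the second cutset term is at most h(Y2) + h(Y3' | U), and the
  second achieved term is h(Y2) - h(Y2 | U) + h(Y3' | U). The gap is thus h(Y2 | U) minus the noise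
  entropy, while the first terms compare without loss.\<close>

lemma cutset_rate_le_R_NPDF:
  fixes G21 :: "complex ^ 't1::finite ^ 'r2::finite"
    and G31 :: "complex ^ 't1 ^ 'r3a::finite"
    and G32 :: "complex ^ 't2::finite ^ 'r3b::finite"
  assumes F: "F \<in> cutset_inputs P"
  shows "ereal (cutset_rate G21 G31 G32 F) \<le> R_NPDF G21 G31 G32 P + ereal (real (min CARD('t1) CARD('r2)))"
proof -
  interpret rfd F G21 G31 G32 fst snd by (rule rfd_cutset_inputs[OF F])
  let ?H = "F \<Otimes>\<^sub>M (gaussian :: (complex ^ 'r2) measure)"
  let ?U = "\<lambda>x. G21 *v fst (fst x) + snd x" and ?N = "aux_space 0 \<Otimes>\<^sub>M (borel :: (complex ^ 'r2) measure)"
  \<comment> \<open>No auxiliary is given here, so \<open>U\<close> is paired with the only point of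
    \<open>aux_space 0\<close> in order to reuse the encoding.\<close>
  let ?emb = "\<lambda>y :: complex ^ 'r2. ((\<lambda>_. undefined) :: nat \<Rightarrow> complex, y)"
  let ?h2 = "\<lambda>x. G21 *v fst (fst x)" and ?h3a = "\<lambda>x. G31 *v fst (fst x)" and ?h3b = "\<lambda>x. G32 *v snd (fst x)"
  let ?n2 = "noise_ent TYPE(complex ^ 'r2)" and ?na = "noise_ent TYPE(complex ^ 'r3a)"
    and ?nb = "noise_ent TYPE(complex ^ 'r3b)" and ?d = "real (min CARD('t1) CARD('r2))"
  have P: "power_constraint P F fst" "power_constraint P F snd"
    using F by (simp_all add: cutset_inputs_def)
  have PH: "power_constraint P ?H (\<lambda>x. fst (fst x))" "power_constraint P ?H (\<lambda>x. snd (fst x))"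
    using P power_constraint_distr[of fst ?H F fst P] power_constraint_distr[of fst ?H F snd P]
    by (simp_all add: gaussian.distr_pair_fst)
  interpret FG: pair_prob_space F "gaussian :: (complex ^ 'r2) measure" ..
  interpret H: rfd ?H G21 G31 G32 "\<lambda>x. fst (fst x)" "\<lambda>x. snd (fst x)"
    by standard (simp_all add: power_constraint_integrable[OF PH(1)] power_constraint_integrable[OF PH(2)])
  have U[measurable]: "?U \<in> borel_measurable ?H" by simp
  have emb[measurable]: "?emb \<in> measurable borel ?N"
    by (intro measurable_Pair measurable_const) (simp_all add: space_PiM)
  have W: "(\<lambda>x. ?emb (?U x)) \<in> measurable ?H ?N" by simp
  obtain e :: "(nat \<Rightarrow> complex) \<times> (complex ^ 'r2) \<Rightarrow> nat \<Rightarrow> complex" and d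
    where e: "e \<in> measurable ?N (aux_space (0 + CARD('r2)))" "d \<in> measurable (aux_space (0 + CARD('r2))) ?N"
      "\<And>x. x \<in> space ?N \<Longrightarrow> d (e x) = x"
    using aux_space_encoding[where 'n='r2 and m=0] by blast
  obtain F' where F': "F' \<in> npdf_inputs P (0 + CARD('r2))" and rate: "min
    ((ent0 ?H ?h3a + ent0 ?H ?h3b - noise_ent TYPE((complex ^ 'r3a) \<times> (complex ^ 'r3b))) / ln 2)
    ((ent0 ?H ?h2 - ent ?H ?N ?h2 (\<lambda>x. ?emb (?U x)) + ent ?H ?N ?h3a (\<lambda>x. ?emb (?U x)) - ?na) / ln 2)
    \<le> pdf_rate G21 G31 G32 (0 + CARD('r2)) F'"
    by (rule npdf_achieves[OF FG.prob_space_axioms H.X1 H.X2 PH W e(1,2), of G31 G32 G21]) (use e(3) in auto)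
  have inj: "ent ?H ?N ?h2 (\<lambda>x. ?emb (?U x)) = ent ?H borel ?h2 ?U"
    "ent ?H ?N ?h3a (\<lambda>x. ?emb (?U x)) = ent ?H borel ?h3a ?U"
    using awgn.ent_injection[OF H.awgn_g2[OF U] emb, of snd] awgn.ent_injection[OF H.awgn_g3a[OF U] emb, of snd]
    by simp_all
  have marg: "ent0 ?H (\<lambda>x. f (fst x)) = ent0 F f" if "f \<in> borel_measurable F" for f :: "_ \<Rightarrow> 'z::euclidean_space"
    using ent_distr[of fst ?H F f "\<lambda>_. ()" "count_space UNIV"] that by (simp add: gaussian.distr_pair_fst)
  have m: "ent0 ?H ?h2 = ent0 F g2" "ent0 ?H ?h3a = ent0 F g3a" "ent0 ?H ?h3b = ent0 F g3b"
    using marg[of g2] marg[of g3a] marg[of g3b] by simp_all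
  have gap: "ent ?H borel ?h2 ?U \<le> ?n2 + ?d * ln 2"
  proof -
    obtain B where B: "finite B" "pairwise orthogonal B" "\<forall>b\<in>B. norm b = 1"
      and card: "card B \<le> DIM(complex ^ 't1)" "card B \<le> DIM(complex ^ 'r2)"
      and sp: "\<forall>x. (\<Sum>b\<in>B. ((G21 *v x) \<bullet> b) *\<^sub>R b) = G21 *v x"
      using orthonormal_range_basis[of G21] by blast
    have a: "awgn0 F g2" by (rule awgn_g2) simp
    \<comment> \<open>The estimate is used with the dimension taken from the input space and from
      the relay space. In each case 2n real dimensions at ln (sqrt 2) give n ln 2.\<close>
    show ?thesis
      using ent_gap_le[OF a B(1,2) bspec[OF B(3)] card(1) spec[OF sp]]
        ent_gap_le[OF a B(1,2) bspec[OF B(3)] card(2) spec[OF sp]]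
      by (simp add: min_def ln_sqrt)
  qed
  have chain: "ent F borel g snd \<le> ent0 F g2 + ent ?H borel ?h3a ?U + ?nb"
  proof -
    let ?V = "\<lambda>x. (?U x, snd (fst x))"
    have V: "?V \<in> measurable ?H (borel \<Otimes>\<^sub>M borel)" by simp
    \<comment> \<open>The relay output made into side information by the chain rule is the very
      expression \<open>?U\<close>.\<close>
    have "ent F borel g snd \<le> ent F borel g2 snd + ent ?H (borel \<Otimes>\<^sub>M borel) H.g3 ?V"
      using ent_chain_le[OF awgn_g[OF X2]] by simp
    moreover have "ent F borel g2 snd \<le> ent0 F g2" by (rule awgn.ent_le_ent0[OF awgn_g2[OF X2]])
    moreover have "ent ?H (borel \<Otimes>\<^sub>M borel) H.g3 ?V \<le> ent ?H (borel \<Otimes>\<^sub>M borel) ?h3a ?V + ?nb"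
      using H.ent_g3_given_le[OF V, of snd] by simp
    moreover have "ent ?H (borel \<Otimes>\<^sub>M borel) ?h3a ?V \<le> ent ?H borel ?h3a ?U"
      using awgn.ent_le_comp[OF H.awgn_g3a[OF V], of fst borel] by simp
    ultimately show ?thesis by simp
  qed
  let ?a = "(ent0 F g3 - noise_ent TYPE((complex ^ 'r3a) \<times> (complex ^ 'r3b))) / ln 2"
    and ?a' = "(ent0 F g3a + ent0 F g3b - noise_ent TYPE((complex ^ 'r3a) \<times> (complex ^ 'r3b))) / ln 2"
    and ?b = "(ent F borel g snd - noise_ent TYPE((complex ^ 'r2) \<times> (complex ^ 'r3a) \<times> (complex ^ 'r3b))) / ln 2"
    and ?b' = "(ent0 F g2 - ent ?H borel ?h2 ?U + ent ?H borel ?h3a ?U - ?na) / ln 2"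
  have "?a \<le> ?a'" using ent0_g3_le by (intro divide_right_mono) simp_all
  moreover have "?b \<le> ?b' + ?d"
  proof -
    have "?b \<le> (ent0 F g2 - ent ?H borel ?h2 ?U + ent ?H borel ?h3a ?U - ?na + ?d * ln 2) / ln 2"
      using gap chain by (intro divide_right_mono) (simp_all add: noise_ent_prod)
    then show ?thesis by (simp add: add_divide_distrib)
  qed
  \<comment> \<open>Being nonnegative, the gap may be added to the first term as well, which lets it
    leave the minimum.\<close>
  moreover have "?d \<ge> 0" by simp
  ultimately have "cutset_rate G21 G31 G32 F \<le> min ?a' ?b' + ?d"
    unfolding cutset_rate_eq[OF F] by linarith
  also have "\<dots> \<le> pdf_rate G21 G31 G32 (0 + CARD('r2)) F' + ?d"
    using rate unfolding inj m by simp
  finally have "ereal (cutset_rate G21 G31 G32 F) \<le> ereal (pdf_rate G21 G31 G32 (0 + CARD('r2)) F') + ereal ?d"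
    by simp
  also have "\<dots> \<le> R_NPDF G21 G31 G32 P + ereal ?d"
    by (intro add_right_mono npdf_rate_le_R_NPDF[OF F'])
  finally show ?thesis .
qed

section \<open>Finiteness of the cutset bound\<close>

lemma integral_matrix_vector_square_le:
  fixes A :: "complex ^ 't::finite ^ 'r::finite"
  assumes pc: "power_constraint P F X" and X[measurable]: "X \<in> borel_measurable F" and P: "P \<ge> 0"
  shows "(\<integral>w. (norm (A *v X w))\<^sup>2 \<partial>F) \<le> (onorm ((*v) A))\<^sup>2 * P"
proof -
  note i = power_constraint_integrable[OF pc X]
  have "ennreal (\<integral>w. (norm (X w))\<^sup>2 \<partial>F) \<le> ennreal P"
    using pc i by (simp add: nn_integral_eq_integral power_constraint_def)
  then have le: "(\<integral>w. (norm (X w))\<^sup>2 \<partial>F) \<le> P" using P by simp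
  have "(norm (A *v X w))\<^sup>2 \<le> (onorm ((*v) A) * norm (X w))\<^sup>2" for w
    by (intro power_mono onorm matrix_vector_mul_bounded_linear) simp
  then have "(\<integral>w. (norm (A *v X w))\<^sup>2 \<partial>F) \<le> (\<integral>w. (onorm ((*v) A))\<^sup>2 * (norm (X w))\<^sup>2 \<partial>F)"
    by (intro integral_mono integrable_matrix_vector_square X i integrable_mult_right)
       (simp add: power_mult_distrib)
  also have "\<dots> \<le> (onorm ((*v) A))\<^sup>2 * P" using le by (simp add: mult_left_mono)
  finally show ?thesis .
qed

text \<open>In \<open>ereal\<close> the difference \<infinity> - \<infinity> is \<infinity>, so the
  comparison of the bounds yields a gap only once the cutset bound is finite. Its first term alone
  is bounded in terms of the power and the channel matrices.\<close>

lemma R_CS_less_infinity: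
  fixes G21 :: "complex ^ 't1::finite ^ 'r2::finite"
    and G31 :: "complex ^ 't1 ^ 'r3a::finite"
    and G32 :: "complex ^ 't2::finite ^ 'r3b::finite"
  assumes P: "P \<ge> 0"
  shows "R_CS G21 G31 G32 P < \<infinity>"
proof -
  define C where "C = (real DIM((complex ^ 'r3a) \<times> (complex ^ 'r3b)) * ln (sqrt pi)
    + 2 * ((onorm ((*v) G31))\<^sup>2 * P + (onorm ((*v) G32))\<^sup>2 * P)
    + 2 * (\<integral>z. (norm (z :: (complex ^ 'r3a) \<times> (complex ^ 'r3b)))\<^sup>2 \<partial>gaussian)
    - noise_ent TYPE((complex ^ 'r3a) \<times> (complex ^ 'r3b))) / ln 2"
  have "cutset_rate G21 G31 G32 F \<le> C" if F: "F \<in> cutset_inputs P" for F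
  proof -
    interpret rfd F G21 G31 G32 fst snd by (rule rfd_cutset_inputs[OF F])
    have pc: "power_constraint P F fst" "power_constraint P F snd"
      using F by (simp_all add: cutset_inputs_def)
    have a: "awgn0 F g3" by (rule awgn_g3) simp
    have "(\<integral>w. (norm (g3 w))\<^sup>2 \<partial>F) = (\<integral>w. (norm (g3a w))\<^sup>2 \<partial>F) + (\<integral>w. (norm (g3b w))\<^sup>2 \<partial>F)"
      by (simp add: norm_Pair integrable_matrix_vector_square X1_square X2_square)
    also have "\<dots> \<le> (onorm ((*v) G31))\<^sup>2 * P + (onorm ((*v) G32))\<^sup>2 * P"
      by (intro add_mono integral_matrix_vector_square_le pc X1 X2 P)
    finally have "ent0 F g3 - noise_ent TYPE((complex ^ 'r3a) \<times> (complex ^ 'r3b)) \<le> C * ln 2"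
      using ent0_le[OF a] by (simp add: C_def)
    then have "(ent0 F g3 - noise_ent TYPE((complex ^ 'r3a) \<times> (complex ^ 'r3b))) / ln 2 \<le> C"
      by (simp add: pos_divide_le_eq)
    then show ?thesis unfolding cutset_rate_eq[OF F] by simp
  qed
  then have "R_CS G21 G31 G32 P \<le> ereal C"
    unfolding R_CS_def by (intro SUP_least) simp
  then show ?thesis by (rule le_less_trans) simp
qed

text \<open>The all-zero input keeps the supremum of the cutset rates above - \<infinity>.\<close>

lemma cutset_inputs_nonempty:
  "return (borel \<Otimes>\<^sub>M borel) (0, 0) \<in> (cutset_inputs P :: ((complex ^ 't1::finite) \<times> (complex ^ 't2::finite)) measure set)"
  by (auto simp: cutset_inputs_def power_constraint_def nn_integral_return space_pair_measure intro!: prob_space_return)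

theorem proposition13:
  fixes G21 :: "complex ^ ('t1::finite) ^ ('r2::finite)"
    and G31 :: "complex ^ 't1 ^ ('r3a::finite)"
    and G32 :: "complex ^ ('t2::finite) ^ ('r3b::finite)"
    and P :: real
  assumes "P > 0"
  shows "R_PDF G21 G31 G32 P = R_NPDF G21 G31 G32 P \<and>
         \<Delta>_PDF G21 G31 G32 P = \<Delta>_NPDF G21 G31 G32 P \<and>
         \<Delta>_NPDF G21 G31 G32 P \<le> ereal (real (min CARD('t1) CARD('r2)))"
proof -
  have "R_PDF G21 G31 G32 P \<le> R_NPDF G21 G31 G32 P"
    unfolding R_PDF_def by (intro SUP_least pdf_rate_le_R_NPDF)
  moreover have "R_NPDF G21 G31 G32 P \<le> R_PDF G21 G31 G32 P"
    unfolding R_PDF_def R_NPDF_def by (intro SUP_mono' SUP_subset_mono) (auto simp: npdf_inputs_def)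
  ultimately have eq: "R_PDF G21 G31 G32 P = R_NPDF G21 G31 G32 P" by (rule antisym)
  let ?C = "R_CS G21 G31 G32 P" and ?R = "R_NPDF G21 G31 G32 P" and ?d = "real (min CARD('t1) CARD('r2))"
  have le: "?C \<le> ?R + ereal ?d"
    unfolding R_CS_def by (intro SUP_least cutset_rate_le_R_NPDF)
  have "?C < \<infinity>" by (rule R_CS_less_infinity) (use assms in simp)
  moreover have "- \<infinity> < ?C"
    unfolding R_CS_def by (rule less_le_trans[OF _ SUP_upper[OF cutset_inputs_nonempty]]) simp
  ultimately obtain c where c: "?C = ereal c" by (cases ?C) auto
  \<comment> \<open>With \<open>?C\<close> finite, \<open>?R = - \<infinity>\<close> contradicts
    \<open>le\<close>, and \<open>?R = \<infinity>\<close> makes the difference -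
    \<infinity>.\<close>
  have "?C - ?R \<le> ereal ?d"
    using le unfolding c by (cases ?R) auto
  then show ?thesis by (simp add: eq \<Delta>_PDF_def \<Delta>_NPDF_def)
qed

end
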